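(* Enforcing domain consistency on the \textsc{RegularGcc} matrix constraint is fixed-parameter tractable in the parameter $k=r\cdot\log Q$, where $r$ is the number of rows of the matrix and $Q$ is the maximum number of states of any row automaton.
   Context: An instance of \textsc{RegularGcc} consists of a matrix of finite-domain decision variables in which each row must be accepted by a given deterministic finite automaton (\textsc{Regular} constraint) and each column is subject to a global cardinality constraint \textsc{Gcc}, prescribing for each value $v$ lower and/or upper bounds on the number of occurrences of $v$ in that column. Domain consistency (DC): every value in every domain extends to a solution; enforcing DC means removing all values that do not. A problem is fixed-parameter tractable in parameter $k$ if it can be solved in time $f(k)\cdot p(n)$ for some computable function $f$ and polynomial $p$ in the input size $n$. *)

theory Defs
  imports Complex_Main
begin

text \<open>Registers hold natural numbers; arithmetic is addition and truncated
subtraction (unit cost), with indirect addressing.  This model is polynomially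
equivalent to Turing machines.  The program halts when the program counter
leaves the program.\<close>

datatype instr =
    Const nat nat
  | Add nat nat nat
  | Sub nat nat nat
  | Load nat nat
  | Store nat nat
  | Jz nat nat

type_synonym prog = "instr list"
type_synonym config = "nat \<times> (nat \<Rightarrow> nat)"

definition halted :: "prog \<Rightarrow> config \<Rightarrow> bool" where
  "halted P s \<longleftrightarrow> length P \<le> fst s"

fun exec_instr :: "instr \<Rightarrow> config \<Rightarrow> config" where
  "exec_instr (Const r c) (pc, m) = (Suc pc, m(r := c))"
| "exec_instr (Add r a b) (pc, m) = (Suc pc, m(r := m a + m b))"
| "exec_instr (Sub r a b) (pc, m) = (Suc pc, m(r := m a - m b))"
| "exec_instr (Load r a) (pc, m) = (Suc pc, m(r := m (m a)))"
| "exec_instr (Store a r) (pc, m) = (Suc pc, m(m a := m r))"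
| "exec_instr (Jz r l) (pc, m) = (if m r = 0 then l else Suc pc, m)"

definition step :: "prog \<Rightarrow> config \<Rightarrow> config" where
  "step P s = (if halted P s then s else exec_instr (P ! fst s) s)"

definition exec :: "prog \<Rightarrow> nat \<Rightarrow> config \<Rightarrow> config" where
  "exec P t s = (step P ^^ t) s"

definition init_config :: "nat list \<Rightarrow> config" where
  "init_config xs = (0, \<lambda>a. if a = 0 then length xs
                            else if a \<le> length xs then xs ! (a - 1) else 0)"

definition output_of :: "config \<Rightarrow> nat list" where
  "output_of s = map (\<lambda>i. snd s (Suc i)) [0..<snd s 0]"

definition computes_within :: "prog \<Rightarrow> nat list \<Rightarrow> nat list \<Rightarrow> nat \<Rightarrow> bool" where
  "computes_within P xs ys t \<longleftrightarrow>
     (\<exists>t' \<le> t. halted P (exec P t' (init_config xs)) \<and>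
               output_of (exec P t' (init_config xs)) = ys)"

definition computable_fun :: "(nat \<Rightarrow> nat) \<Rightarrow> bool" where
  "computable_fun f \<longleftrightarrow> (\<exists>P. \<forall>x. \<exists>t. computes_within P [x] [f x] t)"

fun bitlen :: "nat \<Rightarrow> nat" where
  "bitlen x = (if x \<le> 1 then 1 else Suc (bitlen (x div 2)))"

definition enc_size :: "nat list \<Rightarrow> nat" where
  "enc_size xs = sum_list (map bitlen xs)"

record dfa =
  nst   :: nat                     (* states are 0..<nst *)
  start :: nat
  fins  :: "nat list"
  trans :: "(nat \<times> nat \<times> nat) list"   (* (q, a, q') *)

definition dfa_wf :: "dfa \<Rightarrow> bool" where
  "dfa_wf A \<longleftrightarrow> start A < nst A \<and> (\<forall>q \<in> set (fins A). q < nst A)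
     \<and> (\<forall>(q,a,q') \<in> set (trans A). q < nst A \<and> q' < nst A)
     \<and> distinct (map (\<lambda>(q,a,q'). (q,a)) (trans A))"

definition delta :: "dfa \<Rightarrow> nat \<Rightarrow> nat \<Rightarrow> nat option" where
  "delta A q a = map_option (\<lambda>(_,_,q'). q') (find (\<lambda>(p,b,_). p = q \<and> b = a) (trans A))"

fun run :: "dfa \<Rightarrow> nat option \<Rightarrow> nat list \<Rightarrow> nat option" where
  "run A None w = None"
| "run A (Some q) [] = Some q"
| "run A (Some q) (a # w) = run A (delta A q a) w"

definition accepts :: "dfa \<Rightarrow> nat list \<Rightarrow> bool" where
  "accepts A w \<longleftrightarrow> (case run A (Some (start A)) w of None \<Rightarrow> False | Some q \<Rightarrow> q \<in> set (fins A))"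

text \<open>A column cardinality constraint item (v, lo, hi): the number of
occurrences of value v in the column is at least lo and, if hi = Some h, at
most h.  A Gcc on a column is a list of such items.\<close>

type_synonym gcc_item = "nat \<times> nat \<times> nat option"

record rgcc =
  doms :: "nat list list list"     (* doms ! i ! j = domain of X i j *)
  auts :: "dfa list"               (* automaton of row i *)
  gccs :: "gcc_item list list"     (* Gcc of column j *)

definition nrows :: "rgcc \<Rightarrow> nat" where "nrows I = length (auts I)"
definition ncols :: "rgcc \<Rightarrow> nat" where "ncols I = length (gccs I)"

definition inst_wf :: "rgcc \<Rightarrow> bool" where
  "inst_wf I \<longleftrightarrow> length (doms I) = nrows I
     \<and> (\<forall>i < nrows I. length (doms I ! i) = ncols I)
     \<and> (\<forall>A \<in> set (auts I). dfa_wf A)"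

definition is_solution :: "rgcc \<Rightarrow> (nat \<Rightarrow> nat \<Rightarrow> nat) \<Rightarrow> bool" where
  "is_solution I X \<longleftrightarrow>
     (\<forall>i < nrows I. \<forall>j < ncols I. X i j \<in> set (doms I ! i ! j))
   \<and> (\<forall>i < nrows I. accepts (auts I ! i) (map (X i) [0..<ncols I]))
   \<and> (\<forall>j < ncols I. \<forall>(v, lo, hi) \<in> set (gccs I ! j).
        let c = card {i. i < nrows I \<and> X i j = v} in
        lo \<le> c \<and> (case hi of None \<Rightarrow> True | Some h \<Rightarrow> c \<le> h))"

definition dc_domains :: "rgcc \<Rightarrow> nat list list list" where
  "dc_domains I = map (\<lambda>i. map (\<lambda>j.
       filter (\<lambda>v. \<exists>X. is_solution I X \<and> X i j = v) (doms I ! i ! j))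
     [0..<ncols I]) [0..<nrows I]"

definition maxQ :: "rgcc \<Rightarrow> nat" where
  "maxQ I = Max (insert 1 (nst ` set (auts I)))"

definition param :: "rgcc \<Rightarrow> nat" where
  "param I = nat \<lceil>real (nrows I) * log 2 (real (maxQ I))\<rceil>"

definition enc_list :: "('a \<Rightarrow> nat list) \<Rightarrow> 'a list \<Rightarrow> nat list" where
  "enc_list e xs = length xs # concat (map e xs)"

definition enc_nats :: "nat list \<Rightarrow> nat list" where
  "enc_nats xs = length xs # xs"

definition enc_dfa :: "dfa \<Rightarrow> nat list" where
  "enc_dfa A = [nst A, start A] @ enc_nats (fins A)
               @ enc_list (\<lambda>(q,a,q'). [q,a,q']) (trans A)"

definition enc_item :: "gcc_item \<Rightarrow> nat list" where
  "enc_item c = (case c of (v, lo, hi) \<Rightarrow>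
                   [v, lo, (case hi of None \<Rightarrow> 0 | Some h \<Rightarrow> Suc h)])"

definition enc_doms :: "nat list list list \<Rightarrow> nat list" where
  "enc_doms D = enc_list (enc_list enc_nats) D"

definition enc_inst :: "rgcc \<Rightarrow> nat list" where
  "enc_inst I = enc_doms (doms I) @ enc_list enc_dfa (auts I)
                @ enc_list (enc_list enc_item) (gccs I)"

definition inst_size :: "rgcc \<Rightarrow> nat" where
  "inst_size I = enc_size (enc_inst I)"

end

(* Every row automaton is restricted to the states it mentions, at most Q of them, so there are
   at most Q^r <= 2^k vectors of row states.  The vectors reachable after j columns are computed
   from left to right.  Whether a column can take one vector to another is a matching problem
   between rows and values with lower and upper quotas.  It must be solved in time polynomial in
   r, because for Q = 1 the parameter is 0 whatever r is; this is done by local search along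
   augmenting paths.  A value is kept if the instance with that domain reduced to this value is
   solvable.

   To get a machine program out of this, functional programs on numbers, pairs and lists are
   compiled to the register machine by closure properties (composition, branching, folds) of
   the functions computable in time polynomial in a measure of the argument.  Since the measure
   of the whole algorithm is the input size plus the number of vectors, polynomial time in it is
   fixed-parameter tractability. *)

theory Submission
  imports Defs
begin

section \<open>A structured language compiled to the register machine\<close>

text \<open>The machine charges one unit per addition, so the measure \<open>sz\<close> counts
  memory cells and every number weighs one. A loop may therefore run over a list but not up to a
  number, which is why the states of an automaton are read off its transition table instead of being
  enumerated below \<open>nst\<close>. The notion of polynomial time carries no precondition, so all
  bounds hold for arbitrary arguments, including lists that encode nothing.

  The matching search keeps a value for every row and decreases the total violation of the quotas.
  Compared with a feasible assignment, some value occurs too often, some other too rarely, and a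
  path of row changes leads from the first to the second. Moving one occurrence along it brings both
  counts closer to feasible ones, so no quota gets worse and one improves. If a feasible assignment
  exists, each item is initially violated by at most twice the number of rows, however large the
  quotas are as numbers; hence polynomially many rounds suffice.\<close>

type_synonym mem = "nat \<Rightarrow> nat"

fun straight :: "instr \<Rightarrow> bool" where
  "straight (Jz _ _) = False"
| "straight _ = True"

definition act :: "instr \<Rightarrow> mem \<Rightarrow> mem" where
  "act i m = snd (exec_instr i (0, m))"

lemma act_simps [simp]:
  "act (Const r c) m = m(r := c)"
  "act (Add r a b) m = m(r := m a + m b)"
  "act (Sub r a b) m = m(r := m a - m b)"
  "act (Load r a) m = m(r := m (m a))"
  "act (Store a r) m = m(m a := m r)"
  by (simp_all add: act_def)

lemma exec_straight: "straight i \<Longrightarrow> exec_instr i (pc, m) = (Suc pc, act i m)"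
  by (cases i) (simp_all add: act_def)

text \<open>There is no unconditional jump, so compiled branches and loops reset register 1
  to zero and jump on it; the big-step semantics makes this side effect visible.\<close>

datatype com = Block "instr list" | Seq com com (infixr ";;" 60) | Cond nat com com | While nat com

primrec clen :: "com \<Rightarrow> nat" where
  "clen (Block is) = length is"
| "clen (Seq a b) = clen a + clen b"
| "clen (Cond r a b) = clen a + clen b + 3"
| "clen (While r c) = clen c + 3"

primrec compile :: "com \<Rightarrow> nat \<Rightarrow> prog" where
  "compile (Block is) l = is"
| "compile (Seq a b) l = compile a l @ compile b (l + clen a)"
| "compile (Cond r a b) l =
     Jz r (l + clen b + 3) # compile b (Suc l) @ [Const 1 0, Jz 1 (l + clen a + clen b + 3)]
     @ compile a (l + clen b + 3)"
| "compile (While r c) l =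
     Jz r (l + clen c + 3) # compile c (Suc l) @ [Const 1 0, Jz 1 l]"

lemma length_compile [simp]: "length (compile c l) = clen c"
  by (induction c arbitrary: l) auto

text \<open>The step counts are exact for the layout chosen by \<open>compile\<close>. The zero
  branch of \<open>Cond\<close> is placed last and costs only the test; the other branch has to jump
  over it, and a loop body has to jump back, which takes a reset of register 1 and a jump besides
  the test.\<close>

inductive bs :: "com \<Rightarrow> mem \<Rightarrow> nat \<Rightarrow> mem \<Rightarrow> bool" where
  Block: "list_all straight is \<Longrightarrow> bs (Block is) m (length is) (fold act is m)"
| Seq: "bs a m s m' \<Longrightarrow> bs b m' t m'' \<Longrightarrow> bs (Seq a b) m (s + t) m''"
| Cond0: "m r = 0 \<Longrightarrow> bs a m t m' \<Longrightarrow> bs (Cond r a b) m (t + 1) m'"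
| Cond1: "m r \<noteq> 0 \<Longrightarrow> bs b m t m' \<Longrightarrow> bs (Cond r a b) m (t + 3) (m'(1 := 0))"
| While0: "m r = 0 \<Longrightarrow> bs (While r c) m 1 m"
| While1: "m r \<noteq> 0 \<Longrightarrow> bs c m s m' \<Longrightarrow> bs (While r c) (m'(1 := 0)) t m''
    \<Longrightarrow> bs (While r c) m (s + t + 3) m''"

definition code_at :: "prog \<Rightarrow> nat \<Rightarrow> prog \<Rightarrow> bool" where
  "code_at P l c \<longleftrightarrow> (\<exists>pre post. P = pre @ c @ post \<and> length pre = l)"

lemma code_at_append:
  assumes "code_at P l (a @ b)" shows "code_at P l a" "code_at P (l + length a) b"
proof -
  obtain pre post where "P = pre @ (a @ b) @ post" "length pre = l"
    using assms by (auto simp: code_at_def)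
  then have "P = pre @ a @ (b @ post)" "P = (pre @ a) @ b @ post" "length (pre @ a) = l + length a"
    by auto
  with \<open>length pre = l\<close> show "code_at P l a" "code_at P (l + length a) b"
    unfolding code_at_def by blast+
qed

lemma code_at_Cons:
  assumes "code_at P l (i # c)" shows "l < length P" "P ! l = i" "code_at P (Suc l) c"
  using assms code_at_append(2)[of P l "[i]" c]
  by (auto simp: code_at_def nth_append simp del: append_Cons)
    (auto simp: nth_append)

lemma exec_add: "exec P (s + t) x = exec P t (exec P s x)"
  by (simp add: exec_def funpow_add add.commute[of s t])

lemma exec_1: "exec P 1 x = step P x"
  by (simp add: exec_def)

lemma exec_Suc: "exec P (Suc t) x = exec P t (step P x)"
  by (simp add: exec_def funpow_swap1)

lemma step_code:
  "l < length P \<Longrightarrow> step P (l, m) = exec_instr (P ! l) (l, m)"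
  by (simp add: step_def halted_def)

lemma exec_block:
  assumes "list_all straight is" "code_at P l is"
  shows "exec P (length is) (l, m) = (l + length is, fold act is m)"
  using assms
proof (induction "is" arbitrary: l m)
  case Nil
  then show ?case by (simp add: exec_def)
next
  case (Cons i "is")
  note c = code_at_Cons[OF Cons.prems(2)]
  show ?case
    using Cons c by (simp add: exec_Suc step_code exec_straight)
qed

lemma exec_reset_jump:
  assumes "code_at P l [Const 1 0, Jz 1 l']"
  shows "exec P 2 (l, m) = (l', m(1 := 0))"
proof -
  note c = code_at_Cons[OF assms]
  note c2 = code_at_Cons[OF c(3)]
  have "exec P 2 (l, m) = step P (step P (l, m))"
    by (simp add: exec_def numeral_2_eq_2)
  then show ?thesis using c c2 by (simp add: step_code)
qed

text \<open>Since the step counts of \<open>bs\<close> are exact, the phases of a command are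
  chained by \<open>exec_add\<close> alone; inequalities enter only in later layers.\<close>

theorem compile_correct:
  assumes "bs c m t m'" "code_at P l (compile c l)"
  shows "exec P t (l, m) = (l + clen c, m')"
  using assms
proof (induction arbitrary: l rule: bs.induct)
  case (Block "is" m)
  then show ?case by (simp add: exec_block)
next
  case (Seq a m s m' b t m'')
  then show ?case
    using code_at_append[of P l "compile a l" "compile b (l + clen a)"]
    by (simp add: exec_add)
next
  case (Cond0 m r a t m' b)
  let ?l = "l + clen b + 3"
  note p = Cond0.prems[unfolded compile.simps]
  note c = code_at_Cons[OF p]
  have "code_at P ?l (compile a ?l)"
    using code_at_append(2)[OF code_at_append(2)[OF c(3)]] by (simp add: add_ac eval_nat_numeral)
  then have "exec P t (?l, m) = (l + clen (Cond r a b), m')"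
    using Cond0.IH by simp
  then show ?case
    using c Cond0.hyps by (simp add: exec_Suc step_code)
next
  case (Cond1 m r b t m' a)
  let ?e = "[Const 1 0, Jz 1 (l + clen a + clen b + 3)]"
  note p = Cond1.prems[unfolded compile.simps]
  note c = code_at_Cons[OF p]
  note c2 = code_at_append[OF c(3)]
  have j: "code_at P (Suc l + clen b) ?e"
    using code_at_append(1)[OF c2(2)] by simp
  have "exec P t (Suc l, m) = (Suc l + clen b, m')"
    using Cond1.IH c2(1) by simp
  moreover have "exec P 2 (Suc l + clen b, m') = (l + clen (Cond r a b), m'(1 := 0))"
    using exec_reset_jump[OF j] by simp
  moreover have "exec P 1 (l, m) = (Suc l, m)"
    using c Cond1.hyps by (simp add: exec_1[simplified] exec_1 step_code)
  ultimately have "exec P (1 + (t + 2)) (l, m) = (l + clen (Cond r a b), m'(1 := 0))"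
    by (simp only: exec_add)
  then show ?case by (simp add: eval_nat_numeral fun_upd_def)
next
  case (While0 m r c)
  then show ?case
    using code_at_Cons[of P l] by (simp add: exec_1[simplified] exec_1 step_code)
next
  case (While1 m r c s m' t m'')
  note p = While1.prems[unfolded compile.simps]
  note c = code_at_Cons[OF p]
  note c2 = code_at_append[OF c(3)]
  have j: "code_at P (Suc l + clen c) [Const 1 0, Jz 1 l]"
    using c2(2) by simp
  have "exec P 1 (l, m) = (Suc l, m)"
    using c While1.hyps by (simp add: exec_1[simplified] exec_1 step_code)
  moreover have "exec P s (Suc l, m) = (Suc l + clen c, m')"
    using While1.IH(1) c2(1) by simp
  moreover have "exec P 2 (Suc l + clen c, m') = (l, m'(1 := 0))"
    using exec_reset_jump[OF j] by simp
  moreover have "exec P t (l, m'(1 := 0)) = (l + clen (While r c), m'')"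
    using While1.IH(2) While1.prems by (simp add: fun_upd_def)
  ultimately have "exec P (1 + (s + (2 + t))) (l, m) = (l + clen (While r c), m'')"
    by (simp only: exec_add)
  then show ?case by (simp add: eval_nat_numeral add_ac)
qed

lemma bs_computes:
  assumes "bs c (snd (init_config xs)) t m" "output_of (clen c, m) = ys" "t \<le> T"
  shows "computes_within (compile c 0) xs ys T"
proof -
  have "code_at (compile c 0) 0 (compile c 0)"
    by (force simp: code_at_def)
  then have "exec (compile c 0) t (init_config xs) = (clen c, m)"
    using compile_correct[OF assms(1), of _ 0] by (simp add: init_config_def)
  then show ?thesis
    using assms(2,3) by (auto simp: computes_within_def halted_def)
qed

lemma bs_BlockI:
  "list_all straight is \<Longrightarrow> fold act is m = m' \<Longrightarrow> length is = t \<Longrightarrow> bs (Block is) m t m'"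
  using bs.Block by blast

section \<open>Polynomial bounds\<close>

text \<open>The base \<open>mu x + 2\<close> is at least two, so constant factors and summands are
  absorbed into the exponent and one number \<open>k\<close> witnesses the bound.\<close>

definition pb :: "('a \<Rightarrow> nat) \<Rightarrow> ('a \<Rightarrow> nat) \<Rightarrow> bool" where
  "pb mu g \<longleftrightarrow> (\<exists>k. \<forall>x. g x \<le> (mu x + 2) ^ k)"

lemma pb_mono: "pb mu g \<Longrightarrow> (\<And>x. h x \<le> g x) \<Longrightarrow> pb mu h"
  unfolding pb_def by (meson order_trans)

lemma pb_weaken: "pb mu g \<Longrightarrow> (\<And>x. mu x \<le> nu x) \<Longrightarrow> pb nu g"
  unfolding pb_def by (meson add_right_mono order_trans power_mono zero_le)

lemma pb_self: "pb mu mu"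
  unfolding pb_def by (intro exI[of _ 1]) simp

lemma pb_const: "pb mu (\<lambda>_. c)"
proof -
  have "c \<le> (mu x + 2) ^ c" for x
    using less_exp[of c] power_mono[of 2 "mu x + 2" c] by linarith
  then show ?thesis unfolding pb_def by blast
qed

lemma pb_mult:
  assumes "pb mu g" "pb mu h" shows "pb mu (\<lambda>x. g x * h x)"
proof -
  obtain a b where "\<And>x. g x \<le> (mu x + 2) ^ a" "\<And>x. h x \<le> (mu x + 2) ^ b"
    using assms unfolding pb_def by blast
  then have "g x * h x \<le> (mu x + 2) ^ (a + b)" for x
    by (metis mult_le_mono power_add)
  then show ?thesis unfolding pb_def by blast
qed

lemma pb_add:
  assumes "pb mu g" "pb mu h" shows "pb mu (\<lambda>x. g x + h x)"
proof -
  have "pb mu (\<lambda>x. (g x + 1) * (h x + 1))" if "pb mu (\<lambda>x. g x + 1)" "pb mu (\<lambda>x. h x + 1)"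
    using pb_mult that .
  moreover have "pb mu (\<lambda>x. f x + 1)" if f: "pb mu f" for f
  proof -
    obtain a where a: "\<And>x. f x \<le> (mu x + 2) ^ a"
      using f unfolding pb_def by blast
    have "f x + 1 \<le> (mu x + 2) ^ Suc a" for x
    proof -
      have "1 \<le> (mu x + 2) ^ a" by simp
      then have "f x + 1 \<le> (mu x + 2) ^ a * 2" using a[of x] by linarith
      also have "\<dots> \<le> (mu x + 2) ^ a * (mu x + 2)" by (intro mult_le_mono) auto
      finally show ?thesis by (simp add: mult.commute)
    qed
    then show ?thesis unfolding pb_def by blast
  qed
  ultimately have "pb mu (\<lambda>x. (g x + 1) * (h x + 1))" using assms by blast
  then show ?thesis by (rule pb_mono) simp
qed

lemma pb_comp:
  assumes "pb nu g" "pb mu (\<lambda>x. nu (f x))" shows "pb mu (\<lambda>x. g (f x))"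
proof -
  have "pb mu (\<lambda>x. nu (f x) + 2)"
    by (intro pb_add assms pb_const)
  then obtain b where b: "\<And>x. nu (f x) + 2 \<le> (mu x + 2) ^ b"
    unfolding pb_def by blast
  obtain a where a: "\<And>y. g y \<le> (nu y + 2) ^ a"
    using assms(1) unfolding pb_def by blast
  have "g (f x) \<le> (mu x + 2) ^ (b * a)" for x
    using a[of "f x"] power_mono[OF b, of x a] by (simp add: power_mult)
  then show ?thesis unfolding pb_def by blast
qed

lemmas pb_intros = pb_const pb_self pb_add pb_mult

section \<open>Data structures on the heap\<close>

text \<open>Untyped trees let one heap predicate serve all types. On the heap subtrees may be
  shared, so \<open>vsize\<close> measures the unfolded tree and not the memory that it
  occupies.\<close>

datatype val = Word nat | Cell val val

primrec vsize :: "val \<Rightarrow> nat" where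
  "vsize (Word n) = 1"
| "vsize (Cell a b) = vsize a + vsize b + 1"

class repr =
  fixes repr :: "'a \<Rightarrow> val"

definition sz :: "'a :: repr \<Rightarrow> nat" where
  "sz x = vsize (repr x)"

instantiation nat :: repr begin
definition "repr_nat (n :: nat) = Word n"
instance ..
end

instantiation bool :: repr begin
definition "repr_bool b = Word (if b then 1 else 0)"
instance ..
end

instantiation prod :: (repr, repr) repr begin
definition "repr_prod p = Cell (repr (fst p)) (repr (snd p))"
instance ..
end

text \<open>The empty list is the null pointer; this is unambiguous because the heap starts at
  a positive address.\<close>

instantiation list :: (repr) repr begin
primrec repr_list :: "'a list \<Rightarrow> val" where
  "repr_list [] = Word 0"
| "repr_list (x # xs) = Cell (repr x) (repr_list xs)"
instance ..
end

lemma sz_simps [simp]: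
  "sz (n :: nat) = 1" "sz (b :: bool) = 1" "sz (x, y) = sz x + sz y + 1"
  "sz ([] :: 'a :: repr list) = 1" "sz (a # as) = sz a + sz as + 1"
  by (simp_all add: sz_def repr_nat_def repr_bool_def repr_prod_def)

text \<open>The bounds confine all cells to the allocated part of the heap, so that writes to
  registers below \<open>lo\<close> and to free addresses from \<open>hi\<close> on cannot damage
  the value.\<close>

primrec rp :: "nat \<Rightarrow> nat \<Rightarrow> mem \<Rightarrow> val \<Rightarrow> nat \<Rightarrow> bool" where
  "rp lo hi m (Word n) w \<longleftrightarrow> w = n"
| "rp lo hi m (Cell a b) w \<longleftrightarrow> lo \<le> w \<and> Suc w < hi \<and> rp lo hi m a (m w) \<and> rp lo hi m b (m (Suc w))"

lemma rp_cong:
  "rp lo hi m v w \<Longrightarrow> (\<And>a. lo \<le> a \<Longrightarrow> a < hi \<Longrightarrow> m' a = m a) \<Longrightarrow> hi \<le> hi' \<Longrightarrow> rp lo hi' m' v w"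
  by (induction v arbitrary: w) auto

lemma rp_upd [simp]:
  "r < lo \<or> hi \<le> r \<Longrightarrow> rp lo hi (m(r := z)) v w = rp lo hi m v w"
  by (induction v arbitrary: w) auto

text \<open>Register 0 points to the free part of the heap, which starts at \<open>lo\<close>.  Code at
  depth \<open>d\<close> keeps the registers \<open>2..d\<close> and everything already allocated.\<close>

definition frame :: "nat \<Rightarrow> nat \<Rightarrow> mem \<Rightarrow> mem \<Rightarrow> bool" where
  "frame lo d m m' \<longleftrightarrow> (\<forall>a. 2 \<le> a \<longrightarrow> a \<le> d \<longrightarrow> m' a = m a)
     \<and> (\<forall>a. lo \<le> a \<longrightarrow> a < m 0 \<longrightarrow> m' a = m a) \<and> m 0 \<le> m' 0"

definition holds :: "nat \<Rightarrow> mem \<Rightarrow> val \<Rightarrow> nat \<Rightarrow> bool" where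
  "holds lo m v r \<longleftrightarrow> rp lo (m 0) m v (m r)"

lemma frame_refl: "frame lo d m m"
  by (simp add: frame_def)

lemma frame_trans:
  "frame lo d m m' \<Longrightarrow> frame lo d' m' m'' \<Longrightarrow> d \<le> d' \<Longrightarrow> frame lo d m m''"
  unfolding frame_def by force

lemma holds_frame:
  "holds lo m v r \<Longrightarrow> frame lo d m m' \<Longrightarrow> 2 \<le> r \<Longrightarrow> r \<le> d \<Longrightarrow> holds lo m' v r"
  unfolding holds_def frame_def by (auto intro: rp_cong)

lemma frame_upd:
  "d < r \<or> r = 1 \<Longrightarrow> 0 < r \<Longrightarrow> r < lo \<Longrightarrow> frame lo d m m' \<Longrightarrow> frame lo d m (m'(r := w))"
  unfolding frame_def by auto

lemma frame_reset: "1 < lo \<Longrightarrow> frame lo d m m' \<Longrightarrow> frame lo d m (m'(1 := 0))"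
  by (rule frame_upd) auto

lemma holds_upd:
  "r \<noteq> s \<Longrightarrow> 0 < s \<Longrightarrow> s < lo \<Longrightarrow> holds lo m v r \<Longrightarrow> holds lo (m(s := w)) v r"
  unfolding holds_def by auto

section \<open>Polynomial-time functions\<close>

definition eval_code :: "com \<Rightarrow> nat \<Rightarrow> nat \<Rightarrow> mem \<Rightarrow> nat \<Rightarrow> val \<Rightarrow> bool" where
  "eval_code c lo d m T v \<longleftrightarrow>
     (\<exists>t m'. bs c m t m' \<and> t \<le> T \<and> frame lo d m m' \<and> holds lo m' v (Suc d))"

text \<open>The depth \<open>d\<close> is fixed at compile time: the argument lies in register
  \<open>d\<close>, the result goes to \<open>Suc d\<close>, and the registers above up to the heap
  are scratch. \<open>R\<close> says how much room they need. The size of the result is bounded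
  separately because running time does not control it: by sharing, pairing a value with itself
  repeatedly doubles \<open>sz\<close> in a constant number of steps.\<close>

definition PT :: "('a :: repr \<Rightarrow> nat) \<Rightarrow> ('a \<Rightarrow> 'b :: repr) \<Rightarrow> bool" where
  "PT mu f \<longleftrightarrow> pb mu (\<lambda>x. sz (f x)) \<and> (\<forall>d\<ge>2. \<exists>c R T. pb mu T \<and> d + 2 \<le> R \<and>
     (\<forall>lo m x. R \<le> lo \<longrightarrow> lo \<le> m 0 \<longrightarrow> holds lo m (repr x) d \<longrightarrow>
        eval_code c lo d m (T x) (repr (f x))))"

abbreviation pt :: "('a :: repr \<Rightarrow> 'b :: repr) \<Rightarrow> bool" where
  "pt \<equiv> PT sz"

lemma PT_I:
  assumes "pb mu (\<lambda>x. sz (f x))"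
    and "\<And>d. 2 \<le> d \<Longrightarrow> \<exists>c R T. pb mu T \<and> d + 2 \<le> R \<and>
     (\<forall>lo m x. R \<le> lo \<longrightarrow> lo \<le> m 0 \<longrightarrow> holds lo m (repr x) d \<longrightarrow>
        eval_code c lo d m (T x) (repr (f x)))"
  shows "PT mu f"
  using assms unfolding PT_def by blast

lemma PT_E:
  assumes "PT mu f" "2 \<le> d"
  obtains c R T where "pb mu T" "d + 2 \<le> R"
    "\<And>lo m x. R \<le> lo \<Longrightarrow> lo \<le> m 0 \<Longrightarrow> holds lo m (repr x) d \<Longrightarrow>
        \<exists>t m'. bs c m t m' \<and> t \<le> T x \<and> frame lo d m m' \<and> holds lo m' (repr (f x)) (Suc d)"
  using assms unfolding PT_def eval_code_def by metis

lemma PT_size: "PT mu f \<Longrightarrow> pb mu (\<lambda>x. sz (f x))"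
  by (simp add: PT_def)

lemma PT_weaken: "PT mu f \<Longrightarrow> (\<And>x. mu x \<le> nu x) \<Longrightarrow> PT nu f"
  unfolding PT_def using pb_weaken[of mu _ nu] by meson

lemma PT_block:
  assumes "pb mu (\<lambda>x. sz (f x))"
    and "\<And>d. list_all straight (bl d)"
    and "\<And>d lo m x. 2 \<le> d \<Longrightarrow> d + 2 \<le> lo \<Longrightarrow> lo \<le> m 0 \<Longrightarrow> holds lo m (repr x) d \<Longrightarrow>
      frame lo d m (fold act (bl d) m) \<and> holds lo (fold act (bl d) m) (repr (f x)) (Suc d)"
  shows "PT mu f"
proof (rule PT_I[OF assms(1)], rename_tac d)
  fix d :: nat assume "2 \<le> d"
  then show "\<exists>c R T. pb mu T \<and> d + 2 \<le> R \<and>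
     (\<forall>lo m x. R \<le> lo \<longrightarrow> lo \<le> m 0 \<longrightarrow> holds lo m (repr x) d \<longrightarrow>
        eval_code c lo d m (T x) (repr (f x)))"
    using assms(2,3) unfolding eval_code_def
    by (intro exI[of _ "Block (bl d)"] exI[of _ "d + 2"] exI[of _ "\<lambda>_. length (bl d)"])
      (blast intro: pb_const bs_BlockI)
qed

lemma pt_fst: "pt fst"
  by (rule PT_block[of _ _ "\<lambda>d. [Load (Suc d) d]"])
    (auto simp: sz_def repr_prod_def holds_def frame_def intro: pb_mono[OF pb_self])

lemma pt_snd: "pt snd"
  by (rule PT_block[of _ _ "\<lambda>d. [Const 1 1, Add (Suc d) d 1, Load (Suc d) (Suc d)]"])
    (auto simp: sz_def repr_prod_def holds_def frame_def intro: pb_mono[OF pb_self])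

lemma PT_id: "(\<And>x. sz x \<le> mu x) \<Longrightarrow> PT mu (\<lambda>x. x)"
  by (rule PT_block[of _ _ "\<lambda>d. [Const 1 0, Add (Suc d) d 1]"])
    (auto simp: holds_def frame_def intro: pb_mono[OF pb_self])

lemma PT_comp:
  assumes f: "PT mu f" and g: "PT nu g" and nu: "pb mu (\<lambda>x. nu (f x))"
  shows "PT mu (\<lambda>x. g (f x))"
proof (rule PT_I)
  show "pb mu (\<lambda>x. sz (g (f x)))"
    using pb_comp[OF PT_size[OF g] nu] .
  fix d :: nat assume d: "2 \<le> d"
  obtain c R T where c: "pb mu T" "d + 2 \<le> R"
    "\<And>lo m x. R \<le> lo \<Longrightarrow> lo \<le> m 0 \<Longrightarrow> holds lo m (repr x) d \<Longrightarrow>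
        \<exists>t m'. bs c m t m' \<and> t \<le> T x \<and> frame lo d m m' \<and> holds lo m' (repr (f x)) (Suc d)"
    using f d by (rule PT_E) blast
  have "2 \<le> Suc d" using d by simp
  with g obtain c' R' T' where c': "pb nu T'" "Suc d + 2 \<le> R'"
    "\<And>lo m x. R' \<le> lo \<Longrightarrow> lo \<le> m 0 \<Longrightarrow> holds lo m (repr x) (Suc d) \<Longrightarrow>
        \<exists>t m'. bs c' m t m' \<and> t \<le> T' x \<and> frame lo (Suc d) m m' \<and> holds lo m' (repr (g x)) (Suc (Suc d))"
    by (rule PT_E) blast
  \<comment> \<open>The code of \<open>g\<close> runs one register higher and leaves its result
    there, so the result is moved down.\<close>
  let ?b = "[Const 1 0, Add (Suc d) (Suc (Suc d)) 1]"
  have "eval_code (c ;; c' ;; Block ?b) lo d m (T x + T' (f x) + 2) (repr (g (f x)))"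
    if h: "R + R' \<le> lo" "lo \<le> m 0" "holds lo m (repr x) d" for lo m x
  proof -
    obtain t m1 where 1: "bs c m t m1" "t \<le> T x" "frame lo d m m1" "holds lo m1 (repr (f x)) (Suc d)"
      using c(3)[of lo m x] h by auto
    then have "lo \<le> m1 0" using h(2) by (auto simp: frame_def)
    then obtain s m2 where 2: "bs c' m1 s m2" "s \<le> T' (f x)" "frame lo (Suc d) m1 m2"
      "holds lo m2 (repr (g (f x))) (Suc (Suc d))"
      using c'(3)[of lo m1 "f x"] h 1 by auto
    have 3: "bs (Block ?b) m2 2 (fold act ?b m2)"
      by (rule bs_BlockI) auto
    have "frame lo d m1 (fold act ?b m2)"
      using 2(3) h(1) c(2) d unfolding frame_def by auto
    then have "frame lo d m (fold act ?b m2)"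
      using 1(3) frame_trans by blast
    moreover have "holds lo (fold act ?b m2) (repr (g (f x))) (Suc d)"
      using 2(4) h(1) c(2) d by (auto simp: holds_def)
    ultimately show ?thesis
      using bs.Seq[OF 1(1) bs.Seq[OF 2(1) 3]] 1(2) 2(2) unfolding eval_code_def
      by (metis (no_types, lifting) add_le_mono add.assoc le_refl)
  qed
  moreover have "pb mu (\<lambda>x. T x + T' (f x) + 2)"
    by (intro pb_intros c pb_comp[OF c'(1) nu])
  moreover have "d + 2 \<le> R + R'" using c(2) by simp
  ultimately show "\<exists>c R T. pb mu T \<and> d + 2 \<le> R \<and>
     (\<forall>lo m x. R \<le> lo \<longrightarrow> lo \<le> m 0 \<longrightarrow> holds lo m (repr x) d \<longrightarrow>
        eval_code c lo d m (T x) (repr (g (f x))))"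
    by blast
qed

text \<open>The argument is copied to register \<open>d + 2\<close> and the code of \<open>g\<close>
  runs at that depth; its frame condition then protects the result of \<open>f\<close> in register
  \<open>d + 1\<close>.\<close>

lemma PT_two:
  assumes f: "PT mu f" and g: "PT mu g" and d: "2 \<le> d"
  obtains c R T where "pb mu T" "d + 5 \<le> R"
    "\<And>lo m x. R \<le> lo \<Longrightarrow> lo \<le> m 0 \<Longrightarrow> holds lo m (repr x) d \<Longrightarrow>
        \<exists>t m'. bs c m t m' \<and> t \<le> T x \<and> frame lo d m m' \<and> holds lo m' (repr (f x)) (d + 1)
          \<and> holds lo m' (repr (g x)) (d + 3)"
proof -
  obtain c R T where c: "pb mu T" "d + 2 \<le> R"
    "\<And>lo m x. R \<le> lo \<Longrightarrow> lo \<le> m 0 \<Longrightarrow> holds lo m (repr x) d \<Longrightarrow>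
        \<exists>t m'. bs c m t m' \<and> t \<le> T x \<and> frame lo d m m' \<and> holds lo m' (repr (f x)) (Suc d)"
    using f d by (rule PT_E) blast
  have "2 \<le> d + 2" using d by simp
  with g obtain c' R' T' where c': "pb mu T'" "d + 2 + 2 \<le> R'"
    "\<And>lo m x. R' \<le> lo \<Longrightarrow> lo \<le> m 0 \<Longrightarrow> holds lo m (repr x) (d + 2) \<Longrightarrow>
        \<exists>t m'. bs c' m t m' \<and> t \<le> T' x \<and> frame lo (d + 2) m m' \<and> holds lo m' (repr (g x)) (Suc (d + 2))"
    by (rule PT_E) blast
  let ?b = "[Const 1 0, Add (d + 2) d 1]"
  have "\<exists>t m'. bs (c ;; Block ?b ;; c') m t m' \<and> t \<le> T x + 2 + T' x \<and> frame lo d m m' \<and>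
      holds lo m' (repr (f x)) (d + 1) \<and> holds lo m' (repr (g x)) (d + 3)"
    if h: "R + R' + 5 \<le> lo" "lo \<le> m 0" "holds lo m (repr x) d" for lo m x
  proof -
    obtain t m1 where 1: "bs c m t m1" "t \<le> T x" "frame lo d m m1" "holds lo m1 (repr (f x)) (Suc d)"
      using c(3)[of lo m x] h by auto
    define m2 where "m2 = fold act ?b m1"
    have 2: "bs (Block ?b) m1 2 m2"
      unfolding m2_def by (rule bs_BlockI) auto
    have f2: "frame lo (d + 1) m1 m2"
      using h(1) c(2) d unfolding frame_def m2_def by auto
    have "holds lo m1 (repr x) d"
      using holds_frame[OF h(3) 1(3)] d by simp
    then have "holds lo m2 (repr x) (d + 2)"
      using h(1) c(2) d by (auto simp: holds_def m2_def)
    moreover have "lo \<le> m2 0" using h(2) 1(3) f2 by (auto simp: frame_def)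
    ultimately obtain s m3 where 3: "bs c' m2 s m3" "s \<le> T' x" "frame lo (d + 2) m2 m3"
      "holds lo m3 (repr (g x)) (Suc (d + 2))"
      using c'(3)[of lo m2 x] h by auto
    have "frame lo (d + 1) m1 m3"
      using frame_trans[OF f2 3(3)] by simp
    then have "holds lo m3 (repr (f x)) (d + 1)" "frame lo d m m3"
      using holds_frame[OF 1(4)] 1(3) frame_trans d by fastforce+
    moreover have "bs (c ;; Block ?b ;; c') m (t + (2 + s)) m3"
      using 1 2 3 by (intro bs.Seq)
    moreover have "t + (2 + s) \<le> T x + 2 + T' x" using 1 3 by simp
    moreover have "holds lo m3 (repr (g x)) (d + 3)"
      using 3(4) by (simp add: eval_nat_numeral)
    ultimately show ?thesis by blast
  qed
  moreover have "pb mu (\<lambda>x. T x + 2 + T' x)"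
    by (intro pb_intros c c')
  moreover have "d + 5 \<le> R + R' + 5" using c(2) by simp
  ultimately show thesis using that by blast
qed

lemma PT_binop:
  assumes f: "PT mu f" and g: "PT mu g" and h: "pb mu (\<lambda>x. sz (h x))"
    and "\<And>d. list_all straight (bl d)"
    and b: "\<And>d lo m x. 2 \<le> d \<Longrightarrow> d + 5 \<le> lo \<Longrightarrow> lo \<le> m 0 \<Longrightarrow> holds lo m (repr (f x)) (d + 1) \<Longrightarrow>
      holds lo m (repr (g x)) (d + 3) \<Longrightarrow>
      frame lo d m (fold act (bl d) m) \<and> holds lo (fold act (bl d) m) (repr (h x)) (Suc d)"
  shows "PT mu h"
proof (rule PT_I[OF h])
  fix d :: nat assume d: "2 \<le> d"
  obtain c R T where c: "pb mu T" "d + 5 \<le> R"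
    "\<And>lo m x. R \<le> lo \<Longrightarrow> lo \<le> m 0 \<Longrightarrow> holds lo m (repr x) d \<Longrightarrow>
        \<exists>t m'. bs c m t m' \<and> t \<le> T x \<and> frame lo d m m' \<and> holds lo m' (repr (f x)) (d + 1)
          \<and> holds lo m' (repr (g x)) (d + 3)"
    using f g d by (rule PT_two) blast
  have "eval_code (c ;; Block (bl d)) lo d m (T x + length (bl d)) (repr (h x))"
    if "R \<le> lo" "lo \<le> m 0" "holds lo m (repr x) d" for lo m x
  proof -
    obtain t m1 where 1: "bs c m t m1" "t \<le> T x" "frame lo d m m1"
      "holds lo m1 (repr (f x)) (d + 1)" "holds lo m1 (repr (g x)) (d + 3)"
      using c(3) \<open>R \<le> lo\<close> \<open>lo \<le> m 0\<close> \<open>holds lo m (repr x) d\<close> by blast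
    have "lo \<le> m1 0" using 1(3) that(2) by (auto simp: frame_def)
    then have 2: "frame lo d m1 (fold act (bl d) m1) \<and> holds lo (fold act (bl d) m1) (repr (h x)) (Suc d)"
      using b[of d lo m1 x] that(1) c(2) d 1 by auto
    have 3: "bs (Block (bl d)) m1 (length (bl d)) (fold act (bl d) m1)"
      using assms(4) by (rule bs.Block)
    show ?thesis
      using bs.Seq[OF 1(1) 3] 1(2,3) 2 frame_trans unfolding eval_code_def
      by (metis add_le_mono1 le_refl)
  qed
  moreover have "pb mu (\<lambda>x. T x + length (bl d))"
    by (intro pb_intros c)
  moreover have "d + 2 \<le> R" using c(2) by simp
  ultimately show "\<exists>c R T. pb mu T \<and> d + 2 \<le> R \<and>
     (\<forall>lo m x. R \<le> lo \<longrightarrow> lo \<le> m 0 \<longrightarrow> holds lo m (repr x) d \<longrightarrow>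
        eval_code c lo d m (T x) (repr (h x)))"
    by blast
qed

section \<open>Allocation, arithmetic and branching\<close>

definition alloc :: "nat \<Rightarrow> nat \<Rightarrow> nat \<Rightarrow> instr list" where
  "alloc a b r = [Store 0 a, Const 1 0, Add r 0 1, Const 1 1, Add 0 0 1, Store 0 b, Add 0 0 1]"

text \<open>Seven instructions per cell, a number that recurs in the later step counts. In
  \<open>alloc\<close> the content of \<open>a\<close> is stored before \<open>r\<close> is
  overwritten and that of \<open>b\<close> after it, so \<open>r\<close> may coincide with
  \<open>a\<close> but not with \<open>b\<close>.\<close>

lemma straight_alloc: "list_all straight (alloc a b r)" "length (alloc a b r) = 7"
  by (simp_all add: alloc_def)

lemma alloc_eq:
  assumes "1 < a" "1 < b" "1 < r" "r \<noteq> b" "a < m 0" "b < m 0" "r < m 0"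
  shows "fold act (alloc a b r) m = m(m 0 := m a, Suc (m 0) := m b, r := m 0, 1 := 1, 0 := m 0 + 2)"
proof -
  define H where "H = m 0"
  have n: "H \<noteq> 0" "H \<noteq> 1" "H \<noteq> a" "H \<noteq> b" "H \<noteq> r" "Suc H \<noteq> a" "Suc H \<noteq> b" "Suc H \<noteq> r"
    "a \<noteq> 0" "a \<noteq> 1" "b \<noteq> 0" "b \<noteq> 1" "r \<noteq> 0" "r \<noteq> 1" "H \<noteq> Suc 0" "a \<noteq> Suc 0" "b \<noteq> Suc 0" "r \<noteq> Suc 0"
    using assms by (auto simp: H_def)
  show ?thesis
    unfolding alloc_def fold_simps act_simps H_def[symmetric]
    using n n[symmetric] assms(4) assms(4)[symmetric] H_def
    by (simp add: fun_eq_iff)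
qed

lemma alloc_holds:
  assumes "1 < a" "1 < b" "1 < r" "r \<noteq> b" "a < lo" "b < lo" "r < lo" "lo \<le> m 0"
    and "holds lo m v a" "holds lo m w b" and m': "m' = fold act (alloc a b r) m"
  shows "holds lo m' (Cell v w) r" "frame lo 1 m m'"
    "\<And>q. 1 < q \<Longrightarrow> q < lo \<Longrightarrow> q \<noteq> r \<Longrightarrow> m' q = m q"
    "\<And>q u. 1 < q \<Longrightarrow> q < lo \<Longrightarrow> q \<noteq> r \<Longrightarrow> holds lo m u q \<Longrightarrow> holds lo m' u q"
proof -
  have e: "m' = m(m 0 := m a, Suc (m 0) := m b, r := m 0, 1 := 1, 0 := m 0 + 2)"
    unfolding m' using assms(1-8) by (intro alloc_eq) auto
  show f: "frame lo 1 m m'"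
    using assms(1-8) unfolding e frame_def by auto
  show q: "m' q = m q" if "1 < q" "q < lo" "q \<noteq> r" for q
    using assms(1-8) that unfolding e by auto
  have k: "m' 0 = m 0 + 2" "m' r = m 0" "m' (m 0) = m a" "m' (Suc (m 0)) = m b"
    using assms(1-8) unfolding e by auto
  have c: "rp lo (m' 0) m' u x" if "rp lo (m 0) m u x" for u x
    using that by (rule rp_cong) (use f in \<open>auto simp: frame_def\<close>)
  show "holds lo m' u q" if "1 < q" "q < lo" "q \<noteq> r" "holds lo m u q" for q u
    using c q that by (simp add: holds_def)
  show "holds lo m' (Cell v w) r"
    using c k assms(8-10) by (simp add: holds_def)
qed

lemma PT_pair:
  assumes "PT mu f" "PT mu g" shows "PT mu (\<lambda>x. (f x, g x))"
  using assms
proof (rule PT_binop[where f = f and g = g and bl = "\<lambda>d. alloc (d + 1) (d + 3) (d + 1)"])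
  show "pb mu (\<lambda>x. sz (f x, g x))"
    unfolding sz_simps by (intro pb_intros PT_size assms)
  fix d lo m x
  assume h: "2 \<le> d" "d + 5 \<le> lo" "lo \<le> m 0" "holds lo m (repr (f x)) (d + 1)"
    "holds lo m (repr (g x)) (d + 3)"
  define m' where "m' = fold act (alloc (d + 1) (d + 3) (d + 1)) m"
  have n: "1 < d + 1" "1 < d + 3" "1 < d + 1" "d + 1 \<noteq> d + 3" "d + 1 < lo" "d + 3 < lo" "d + 1 < lo"
    using h(1,2) by auto
  note a = alloc_holds[OF n h(3-5) m'_def]
  have "frame lo d m m'"
    using a(2,3) h(1,2) unfolding frame_def by auto
  then show "frame lo d m (fold act (alloc (d + 1) (d + 3) (d + 1)) m) \<and>
    holds lo (fold act (alloc (d + 1) (d + 3) (d + 1)) m) (repr (f x, g x)) (Suc d)"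
    using a(1) by (simp add: m'_def repr_prod_def)
qed (rule straight_alloc)

lemma PT_add: "PT mu f \<Longrightarrow> PT mu g \<Longrightarrow> PT mu (\<lambda>x. f x + g x :: nat)"
  by (rule PT_binop[where f = f and g = g and bl = "\<lambda>d. [Add (d + 1) (d + 1) (d + 3)]"])
    (auto simp: pb_const frame_def holds_def repr_nat_def)

lemma PT_sub: "PT mu f \<Longrightarrow> PT mu g \<Longrightarrow> PT mu (\<lambda>x. f x - g x :: nat)"
  by (rule PT_binop[where f = f and g = g and bl = "\<lambda>d. [Sub (d + 1) (d + 1) (d + 3)]"])
    (auto simp: pb_const frame_def holds_def repr_nat_def)

lemma PT_nat: "PT mu (\<lambda>_. n :: nat)"
  by (rule PT_block[of _ _ "\<lambda>d. [Const (Suc d) n]"])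
    (auto simp: pb_const frame_def holds_def repr_nat_def)

text \<open>Types with the same heap image share their code: a cons cell is a pair, and Booleans and
  the empty list are numbers.\<close>

lemma PT_cast:
  fixes f :: "'a :: repr \<Rightarrow> 'b :: repr" and g :: "'a \<Rightarrow> 'c :: repr"
  assumes "PT mu f" "\<And>x. repr (g x) = repr (f x)" shows "PT mu g"
  using assms by (simp add: PT_def sz_def)

lemma PT_if_zero:
  assumes b: "PT mu b" and f: "PT mu f" and g: "PT mu g"
  shows "PT mu (\<lambda>x. if b x = (0 :: nat) then f x else g x)"
proof (rule PT_I)
  show "pb mu (\<lambda>x. sz (if b x = 0 then f x else g x))"
    by (rule pb_mono[OF pb_add[OF PT_size[OF f] PT_size[OF g]]]) auto
  fix d :: nat assume d: "2 \<le> d"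
  obtain c R T where c: "pb mu T" "d + 2 \<le> R"
    "\<And>lo m x. R \<le> lo \<Longrightarrow> lo \<le> m 0 \<Longrightarrow> holds lo m (repr x) d \<Longrightarrow>
        \<exists>t m'. bs c m t m' \<and> t \<le> T x \<and> frame lo d m m' \<and> holds lo m' (repr (b x)) (Suc d)"
    using b d by (rule PT_E) blast
  obtain cf Rf Tf where cf: "pb mu Tf" "d + 2 \<le> Rf"
    "\<And>lo m x. Rf \<le> lo \<Longrightarrow> lo \<le> m 0 \<Longrightarrow> holds lo m (repr x) d \<Longrightarrow>
        \<exists>t m'. bs cf m t m' \<and> t \<le> Tf x \<and> frame lo d m m' \<and> holds lo m' (repr (f x)) (Suc d)"
    using f d by (rule PT_E) blast
  obtain cg Rg Tg where cg: "pb mu Tg" "d + 2 \<le> Rg"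
    "\<And>lo m x. Rg \<le> lo \<Longrightarrow> lo \<le> m 0 \<Longrightarrow> holds lo m (repr x) d \<Longrightarrow>
        \<exists>t m'. bs cg m t m' \<and> t \<le> Tg x \<and> frame lo d m m' \<and> holds lo m' (repr (g x)) (Suc d)"
    using g d by (rule PT_E) blast
  let ?h = "\<lambda>x. if b x = 0 then f x else g x"
  have "eval_code (c ;; Cond (Suc d) cf cg) lo d m (T x + (Tf x + Tg x + 3)) (repr (?h x))"
    if h: "R + Rf + Rg \<le> lo" "lo \<le> m 0" "holds lo m (repr x) d" for lo m x
  proof -
    obtain t m1 where 1: "bs c m t m1" "t \<le> T x" "frame lo d m m1" "holds lo m1 (repr (b x)) (Suc d)"
      using c(3)[of lo m x] h by auto
    have b: "m1 (Suc d) = b x" using 1(4) by (simp add: holds_def repr_nat_def)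
    have x: "holds lo m1 (repr x) d" using holds_frame[OF h(3) 1(3)] d by simp
    have lo: "lo \<le> m1 0" using 1(3) h(2) by (auto simp: frame_def)
    have "\<exists>s m2. bs (Cond (Suc d) cf cg) m1 s m2 \<and> s \<le> Tf x + Tg x + 3 \<and> frame lo d m1 m2 \<and>
        holds lo m2 (repr (?h x)) (Suc d)"
    proof (cases "b x = 0")
      case True
      obtain s m2 where 2: "bs cf m1 s m2" "s \<le> Tf x" "frame lo d m1 m2" "holds lo m2 (repr (f x)) (Suc d)"
        using cf(3)[of lo m1 x] h x lo by auto
      have "bs (Cond (Suc d) cf cg) m1 (s + 1) m2"
        using True b 2(1) by (intro bs.Cond0) auto
      with 2 True show ?thesis by (intro exI conjI) auto
    next
      case False
      obtain s m2 where 2: "bs cg m1 s m2" "s \<le> Tg x" "frame lo d m1 m2" "holds lo m2 (repr (g x)) (Suc d)"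
        using cg(3)[of lo m1 x] h x lo by auto
      have "bs (Cond (Suc d) cf cg) m1 (s + 3) (m2(1 := 0))"
        using False b 2(1) by (intro bs.Cond1) auto
      moreover have "frame lo d m1 (m2(1 := 0))" using 2(3) h(1) c(2) by (intro frame_reset) auto
      moreover have "holds lo (m2(1 := 0)) (repr (g x)) (Suc d)"
        using 2(4) h(1) c(2) d by (intro holds_upd) auto
      ultimately show ?thesis using 2 False by (intro exI conjI) auto
    qed
    then obtain s m2 where "bs (Cond (Suc d) cf cg) m1 s m2" "s \<le> Tf x + Tg x + 3"
      "frame lo d m1 m2" "holds lo m2 (repr (?h x)) (Suc d)" by blast
    with 1 show ?thesis unfolding eval_code_def
      by (meson bs.Seq add_le_mono frame_trans le_refl)
  qed
  moreover have "pb mu (\<lambda>x. T x + (Tf x + Tg x + 3))"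
    by (intro pb_intros c cf cg)
  moreover have "d + 2 \<le> R + Rf + Rg" using c(2) by simp
  ultimately show "\<exists>c R T. pb mu T \<and> d + 2 \<le> R \<and>
     (\<forall>lo m x. R \<le> lo \<longrightarrow> lo \<le> m 0 \<longrightarrow> holds lo m (repr x) d \<longrightarrow>
        eval_code c lo d m (T x) (repr (?h x)))"
    by blast
qed

text \<open>The default \<open>f x\<close> is computed in advance and packed with \<open>x\<close>
  and the list, so the machine code only has to treat this triple. A nonempty list is already the
  cell of its head and tail; therefore the pair of \<open>x\<close> and the list serves unchanged as
  the argument \<open>(x, y, ys)\<close> of \<open>g\<close>.\<close>

lemma PT_list_case:
  fixes l :: "'a :: repr \<Rightarrow> 'b :: repr list" and f :: "'a \<Rightarrow> 'c :: repr"
  assumes l: "PT mu l" and f: "PT mu f" and g: "pt g" and mu: "\<And>x. sz x \<le> mu x"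
  shows "PT mu (\<lambda>x. case l x of [] \<Rightarrow> f x | y # ys \<Rightarrow> g (x, y, ys))"
proof -
  define F :: "'c \<times> 'a \<times> 'b list \<Rightarrow> 'c" where
    "F p = (case snd (snd p) of [] \<Rightarrow> fst p | y # ys \<Rightarrow> g (fst (snd p), y, ys))" for p
  have "pt F"
  proof (rule PT_I)
    have "pb sz (\<lambda>p :: 'c \<times> 'a \<times> 'b list. sz (fst p) + (case snd (snd p) of [] \<Rightarrow> 0 | y # ys \<Rightarrow> sz (g (fst (snd p), y, ys))))"
    proof (rule pb_add)
      show "pb sz (\<lambda>p :: 'c \<times> 'a \<times> 'b list. sz (fst p))"
        by (rule pb_mono[OF pb_self]) auto
      obtain k where k: "\<And>q. sz (g q) \<le> (sz q + 2) ^ k"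
        using PT_size[OF g] unfolding pb_def by blast
      have "(case snd (snd p) of [] \<Rightarrow> 0 | y # ys \<Rightarrow> sz (g (fst (snd p), y, ys))) \<le> (sz p + 2) ^ k"
        for p :: "'c \<times> 'a \<times> 'b list"
      proof (cases "snd (snd p)")
        case (Cons y ys)
        then have "sz (fst (snd p), y, ys) \<le> sz p" by (cases p) auto
        then have "sz (g (fst (snd p), y, ys)) \<le> (sz p + 2) ^ k"
          by (rule order_trans[OF k power_mono[OF add_right_mono]]) simp
        with Cons show ?thesis by simp
      qed simp
      then show "pb sz (\<lambda>p :: 'c \<times> 'a \<times> 'b list. case snd (snd p) of [] \<Rightarrow> 0 | y # ys \<Rightarrow> sz (g (fst (snd p), y, ys)))"
        unfolding pb_def by blast
    qed
    then show "pb sz (\<lambda>p. sz (F p))"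
      by (rule pb_mono) (auto simp: F_def split: list.split)
    fix d :: nat assume d: "2 \<le> d"
    have "2 \<le> Suc d" using d by simp
    with g obtain c R T where c: "pb sz T" "Suc d + 2 \<le> R"
      "\<And>lo m x. R \<le> lo \<Longrightarrow> lo \<le> m 0 \<Longrightarrow> holds lo m (repr x) (Suc d) \<Longrightarrow>
        \<exists>t m'. bs c m t m' \<and> t \<le> T x \<and> frame lo (Suc d) m m' \<and> holds lo m' (repr (g x)) (Suc (Suc d))"
      by (rule PT_E) blast
    obtain k where k: "\<And>q. T q \<le> (sz q + 2) ^ k"
      using c(1) unfolding pb_def by blast
    let ?b1 = "[Const 1 1, Add (d + 1) d 1, Load (d + 1) (d + 1), Add (d + 2) (d + 1) 1, Load (d + 2) (d + 2)]"
    let ?b2 = "[Load (d + 1) d]" and ?b3 = "[Const 1 0, Add (d + 1) (d + 2) 1]"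
    let ?c = "Block ?b1 ;; Cond (d + 2) (Block ?b2) (c ;; Block ?b3)"
    have "eval_code ?c lo d m ((sz p + 2) ^ k + 10) (repr (F p))"
      if h: "R + 5 \<le> lo" "lo \<le> m 0" "holds lo m (repr p) d" for lo m p
    proof -
      obtain a x l where p: "p = (a, x, l)" by (cases p) auto
      define m1 where "m1 = fold act ?b1 m"
      have 1: "bs (Block ?b1) m 5 m1"
        unfolding m1_def by (rule bs_BlockI) auto
      have f1: "frame lo d m m1" and d1: "holds lo m1 (repr p) d" and m1: "lo \<le> m1 0"
        using h c(2) d by (auto simp: m1_def holds_def frame_def)
      have x1: "holds lo m1 (repr (x, l)) (Suc d)"
        using h c(2) d by (auto simp: p m1_def holds_def repr_prod_def)
      have l1: "holds lo m1 (repr l) (d + 2)"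
        using h c(2) d by (auto simp: p m1_def holds_def repr_prod_def)
      have "\<exists>s m2. bs (Cond (d + 2) (Block ?b2) (c ;; Block ?b3)) m1 s m2 \<and> s \<le> (sz p + 2) ^ k + 5 \<and>
        frame lo d m1 m2 \<and> holds lo m2 (repr (F p)) (Suc d)"
      proof (cases l)
        case Nil
        then have z: "m1 (d + 2) = 0" using l1 by (simp add: holds_def)
        have "bs (Block ?b2) m1 1 (fold act ?b2 m1)" by (rule bs_BlockI) auto
        then have "bs (Cond (d + 2) (Block ?b2) (c ;; Block ?b3)) m1 (1 + 1) (fold act ?b2 m1)"
          using z by (rule bs.Cond0[rotated])
        moreover have "frame lo d m1 (fold act ?b2 m1)"
          using h(1) c(2) d by (auto simp: frame_def)
        moreover have "holds lo (fold act ?b2 m1) (repr (F p)) (Suc d)"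
          using d1 h(1) c(2) d by (auto simp: p Nil F_def holds_def repr_prod_def)
        moreover have "1 + 1 \<le> (sz p + 2) ^ k + 5" by simp
        ultimately show ?thesis by blast
      next
        case (Cons y ys)
        then have z: "m1 (d + 2) \<noteq> 0" using l1 h(1) c(2) by (auto simp: holds_def)
        have "holds lo m1 (repr (x, y, ys)) (Suc d)"
          using x1 by (simp add: Cons repr_prod_def)
        then obtain t m2 where 2: "bs c m1 t m2" "t \<le> T (x, y, ys)" "frame lo (Suc d) m1 m2"
          "holds lo m2 (repr (g (x, y, ys))) (Suc (Suc d))"
          using c(3)[of lo m1 "(x, y, ys)"] h(1) m1 by auto
        define m3 where "m3 = fold act ?b3 m2"
        have 3: "bs (Block ?b3) m2 2 m3" unfolding m3_def by (rule bs_BlockI) auto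
        have f3: "frame lo d m1 m3"
          using 2(3) h(1) c(2) d unfolding frame_def m3_def by auto
        have d3: "holds lo m3 (repr (g (x, y, ys))) (Suc d)"
          using 2(4) h(1) c(2) d by (auto simp: m3_def holds_def)
        have "bs (Cond (d + 2) (Block ?b2) (c ;; Block ?b3)) m1 (t + 2 + 3) (m3(1 := 0))"
          using z bs.Seq[OF 2(1) 3] by (rule bs.Cond1)
        moreover have "frame lo d m1 (m3(1 := 0))" using f3 h(1) c(2) by (intro frame_reset) auto
        moreover have "holds lo (m3(1 := 0)) (repr (F p)) (Suc d)"
          using d3 h(1) c(2) d by (auto simp: p Cons F_def holds_def)
        moreover have "t + 2 + 3 \<le> (sz p + 2) ^ k + 5"
        proof -
          have "sz (x, y, ys) \<le> sz p" by (simp add: p Cons)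
          then have "(sz (x, y, ys) + 2) ^ k \<le> (sz p + 2) ^ k" by (intro power_mono) auto
          with k[of "(x, y, ys)"] 2(2) show ?thesis by linarith
        qed
        ultimately show ?thesis by blast
      qed
      then obtain s m2 where 2: "bs (Cond (d + 2) (Block ?b2) (c ;; Block ?b3)) m1 s m2"
        "s \<le> (sz p + 2) ^ k + 5" "frame lo d m1 m2" "holds lo m2 (repr (F p)) (Suc d)" by blast
      have "5 + s \<le> (sz p + 2) ^ k + 10" using 2(2) by simp
      then show ?thesis
        using bs.Seq[OF 1 2(1)] 2 frame_trans[OF f1 2(3)] unfolding eval_code_def by blast
    qed
    moreover have "pb sz (\<lambda>p :: 'c \<times> 'a \<times> 'b list. (sz p + 2) ^ k + 10)"
      by (intro pb_add pb_const) (auto simp: pb_def)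
    moreover have "d + 2 \<le> R + 5" using c(2) by simp
    ultimately show "\<exists>c R T. pb sz T \<and> d + 2 \<le> R \<and>
     (\<forall>lo m x. R \<le> lo \<longrightarrow> lo \<le> m 0 \<longrightarrow> holds lo m (repr x) d \<longrightarrow>
        eval_code c lo d m (T x) (repr (F x)))"
      by (intro exI[of _ ?c] exI[of _ "R + 5"] exI[of _ "\<lambda>p. (sz p + 2) ^ k + 10"]) blast
  qed
  moreover have "PT mu (\<lambda>x. (f x, x, l x))"
    by (intro PT_pair f l PT_id mu)
  ultimately have "PT mu (\<lambda>x. F (f x, x, l x))"
    using PT_comp PT_size by blast
  then show ?thesis by (simp only: F_def fst_conv snd_conv)
qed

section \<open>Iteration over a list\<close>

lemma length_le_sz: "length l \<le> sz (l :: 'a :: repr list)"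
  by (induction l) auto

lemma sz_nth: "i < length l \<Longrightarrow> sz (l ! i) \<le> sz (l :: 'a :: repr list)"
proof (induction l arbitrary: i)
  case (Cons a l)
  then show ?case by (cases i) (auto simp: le_SucI trans_le_add2)
qed simp

text \<open>Register \<open>d + 1\<close> holds the accumulator, \<open>d + 2\<close> the remaining
  list and \<open>d + 3\<close> the parameter \<open>x\<close>. The triple for the step is assembled
  in \<open>d + 4\<close>, using \<open>d + 5\<close> for the element and \<open>d + 6\<close> for
  the inner pair. An iteration adds 20 instructions of bookkeeping and 3 for the loop itself, hence
  the constant 23.\<close>

lemma fold_loop:
  fixes s :: "'x :: repr \<times> 'a :: repr \<times> 'y :: repr \<Rightarrow> 'a"
  assumes c: "\<And>m p. lo \<le> m 0 \<Longrightarrow> holds lo m (repr p) (d + 4) \<Longrightarrow>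
        \<exists>t m'. bs c m t m' \<and> t \<le> T p \<and> frame lo (d + 4) m m' \<and> holds lo m' (repr (s p)) (Suc (d + 4))"
    and d: "2 \<le> d" "d + 7 \<le> lo"
    and body: "body = Block [Load (d + 5) (d + 2)] ;; Block (alloc (d + 1) (d + 5) (d + 6)) ;;
      Block (alloc (d + 3) (d + 6) (d + 4)) ;; c ;; Block [Const 1 0, Add (d + 1) (d + 5) 1, Const 1 1,
      Add (d + 2) (d + 2) 1, Load (d + 2) (d + 2)]"
  shows "lo \<le> m 0 \<Longrightarrow> holds lo m (repr a) (d + 1) \<Longrightarrow> holds lo m (repr l) (d + 2) \<Longrightarrow>
    holds lo m (repr x) (d + 3) \<Longrightarrow>
    (\<And>i. i < length l \<Longrightarrow> T (x, foldl (\<lambda>a y. s (x, a, y)) a (take i l), l ! i) \<le> B) \<Longrightarrow>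
    \<exists>t m'. bs (While (d + 2) body) m t m' \<and> t \<le> length l * (B + 23) + 1 \<and> frame lo d m m' \<and>
      holds lo m' (repr (foldl (\<lambda>a y. s (x, a, y)) a l)) (d + 1)"
proof (induction l arbitrary: a m)
  case Nil
  then have "m (d + 2) = 0" by (simp add: holds_def)
  then have "bs (While (d + 2) body) m 1 m" by (rule bs.While0)
  with Nil frame_refl show ?case by (intro exI conjI) auto
next
  case (Cons y ys)
  let ?b3 = "[Const 1 0, Add (d + 1) (d + 5) 1, Const 1 1, Add (d + 2) (d + 2) 1, Load (d + 2) (d + 2)]"
  define n1 where "n1 = fold act [Load (d + 5) (d + 2)] m"
  define n2 where "n2 = fold act (alloc (d + 1) (d + 5) (d + 6)) n1"
  define m1 where "m1 = fold act (alloc (d + 3) (d + 6) (d + 4)) n2"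
  have 1: "bs (Block [Load (d + 5) (d + 2)]) m 1 n1" "bs (Block (alloc (d + 1) (d + 5) (d + 6))) n1 7 n2"
    "bs (Block (alloc (d + 3) (d + 6) (d + 4))) n2 7 m1"
    unfolding n1_def n2_def m1_def by (auto intro!: bs_BlockI straight_alloc)
  have fn1: "frame lo (d + 3) m n1" using d by (auto simp: n1_def frame_def)
  have hn1: "holds lo n1 (repr a) (d + 1)" "holds lo n1 (repr x) (d + 3)" "holds lo n1 (repr y) (d + 5)"
    using Cons.prems(1-4) d by (auto simp: n1_def holds_def)
  have lo1: "lo \<le> n1 0" using fn1 Cons.prems(1) by (auto simp: frame_def)
  have n: "1 < d + 1" "1 < d + 5" "1 < d + 6" "d + 6 \<noteq> d + 5" "d + 1 < lo" "d + 5 < lo" "d + 6 < lo"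
    and n': "1 < d + 3" "1 < d + 6" "1 < d + 4" "d + 4 \<noteq> d + 6" "d + 3 < lo" "d + 6 < lo" "d + 4 < lo"
    using d by auto
  note hn2 = alloc_holds(1-3)[OF n lo1 hn1(1,3) n2_def]
  have xn2: "holds lo n2 (repr x) (d + 3)"
    by (rule alloc_holds(4)[OF n lo1 hn1(1,3) n2_def _ _ _ hn1(2)]) (use n n' in auto)
  have fn2: "frame lo (d + 3) n1 n2"
    using hn2(2,3) d unfolding frame_def by auto
  have lo2: "lo \<le> n2 0" using fn2 lo1 by (auto simp: frame_def)
  note h1 = alloc_holds(1-3)[OF n' lo2 xn2 hn2(1) m1_def]
  have "frame lo (d + 3) n2 m1" using h1(2,3) d unfolding frame_def by auto
  then have f1: "frame lo (d + 3) m m1" using fn1 fn2 frame_trans by blast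
  then have lo1': "lo \<le> m1 0" using Cons.prems(1) by (auto simp: frame_def)
  have "holds lo m1 (repr (x, a, y)) (d + 4)"
    using h1(1) by (simp add: repr_prod_def)
  with lo1' obtain t m2 where 2: "bs c m1 t m2" "t \<le> T (x, a, y)" "frame lo (d + 4) m1 m2"
    "holds lo m2 (repr (s (x, a, y))) (Suc (d + 4))"
    using c by blast
  have f2: "frame lo (d + 3) m m2" using frame_trans[OF f1 2(3)] by simp
  define m3 where "m3 = (fold act ?b3 m2)(1 := 0)"
  have 3: "bs (Block ?b3) m2 5 (fold act ?b3 m2)" by (rule bs_BlockI) auto
  have x2: "holds lo m2 (repr x) (d + 3)" and l2: "holds lo m2 (repr (y # ys)) (d + 2)"
    using holds_frame[OF Cons.prems(4) f2] holds_frame[OF Cons.prems(3) f2] d by auto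
  have "frame lo d m2 m3" using d by (auto simp: m3_def frame_def)
  moreover have "frame lo d m m2" using f2 by (auto simp: frame_def)
  ultimately have f3: "frame lo d m m3" using frame_trans by blast
  have a3: "holds lo m3 (repr (s (x, a, y))) (d + 1)"
    using 2(4) d by (auto simp: m3_def holds_def eval_nat_numeral)
  have l3: "holds lo m3 (repr ys) (d + 2)"
    using l2 d by (auto simp: m3_def holds_def)
  have x3: "holds lo m3 (repr x) (d + 3)"
    using x2 d by (auto simp: m3_def holds_def)
  have lo3: "lo \<le> m3 0" using f3 Cons.prems(1) by (auto simp: frame_def)
  have "T (x, foldl (\<lambda>a y. s (x, a, y)) (s (x, a, y)) (take i ys), ys ! i) \<le> B" if "i < length ys" for i
    using Cons.prems(5)[of "Suc i"] that by simp
  from Cons.IH[OF lo3 a3 l3 x3 this] obtain t' m' where 4: "bs (While (d + 2) body) m3 t' m'"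
    "t' \<le> length ys * (B + 23) + 1" "frame lo d m3 m'"
    "holds lo m' (repr (foldl (\<lambda>a y. s (x, a, y)) (s (x, a, y)) ys)) (d + 1)" by blast
  have "bs body m (1 + (7 + (7 + (t + 5)))) (fold act ?b3 m2)"
    unfolding body using 1 2(1) 3 by (intro bs.Seq)
  moreover have "m (d + 2) \<noteq> 0" using Cons.prems(3) d by (auto simp: holds_def)
  ultimately have "bs (While (d + 2) body) m ((1 + (7 + (7 + (t + 5)))) + t' + 3) m'"
    using 4(1) unfolding m3_def by (intro bs.While1)
  moreover have "(1 + (7 + (7 + (t + 5)))) + t' + 3 \<le> length (y # ys) * (B + 23) + 1"
    using 2(2) 4(2) Cons.prems(5)[of 0] by simp
  moreover have "frame lo d m m'" using f3 4(3) frame_trans by blast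
  ultimately show ?case using 4(4) by (intro exI conjI) auto
qed

text \<open>A step that is polynomial-time may still square the size of the accumulator, which
  iterates to a tower of growth. The fold is polynomial only because one bound \<open>b\<close>
  covers all intermediate accumulators.\<close>

lemma PT_foldl:
  fixes s :: "'x :: repr \<Rightarrow> 'a :: repr \<Rightarrow> 'y :: repr \<Rightarrow> 'a"
  assumes i: "PT mu i" and l: "PT mu l" and s: "pt (\<lambda>p. s (fst p) (fst (snd p)) (snd (snd p)))"
    and mu: "\<And>x. sz x \<le> mu x"
    and b: "pb mu b" "\<And>x j. sz (foldl (s x) (i x) (take j (l x))) \<le> b x"
  shows "PT mu (\<lambda>x. foldl (s x) (i x) (l x))"
proof -
  define S where "S = (\<lambda>p. s (fst p) (fst (snd p)) (snd (snd p)))"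
  have S: "(\<lambda>a y. S (x, a, y)) = s x" for x by (simp add: S_def)
  \<comment> \<open>The measure sums the sizes along the whole computation, so the time of every
    iteration is bounded in terms of the triple alone, without reference to the outer argument on
    which \<open>b\<close> depends.\<close>
  define nu where "nu p = (case p of (x, a, l) \<Rightarrow> sz x + sz l + (\<Sum>j\<le>length l. sz (foldl (s x) a (take j l))))" for p
  have nu: "sz x + sz l + sz (foldl (s x) a (take j l)) \<le> nu (x, a, l)" for x a l j
  proof -
    have "foldl (s x) a (take j l) = foldl (s x) a (take (min j (length l)) l)"
      by (simp add: min_def)
    then show ?thesis
      using member_le_sum[of "min j (length l)" "{..length l}" "\<lambda>j. sz (foldl (s x) a (take j l))"]
      by (simp add: nu_def)
  qed
  define F where "F p = foldl (s (fst p)) (fst (snd p)) (snd (snd p))" for p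
  have "PT nu F"
  proof (rule PT_I)
    have "sz (F p) \<le> nu p" for p
    proof -
      obtain x a l where "p = (x, a, l)" by (cases p) auto
      then show ?thesis using nu[of x l a "length l"] by (simp add: F_def)
    qed
    then show "pb nu (\<lambda>p. sz (F p))" by (rule pb_mono[OF pb_self])
    fix d :: nat assume d: "2 \<le> d"
    then have "2 \<le> d + 4" by simp
    with s[folded S_def] obtain c R T where c: "pb sz T" "d + 4 + 2 \<le> R"
      "\<And>lo m x. R \<le> lo \<Longrightarrow> lo \<le> m 0 \<Longrightarrow> holds lo m (repr x) (d + 4) \<Longrightarrow>
        \<exists>t m'. bs c m t m' \<and> t \<le> T x \<and> frame lo (d + 4) m m' \<and> holds lo m' (repr (S x)) (Suc (d + 4))"
      by (rule PT_E) blast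
    obtain k where k: "\<And>q. T q \<le> (sz q + 2) ^ k"
      using c(1) unfolding pb_def by blast
    let ?b = "[Load (d + 3) d, Const 1 1, Add (d + 4) d 1, Load (d + 4) (d + 4), Load (d + 1) (d + 4),
      Add (d + 4) (d + 4) 1, Load (d + 2) (d + 4)]"
    define body where "body = Block [Load (d + 5) (d + 2)] ;; Block (alloc (d + 1) (d + 5) (d + 6)) ;;
      Block (alloc (d + 3) (d + 6) (d + 4)) ;; c ;; Block [Const 1 0, Add (d + 1) (d + 5) 1, Const 1 1,
      Add (d + 2) (d + 2) 1, Load (d + 2) (d + 2)]"
    have "eval_code (Block ?b ;; While (d + 2) body) lo d m (7 + (nu p * ((2 * nu p + 2 + 2) ^ k + 23) + 1)) (repr (F p))"
      if h: "R + 7 \<le> lo" "lo \<le> m 0" "holds lo m (repr p) d" for lo m p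
    proof -
      obtain x a l where p: "p = (x, a, l)" by (cases p) auto
      define m1 where "m1 = fold act ?b m"
      have 1: "bs (Block ?b) m 7 m1" unfolding m1_def by (rule bs_BlockI) auto
      have f1: "frame lo d m m1" using h c(2) d by (auto simp: m1_def frame_def)
      have h1: "holds lo m1 (repr a) (d + 1)" "holds lo m1 (repr l) (d + 2)" "holds lo m1 (repr x) (d + 3)"
        using h c(2) d by (auto simp: m1_def p holds_def repr_prod_def)
      have lo1: "lo \<le> m1 0" using f1 h(2) by (auto simp: frame_def)
      have step: "T (x, foldl (\<lambda>a y. S (x, a, y)) a (take j l), l ! j) \<le> (2 * nu p + 2 + 2) ^ k" if "j < length l" for j
      proof -
        have "sz (x, foldl (s x) a (take j l), l ! j) \<le> 2 * nu p + 2"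
          using nu[of x l a j] sz_nth[OF that] by (simp add: p)
        then show ?thesis unfolding S
          by (intro order_trans[OF k power_mono[OF add_right_mono]]) auto
      qed
      have Rlo: "R \<le> lo" "d + 7 \<le> lo" using h(1) c(2) by auto
      have "\<exists>t m2. bs (While (d + 2) body) m1 t m2 \<and> t \<le> length l * ((2 * nu p + 2 + 2) ^ k + 23) + 1 \<and>
          frame lo d m1 m2 \<and> holds lo m2 (repr (foldl (\<lambda>a y. S (x, a, y)) a l)) (d + 1)"
        by (rule fold_loop[OF _ d Rlo(2) body_def lo1 h1], rule c(3)[OF Rlo(1)], assumption+) (rule step)
      then obtain t m2
        where 2: "bs (While (d + 2) body) m1 t m2" "t \<le> length l * ((2 * nu p + 2 + 2) ^ k + 23) + 1"
          "frame lo d m1 m2" "holds lo m2 (repr (foldl (\<lambda>a y. S (x, a, y)) a l)) (d + 1)"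
        by blast
      have "length l \<le> nu p"
        using nu[of x l a 0] length_le_sz[of l] by (simp add: p)
      then have "t \<le> nu p * ((2 * nu p + 2 + 2) ^ k + 23) + 1"
        by (intro order_trans[OF 2(2)] add_right_mono mult_le_mono1)
      moreover have "holds lo m2 (repr (F p)) (Suc d)"
        using 2(4) by (simp add: F_def p S)
      ultimately show ?thesis
        using bs.Seq[OF 1 2(1)] frame_trans[OF f1 2(3)] unfolding eval_code_def
        by (intro exI[of _ "7 + t"] exI[of _ m2]) auto
    qed
    moreover have "pb nu (\<lambda>p. 7 + (nu p * ((2 * nu p + 2 + 2) ^ k + 23) + 1))"
    proof -
      have "pb (\<lambda>n. n) (\<lambda>n :: nat. (n + 2) ^ k)" by (auto simp: pb_def)
      moreover have "pb nu (\<lambda>p. 2 * nu p + 2)" by (intro pb_intros)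
      ultimately have "pb nu (\<lambda>p. (2 * nu p + 2 + 2) ^ k)"
        using pb_comp[where nu = "\<lambda>n. n" and g = "\<lambda>n. (n + 2) ^ k" and f = "\<lambda>p. 2 * nu p + 2"] by simp
      then show ?thesis by (intro pb_add pb_mult pb_const pb_self)
    qed
    moreover have "d + 2 \<le> R + 7" using c(2) by simp
    ultimately show "\<exists>c R T. pb nu T \<and> d + 2 \<le> R \<and>
     (\<forall>lo m x. R \<le> lo \<longrightarrow> lo \<le> m 0 \<longrightarrow> holds lo m (repr x) d \<longrightarrow>
        eval_code c lo d m (T x) (repr (F x)))"
      by (intro exI[of _ "Block ?b ;; While (d + 2) body"] exI[of _ "R + 7"]
          exI[of _ "\<lambda>p. 7 + (nu p * ((2 * nu p + 2 + 2) ^ k + 23) + 1)"]) blast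
  qed
  moreover have "PT mu (\<lambda>x. (x, i x, l x))"
    by (intro PT_pair i l PT_id mu)
  moreover have "pb mu (\<lambda>x. nu (x, i x, l x))"
  proof (rule pb_mono)
    show "pb mu (\<lambda>x. mu x + sz (l x) + (sz (l x) + 1) * b x)"
      by (intro pb_intros PT_size l b)
    fix x
    have "(\<Sum>j\<le>length (l x). sz (foldl (s x) (i x) (take j (l x)))) \<le> of_nat (card {..length (l x)}) * b x"
      by (rule sum_bounded_above) (rule b)
    also have "\<dots> \<le> (sz (l x) + 1) * b x"
      using length_le_sz[of "l x"] by simp
    finally show "nu (x, i x, l x) \<le> mu x + sz (l x) + (sz (l x) + 1) * b x"
      using mu[of x] by (simp add: nu_def)
  qed
  ultimately have "PT mu (\<lambda>x. F (x, i x, l x))"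
    using PT_comp[where f = "\<lambda>x. (x, i x, l x)" and g = F and nu = nu] by blast
  then show ?thesis by (simp add: F_def)
qed

section \<open>From list functions to complete programs\<close>

lemma fold_double: "fold act (replicate k (Add 0 0 0)) m = m(0 := 2 ^ k * m 0)"
proof (induction k arbitrary: m)
  case (Suc k)
  then show ?case by (simp add: fun_eq_iff algebra_simps)
qed simp

text \<open>The input occupies the addresses of the working registers.  Doubling register 0, which
  holds the input length, yields an address above the input without using another register;
  there the contents of the registers \<open>1..r\<close> are saved.\<close>

definition save_regs :: "nat \<Rightarrow> instr list" where
  "save_regs r = [Store 0 1, Const 1 1] @ concat (map (\<lambda>i. [Add 0 0 1, Store 0 i]) [2..<Suc r]) @ [Add 0 0 1]"

lemma save_regs_aux:
  assumes "1 \<le> r" "r < m 0"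
  shows "fold act ([Store 0 1, Const 1 1] @ concat (map (\<lambda>i. [Add 0 0 1, Store 0 i]) [2..<Suc r])) m =
    (\<lambda>a. if a = 0 then m 0 + r - 1 else if a = 1 then 1
         else if m 0 \<le> a \<and> a < m 0 + r then m (a - m 0 + 1) else m a)"
  using assms
proof (induction r rule: nat_induct_at_least)
  case base
  then show ?case by (auto simp: fun_eq_iff)
next
  case (Suc r)
  define f where "f = (\<lambda>a. if a = 0 then m 0 + r - 1 else if a = 1 then 1
         else if m 0 \<le> a \<and> a < m 0 + r then m (a - m 0 + 1) else m a)"
  have "fold act ([Store 0 1, Const 1 1] @ concat (map (\<lambda>i. [Add 0 0 1, Store 0 i]) [2..<Suc (Suc r)])) m
    = fold act [Add 0 0 1, Store 0 (Suc r)] f"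
    using Suc.IH Suc.prems Suc.hyps by (simp add: f_def)
  also have "\<dots> = (\<lambda>a. if a = 0 then m 0 + Suc r - 1 else if a = 1 then 1
         else if m 0 \<le> a \<and> a < m 0 + Suc r then m (a - m 0 + 1) else m a)"
  proof
    fix a
    have e: "fold act [Add 0 0 1, Store 0 (Suc r)] f = (f(0 := m 0 + r))(m 0 + r := f (Suc r))"
      using Suc.hyps Suc.prems by (simp add: f_def)
    have "f (Suc r) = m (Suc r)" using Suc.hyps Suc.prems by (simp add: f_def)
    then show "fold act [Add 0 0 1, Store 0 (Suc r)] f a = (if a = 0 then m 0 + Suc r - 1 else if a = 1 then 1
         else if m 0 \<le> a \<and> a < m 0 + Suc r then m (a - m 0 + 1) else m a)"
      using Suc.hyps Suc.prems unfolding e by (auto simp: f_def)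
  qed
  finally show ?case .
qed

lemma save_regs:
  assumes "1 \<le> r" "r < m 0"
  shows "fold act (save_regs r) m =
    (\<lambda>a. if a = 0 then m 0 + r else if a = 1 then 1
         else if m 0 \<le> a \<and> a < m 0 + r then m (a - m 0 + 1) else m a)"
proof -
  have "save_regs r = ([Store 0 1, Const 1 1] @ concat (map (\<lambda>i. [Add 0 0 1, Store 0 i]) [2..<Suc r])) @ [Add 0 0 1]"
    by (simp only: save_regs_def append_assoc)
  then show ?thesis
    using save_regs_aux[of r m, OF assms] assms by (simp only: fold_append o_apply) (auto simp: fun_eq_iff)
qed

lemma straight_concat: "(\<And>x. list_all straight (f x)) \<Longrightarrow> list_all straight (concat (map f xs))"
  by (induction xs) auto

lemma straight_replicate: "straight i \<Longrightarrow> list_all straight (replicate n i)"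
  by (induction n) auto

lemma straight_save_regs: "list_all straight (save_regs r)"
  by (simp add: save_regs_def straight_concat)

section \<open>Conversion between memory blocks and lists on the heap\<close>

definition cons_body :: com where
  "cons_body = Block [Const 1 1, Sub 4 4 1, Load 5 4] ;; Block (alloc 5 2 6) ;;
     Block [Const 1 0, Add 2 6 1, Const 1 1, Sub 3 3 1]"

text \<open>The block is traversed downwards, so that consing yields the entries in memory order.
  Register 2 holds the list, 3 the number of entries left and 4 the address just above the next
  entry.\<close>

lemma cons_loop:
  assumes "6 < s"
  shows "s + c \<le> lo \<Longrightarrow> lo \<le> m 0 \<Longrightarrow> holds lo m (repr (l :: nat list)) 2 \<Longrightarrow> m 3 = c \<Longrightarrow> m 4 = s + c \<Longrightarrow>
    \<exists>t m'. bs (While 3 cons_body) m t m' \<and> t \<le> c * 20 + 1 \<and>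
      holds lo m' (repr (map m [s..<s + c] @ l)) 2 \<and> lo \<le> m' 0 \<and> (\<forall>a. 6 < a \<longrightarrow> a < lo \<longrightarrow> m' a = m a)"
proof (induction c arbitrary: m l)
  case 0
  then have "bs (While 3 cons_body) m 1 m" by (intro bs.While0) auto
  with 0 show ?case by (intro exI[of _ 1] exI[of _ m]) auto
next
  case (Suc c)
  let ?b1 = "[Const 1 1, Sub 4 4 1, Load 5 4]" and ?b3 = "[Const 1 0, Add 2 6 1, Const 1 1, Sub 3 3 1]"
  define m1 where "m1 = fold act ?b1 m"
  define m2 where "m2 = fold act (alloc 5 2 6) m1"
  define m3 where "m3 = (fold act ?b3 m2)(1 := 0)"
  have 1: "bs (Block ?b1) m 3 m1" "bs (Block (alloc 5 2 6)) m1 7 m2" "bs (Block ?b3) m2 4 (fold act ?b3 m2)"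
    unfolding m1_def m2_def by (auto intro!: bs_BlockI straight_alloc)
  have lo: "6 < lo" "s + c < lo" using assms Suc.prems(1) by auto
  have m1: "m1 0 = m 0" "m1 3 = Suc c" "m1 4 = s + c" "m1 5 = m (s + c)" "\<And>a. 6 < a \<Longrightarrow> m1 a = m a" "m1 2 = m 2"
    using Suc.prems assms by (auto simp: m1_def)
  have h1: "holds lo m1 (repr l) 2" "holds lo m1 (repr (m (s + c))) 5"
    using Suc.prems(3) m1 lo by (auto simp: m1_def holds_def repr_nat_def)
  have n: "1 < (5 :: nat)" "1 < (2 :: nat)" "1 < (6 :: nat)" "(6 :: nat) \<noteq> 2" "5 < lo" "2 < lo" "6 < lo"
    using lo by auto
  have lo1: "lo \<le> m1 0" using Suc.prems(2) m1 by simp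
  note m2 = alloc_holds(1-3)[OF n lo1 h1(2,1) m2_def]
  have lo2: "lo \<le> m2 0" using m2(2) lo1 by (simp add: frame_def)
  have m3: "m3 3 = c" "m3 4 = s + c" "m3 0 = m2 0" "\<And>a. 6 < a \<Longrightarrow> m3 a = m2 a"
    using m2(3)[of 3] m2(3)[of 4] m1 lo by (auto simp: m3_def)
  have h3: "holds lo m3 (repr (m (s + c) # l)) 2"
    using m2(1) lo by (auto simp: m3_def holds_def)
  have m3': "m3 a = m a" if "6 < a" "a < lo" for a
    using m3(4)[of a] m2(3)[of a] m1(5)[of a] that by simp
  have "s + c \<le> lo" "lo \<le> m3 0" using lo lo2 m3 by auto
  from Suc.IH[OF this h3 m3(1,2)] obtain t m' where 2: "bs (While 3 cons_body) m3 t m'" "t \<le> c * 20 + 1"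
    "holds lo m' (repr (map m3 [s..<s + c] @ m (s + c) # l)) 2" "lo \<le> m' 0"
    "\<forall>a. 6 < a \<longrightarrow> a < lo \<longrightarrow> m' a = m3 a" by blast
  have e: "map m3 [s..<s + c] = map m [s..<s + c]"
    using m3' assms lo by auto
  have "holds lo m' (repr (map m [s..<s + Suc c] @ l)) 2" using 2(3)[unfolded e] by simp
  moreover have "\<forall>a. 6 < a \<longrightarrow> a < lo \<longrightarrow> m' a = m a" using 2(5) m3' by simp
  moreover have "bs (While 3 cons_body) m ((3 + (7 + 4)) + t + 3) m'"
  proof (rule bs.While1)
    show "bs cons_body m (3 + (7 + 4)) (fold act ?b3 m2)"
      unfolding cons_body_def using 1 by (intro bs.Seq)
    show "bs (While 3 cons_body) ((fold act ?b3 m2)(1 := 0)) t m'"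
      using 2(1) unfolding m3_def .
  qed (use Suc.prems in simp)
  ultimately show ?case using 2(2,4) by (intro exI[of _ "(3 + (7 + 4)) + t + 3"] exI[of _ m']) simp
qed

definition out_body :: com where
  "out_body = Block [Const 1 1, Add 5 5 1, Load 6 3, Store 5 6, Add 3 3 1, Load 3 3]"

text \<open>All writes go to addresses above \<open>H\<close>, beyond the heap, so the list being
  traversed stays intact. Address \<open>H\<close> itself is left free for the length of the
  output.\<close>

lemma out_loop:
  assumes "6 < lo" "lo \<le> H"
  shows "rp lo H m (repr (ys :: nat list)) (m 3) \<Longrightarrow> m 5 = p \<Longrightarrow> H \<le> p \<Longrightarrow>
    \<exists>t m'. bs (While 3 out_body) m t m' \<and> t \<le> length ys * 9 + 1 \<and> m' 5 = p + length ys \<and>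
      (\<forall>i<length ys. m' (Suc (p + i)) = ys ! i) \<and>
      (\<forall>a. a \<notin> {1,3,5,6} \<longrightarrow> \<not> (p < a \<and> a \<le> p + length ys) \<longrightarrow> m' a = m a)"
proof (induction ys arbitrary: m p)
  case Nil
  then have "bs (While 3 out_body) m 1 m" by (intro bs.While0) auto
  with Nil show ?case by (intro exI[of _ 1] exI[of _ m]) auto
next
  case (Cons y ys)
  let ?b = "[Const 1 1, Add 5 5 1, Load 6 3, Store 5 6, Add 3 3 1, Load 3 3]"
  have w: "lo \<le> m 3" "Suc (m 3) < H" "m (m 3) = y" "rp lo H m (repr ys) (m (Suc (m 3)))"
    using Cons.prems(1) by (auto simp: repr_nat_def)
  define m1 where "m1 = (fold act ?b m)(1 := 0)"
  have m1: "m1 = m(3 := m (Suc (m 3)), 5 := Suc p, 6 := y, Suc p := y, 1 := 0)"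
    using w assms Cons.prems(2,3) by (auto simp: m1_def fun_eq_iff)
  have "rp lo H m1 (repr ys) (m1 3)"
    using w(4) assms Cons.prems(2,3) by (auto simp: m1)
  moreover have "m1 5 = Suc p" "H \<le> Suc p" using assms Cons.prems(3) by (auto simp: m1)
  ultimately obtain t m' where 2: "bs (While 3 out_body) m1 t m'" "t \<le> length ys * 9 + 1"
    "m' 5 = Suc p + length ys" "\<forall>i<length ys. m' (Suc (Suc p + i)) = ys ! i"
    "\<forall>a. a \<notin> {1,3,5,6} \<longrightarrow> \<not> (Suc p < a \<and> a \<le> Suc p + length ys) \<longrightarrow> m' a = m1 a"
    using Cons.IH by blast
  have "m' (Suc p) = y" using 2(5) assms Cons.prems(3) by (auto simp: m1)
  then have "\<forall>i<length (y # ys). m' (Suc (p + i)) = (y # ys) ! i"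
    using 2(4) by (auto simp: nth_Cons split: nat.split)
  moreover have "\<forall>a. a \<notin> {1,3,5,6} \<longrightarrow> \<not> (p < a \<and> a \<le> p + length (y # ys)) \<longrightarrow> m' a = m a"
  proof (intro allI impI)
    fix a assume "a \<notin> {1,3,5,6}" "\<not> (p < a \<and> a \<le> p + length (y # ys))"
    then show "m' a = m a" using 2(5)[rule_format, of a] by (auto simp: m1)
  qed
  moreover have "bs (While 3 out_body) m (6 + t + 3) m'"
  proof (rule bs.While1)
    show "bs out_body m 6 (fold act ?b m)" unfolding out_body_def by (rule bs_BlockI) auto
    show "bs (While 3 out_body) ((fold act ?b m)(1 := 0)) t m'" using 2(1) unfolding m1_def .
  qed (use w(1) assms in simp)
  ultimately show ?case using 2(2,3) by (intro exI[of _ "6 + t + 3"] exI[of _ m']) simp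
qed

definition copy_body :: "nat \<Rightarrow> com" where
  "copy_body r = Block [Const 1 r, Add 5 3 1, Add 6 4 5, Load 6 6, Store 5 6, Const 1 1, Sub 3 3 1]"

text \<open>Only output entries with index above \<open>r\<close> are moved here, since the
  addresses up to \<open>r\<close> are still needed as registers. The target may destroy the heap,
  which is no longer used, but must stay below the copy at \<open>H\<close>; this is the condition
  \<open>r + j < H\<close>.\<close>

lemma copy_loop:
  assumes "6 < r"
  shows "r + j < H \<Longrightarrow> m 3 = j \<Longrightarrow> m 4 = H \<Longrightarrow>
    \<exists>t m'. bs (While 3 (copy_body r)) m t m' \<and> t \<le> j * 10 + 1 \<and>
      (\<forall>i. 0 < i \<longrightarrow> i \<le> j \<longrightarrow> m' (r + i) = m (H + (r + i))) \<and>
      (\<forall>a. a \<notin> {1,3,5,6} \<longrightarrow> \<not> (r < a \<and> a \<le> r + j) \<longrightarrow> m' a = m a)"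
proof (induction j arbitrary: m)
  case 0
  then have "bs (While 3 (copy_body r)) m 1 m" by (intro bs.While0) auto
  with 0 show ?case by (intro exI[of _ 1] exI[of _ m]) auto
next
  case (Suc j)
  let ?b = "[Const 1 r, Add 5 3 1, Add 6 4 5, Load 6 6, Store 5 6, Const 1 1, Sub 3 3 1]"
  define m1 where "m1 = (fold act ?b m)(1 := 0)"
  have m1: "m1 = m(3 := j, 5 := r + Suc j, 6 := m (H + (r + Suc j)), r + Suc j := m (H + (r + Suc j)), 1 := 0)"
    using assms Suc.prems by (auto simp: m1_def fun_eq_iff add_ac)
  have "r + j < H" "m1 3 = j" "m1 4 = H" using assms Suc.prems by (auto simp: m1)
  from Suc.IH[OF this] obtain t m' where 2: "bs (While 3 (copy_body r)) m1 t m'" "t \<le> j * 10 + 1"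
    "\<And>i. 0 < i \<Longrightarrow> i \<le> j \<Longrightarrow> m' (r + i) = m1 (H + (r + i))"
    "\<And>a. a \<notin> {1,3,5,6} \<Longrightarrow> \<not> (r < a \<and> a \<le> r + j) \<Longrightarrow> m' a = m1 a" by blast
  have "m' (r + i) = m (H + (r + i))" if "0 < i" "i \<le> Suc j" for i
  proof (cases "i = Suc j")
    case True
    then show ?thesis using 2(4)[of "r + Suc j"] assms by (auto simp: m1)
  next
    case False
    then show ?thesis using 2(3)[of i] that assms Suc.prems by (auto simp: m1)
  qed
  moreover have "m' a = m a" if "a \<notin> {1,3,5,6}" "\<not> (r < a \<and> a \<le> r + Suc j)" for a
    using 2(4)[of a] that by (auto simp: m1)
  moreover have "bs (While 3 (copy_body r)) m (7 + t + 3) m'"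
  proof (rule bs.While1)
    show "bs (copy_body r) m 7 (fold act ?b m)" unfolding copy_body_def by (rule bs_BlockI) auto
    show "bs (While 3 (copy_body r)) ((fold act ?b m)(1 := 0)) t m'" using 2(1) unfolding m1_def .
  qed (use Suc.prems in simp)
  ultimately show ?case using 2(2) by (intro exI[of _ "7 + t + 3"] exI[of _ m']) simp
qed

text \<open>Each low register serves as its own pointer when its final value is loaded.\<close>

definition load_regs :: "nat \<Rightarrow> instr list" where
  "load_regs r = concat (map (\<lambda>i. [Const i i, Add i i 0, Load i i]) [1..<Suc r]) @ [Load 0 0]"

lemma load_regs:
  assumes "r < m 0"
  shows "fold act (load_regs r) m =
    (\<lambda>a. if a = 0 then m (m 0) else if a \<le> r then m (m 0 + a) else m a)"
proof -
  have "fold act (concat (map (\<lambda>i. [Const i i, Add i i 0, Load i i]) [1..<Suc r])) m =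
      (\<lambda>a. if 0 < a \<and> a \<le> r then m (m 0 + a) else m a)"
    using assms
  proof (induction r)
    case (Suc r)
    define f where "f = (\<lambda>a. if 0 < a \<and> a \<le> r then m (m 0 + a) else m a)"
    have "fold act (concat (map (\<lambda>i. [Const i i, Add i i 0, Load i i]) [1..<Suc (Suc r)])) m =
      fold act [Const (Suc r) (Suc r), Add (Suc r) (Suc r) 0, Load (Suc r) (Suc r)] f"
      using Suc by (simp add: f_def)
    also have "\<dots> = f(Suc r := f (m 0 + Suc r))"
      using Suc.prems by (auto simp: f_def fun_eq_iff add_ac)
    also have "\<dots> = (\<lambda>a. if 0 < a \<and> a \<le> Suc r then m (m 0 + a) else m a)"
      using Suc.prems by (auto simp: f_def fun_eq_iff le_Suc_eq)
    finally show ?case .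
  qed auto
  then show ?thesis using assms
    by (simp add: load_regs_def del: upt_Suc) (auto simp: fun_eq_iff)
qed

lemma straight_load_regs: "list_all straight (load_regs r)"
  by (simp add: load_regs_def straight_concat del: upt_Suc)

lemma init_mem:
  "map (snd (init_config xs)) [1..<Suc k] = take k xs @ replicate (k - length xs) 0"
  by (rule nth_equalityI) (auto simp: init_config_def nth_append min_def simp del: upt_Suc)

text \<open>The list is built from a block of memory that extends beyond the input, hence the
  trailing zeros; a parser of a prefix code does not see them.\<close>

theorem PT_program:
  fixes F :: "nat list \<Rightarrow> nat list"
  assumes F: "PT mu F" and mu: "\<And>xs. sz xs \<le> mu xs"
  obtains Q N k where "\<And>xs. xs \<noteq> [] \<Longrightarrow> \<exists>j \<le> N * length xs.
    length (F (xs @ replicate j 0)) \<le> length xs \<longrightarrow>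
    computes_within Q xs (F (xs @ replicate j 0)) ((mu (xs @ replicate j 0) + 2) ^ k)"
proof -
  obtain c R T where c: "pb mu T" "2 + 2 \<le> R"
    "\<And>lo m x. R \<le> lo \<Longrightarrow> lo \<le> m 0 \<Longrightarrow> holds lo m (repr x) 2 \<Longrightarrow>
        \<exists>t m'. bs c m t m' \<and> t \<le> T x \<and> frame lo 2 m m' \<and> holds lo m' (repr (F x)) (Suc 2)"
    using F order_refl by (rule PT_E) blast
  \<comment> \<open>The input and output loops use registers up to 7, and the compiled function
    needs a heap that starts at \<open>R\<close> or later.\<close>
  define r where "r = R + 8"
  \<comment> \<open>After \<open>r + 2\<close> doublings, register 0 exceeds \<open>r + 2\<close>
    and is at least four times the input length, so the saved copies overlap neither the registers
    nor the input.\<close>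
  define in1 where "in1 = replicate (r + 2) (Add 0 0 0) @ save_regs r"
  let ?in2 = "[Const 2 0, Const 1 0, Add 7 0 1, Const 1 r, Sub 4 7 1, Const 1 (Suc r), Sub 3 4 1]"
  let ?in3 = "[Const 3 r, Const 1 0, Add 4 7 1]"
  let ?o1 = "[Const 1 0, Add 4 0 1, Add 5 0 1]"
  let ?o2 = "[Sub 6 5 4, Store 4 6, Const 1 r, Sub 3 6 1]"
  \<comment> \<open>The list is built from its end: the first loop conses the untouched addresses
    above \<open>r\<close>, the second puts the saved contents of the addresses \<open>1..r\<close>
    in front. Register 7 remembers the end of the saved copies between the two loops.\<close>
  define C where "C = Block in1 ;; Block ?in2 ;; While 3 cons_body ;; Block ?in3 ;; While 3 cons_body ;; c ;;
    Block ?o1 ;; While 3 out_body ;; Block ?o2 ;; While 3 (copy_body r) ;; Block (load_regs r)"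
  define K where "K = length in1 + length (load_regs r) + 100 + r * 20"
  define N where "N = (2 :: nat) ^ (r + 2)"
  have main: "\<exists>j \<le> N * length xs. length xs + j \<le> N * length xs \<and>
    (length (F (xs @ replicate j 0)) \<le> length xs \<longrightarrow>
    computes_within (compile C 0) xs (F (xs @ replicate j 0)) (K + N * length xs * 20 + T (xs @ replicate j 0) + length xs * 20))
     \<and> N * length xs = Suc (length xs + j)"
    if xs: "xs \<noteq> []" for xs
  proof -
    define n where "n = length xs"
    have n: "0 < n" using xs by (simp add: n_def)
    define B where "B = N * n"
    define j where "j = B - 1 - n"
    have "r + 2 < 2 ^ (r + 2)" using less_exp by blast
    moreover have "N \<le> B" using n by (simp add: B_def)
    ultimately have B: "r + 2 < B" by (simp add: N_def)
    have "4 * 1 \<le> N" unfolding N_def by (simp add: power_add)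
    then have "4 * n \<le> B" unfolding B_def by (intro mult_le_mono1) simp
    then have nB: "n < B - 1" "n + j = B - 1" using n by (auto simp: j_def)
    define m where "m = snd (init_config xs)"
    have m0: "m 0 = n" by (simp add: m_def init_config_def n_def)
    define m1 where "m1 = fold act in1 m"
    have 1: "bs (Block in1) m (length in1) m1"
      unfolding m1_def in1_def
      by (rule bs_BlockI) (simp_all add: straight_save_regs straight_replicate del: replicate.simps)
    have "m1 = (\<lambda>a. if a = 0 then B + r else if a = 1 then 1
         else if B \<le> a \<and> a < B + r then m (a - B + 1) else m a)"
    proof -
      have "fold act (replicate (r + 2) (Add 0 0 0)) m = m(0 := B)"
        by (simp only: fold_double m0 B_def N_def)
      then have "m1 = fold act (save_regs r) (m(0 := B))"
        unfolding m1_def in1_def by (simp only: fold_append o_apply)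
      then show ?thesis using B by (subst (asm) save_regs) (auto simp: r_def fun_eq_iff)
    qed
    then have m1: "m1 0 = B + r" "\<And>a. 1 < a \<Longrightarrow> a < B \<Longrightarrow> m1 a = m a"
      "\<And>i. i < r \<Longrightarrow> m1 (B + i) = m (Suc i)"
      using B by auto
    define lo where "lo = B + r"
    define m2 where "m2 = fold act ?in2 m1"
    have 2: "bs (Block ?in2) m1 7 m2" unfolding m2_def by (rule bs_BlockI) auto
    have m2: "m2 0 = lo" "m2 2 = 0" "m2 7 = lo" "m2 4 = Suc r + (B - Suc r)" "m2 3 = B - Suc r"
      "\<And>a. 7 < a \<Longrightarrow> m2 a = m1 a"
      using m1(1) B by (auto simp: m2_def lo_def)
    have "6 < Suc r" "Suc r + (B - Suc r) \<le> lo" "lo \<le> m2 0" "holds lo m2 (repr ([] :: nat list)) 2"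
      using m2 B by (auto simp: holds_def r_def lo_def)
    from cons_loop[OF this m2(5,4)] obtain t3 m3 where
      3: "bs (While 3 cons_body) m2 t3 m3" "t3 \<le> (B - Suc r) * 20 + 1"
        "holds lo m3 (repr (map m2 [Suc r..<Suc r + (B - Suc r)] @ [])) 2" "lo \<le> m3 0"
        "\<And>a. 6 < a \<Longrightarrow> a < lo \<Longrightarrow> m3 a = m2 a" by blast
    define l where "l = map m2 [Suc r..<B]"
    have l3: "holds lo m3 (repr l) 2" using 3(3) B by (simp add: l_def)
    define m4 where "m4 = fold act ?in3 m3"
    have 4: "bs (Block ?in3) m3 3 m4" unfolding m4_def by (rule bs_BlockI) auto
    have lo7: "7 < lo" by (simp add: lo_def r_def)
    have m4: "m4 3 = r" "m4 4 = B + r" "m4 0 = m3 0" "\<And>a. 6 < a \<Longrightarrow> m4 a = m3 a"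
      using 3(5)[of 7] m2(3) lo7 by (auto simp: m4_def lo_def)
    have "6 < B" "B + r \<le> lo" "lo \<le> m4 0" "holds lo m4 (repr l) 2"
      using l3 3(4) m4 B lo7 by (auto simp: lo_def r_def m4_def holds_def)
    from cons_loop[OF this m4(1,2)] obtain t5 m5 where
      5: "bs (While 3 cons_body) m4 t5 m5" "t5 \<le> r * 20 + 1" "holds lo m5 (repr (map m4 [B..<B + r] @ l)) 2" "lo \<le> m5 0"
      by blast
    define zs where "zs = xs @ replicate j 0"
    have "map m4 [B..<B + r] @ l = zs"
    proof -
      have "map m4 [B..<B + r] = map m [1..<Suc r]"
      proof (rule nth_equalityI)
        fix i assume "i < length (map m4 [B..<B + r])"
        then have i: "i < r" by simp
        then have "m4 (B + i) = m (Suc i)"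
          using m4(4)[of "B + i"] 3(5)[of "B + i"] m2(6)[of "B + i"] m1(3)[OF i] B
          by (simp add: lo_def r_def)
        then show "map m4 [B..<B + r] ! i = map m [1..<Suc r] ! i" using i by (simp del: upt_Suc)
      qed simp
      moreover have "l = map m [Suc r..<B]"
        unfolding l_def using m1(2) m2(6) by (intro map_cong) (auto simp: r_def)
      ultimately have "map m4 [B..<B + r] @ l = map m ([1..<Suc r] @ [Suc r..<B])" by (simp del: upt_Suc)
      also have "[1..<Suc r] @ [Suc r..<B] = [1..<B]"
        using B upt_add_eq_append[of 1 "Suc r" "B - Suc r"] by simp
      also have "map m [1..<B] = zs"
        using init_mem[of xs "B - 1"] nB B by (simp add: m_def zs_def n_def j_def)
      finally show ?thesis .
    qed
    with 5(3) have "holds lo m5 (repr zs) 2" by simp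
    moreover have "R \<le> lo" by (simp add: lo_def r_def)
    ultimately obtain t6 m6 where 6: "bs c m5 t6 m6" "t6 \<le> T zs" "frame lo 2 m5 m6"
      "holds lo m6 (repr (F zs)) (Suc 2)" using c(3) 5(4) by blast
    define H where "H = m6 0"
    have H: "lo \<le> H" using 6(3) 5(4) by (auto simp: frame_def H_def)
    define ys where "ys = F zs"
    define m7 where "m7 = fold act ?o1 m6"
    have 7: "bs (Block ?o1) m6 3 m7" unfolding m7_def by (rule bs_BlockI) auto
    have m7: "m7 4 = H" "m7 5 = H" "m7 0 = H" "rp lo H m7 (repr ys) (m7 3)"
      using 6(4) lo7 by (auto simp: m7_def H_def holds_def ys_def)
    have "6 < lo" using lo7 by simp
    from out_loop[OF this H m7(4,2) order_refl] obtain t8 m8 where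
      8: "bs (While 3 out_body) m7 t8 m8" "t8 \<le> length ys * 9 + 1" "m8 5 = H + length ys"
      "\<And>i. i < length ys \<Longrightarrow> m8 (Suc (H + i)) = ys ! i"
      "\<And>a. a \<notin> {1,3,5,6} \<Longrightarrow> \<not> (H < a \<and> a \<le> H + length ys) \<Longrightarrow> m8 a = m7 a"
      by blast
    define m9 where "m9 = fold act ?o2 m8"
    have 9: "bs (Block ?o2) m8 4 m9" unfolding m9_def by (rule bs_BlockI) auto
    have H7: "7 < H" using H lo7 by simp
    have m84: "m8 4 = H" "m8 0 = H" using 8(5)[of 4] 8(5)[of 0] m7 H7 by auto
    have m9: "m9 3 = length ys - r" "m9 4 = H" "m9 0 = H" "m9 H = length ys" "\<And>a. H < a \<Longrightarrow> m9 a = m8 a"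
      using 8(3) m84 H7 by (auto simp: m9_def)
    have fin: "computes_within (compile C 0) xs ys (K + B * 20 + T zs + n * 20)" if L: "length ys \<le> n"
    proof -
      \<comment> \<open>Here the output must not be longer than the input: the input ends before
        \<open>B\<close>, hence before \<open>H\<close>, so the final copy cannot run into its own
        source.\<close>
      have len: "r + (length ys - r) < H" "length ys < H"
        using L nB B H by (auto simp: lo_def)
      have "6 < r" by (simp add: r_def)
      from copy_loop[OF this len(1) m9(1,2)] obtain t10 m10 where
        10: "bs (While 3 (copy_body r)) m9 t10 m10" "t10 \<le> (length ys - r) * 10 + 1"
        "\<And>i. 0 < i \<Longrightarrow> i \<le> length ys - r \<Longrightarrow> m10 (r + i) = m9 (H + (r + i))"
        "\<And>a. a \<notin> {1,3,5,6} \<Longrightarrow> \<not> (r < a \<and> a \<le> r + (length ys - r)) \<Longrightarrow> m10 a = m9 a"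
        by blast
      have m100: "m10 0 = H" using 10(4)[of 0] m9 by simp
      have m10H: "m10 (H + i) = m9 (H + i)" for i
        using 10(4)[of "H + i"] H7 len by auto
      define m11 where "m11 = fold act (load_regs r) m10"
      have 11: "bs (Block (load_regs r)) m10 (length (load_regs r)) m11"
        unfolding m11_def by (rule bs_BlockI) (auto simp: straight_load_regs)
      have "r < m10 0" using m100 H by (simp add: lo_def) (use B in linarith)
      from load_regs[of r m10, OF this] have m11: "m11 a = (if a = 0 then m10 H else if a \<le> r then m10 (H + a) else m10 a)" for a
        unfolding m11_def m100 by simp
      have o0: "m11 0 = length ys" using m11[of 0] m10H[of 0] m9(4) by simp
      have o1: "m11 (Suc i) = ys ! i" if "i < length ys" for i
      proof -
        have "m9 (H + Suc i) = ys ! i" using m9(5)[of "H + Suc i"] 8(4)[OF that] by simp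
        moreover have "m11 (Suc i) = m9 (H + Suc i)"
        proof (cases "Suc i \<le> r")
          case True
          then show ?thesis using m11[of "Suc i"] m10H[of "Suc i"] by simp
        next
          case False
          then show ?thesis using m11[of "Suc i"] 10(3)[of "Suc i - r"] that by simp
        qed
        ultimately show ?thesis by simp
      qed
      have "map (\<lambda>i. m11 (Suc i)) [0..<m11 0] = ys"
        unfolding o0 using o1 by (intro nth_equalityI) auto
      then have out: "output_of (clen C, m11) = ys"
        by (simp add: output_of_def)
      have "bs C m (length in1 + (7 + (t3 + (3 + (t5 + (t6 + (3 + (t8 + (4 + (t10 + length (load_regs r))))))))))) m11"
        unfolding C_def
        by (rule bs.Seq[OF 1 bs.Seq[OF 2 bs.Seq[OF 3(1) bs.Seq[OF 4 bs.Seq[OF 5(1) bs.Seq[OF 6(1)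
            bs.Seq[OF 7 bs.Seq[OF 8(1) bs.Seq[OF 9 bs.Seq[OF 10(1) 11]]]]]]]]]])
      moreover have "length in1 + (7 + (t3 + (3 + (t5 + (t6 + (3 + (t8 + (4 + (t10 + length (load_regs r)))))))))) \<le>
        K + B * 20 + T zs + n * 20"
        using 3(2) 5(2) 6(2) 8(2) 10(2) L unfolding K_def by linarith
      ultimately show ?thesis
        using out unfolding m_def by (intro bs_computes)
    qed
    show ?thesis
      using fin nB B n unfolding ys_def zs_def
      by (intro exI[of _ j]) (auto simp: B_def n_def)
  qed
  have "pb mu (\<lambda>zs. K + (length zs + 1) * 20 + T zs + length zs * 20)"
    by (intro pb_add pb_mult pb_const c pb_mono[OF pb_self, of length]) (meson length_le_sz mu order_trans)+
  then obtain k where k: "\<And>zs. K + (length zs + 1) * 20 + T zs + length zs * 20 \<le> (mu zs + 2) ^ k"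
    unfolding pb_def by blast
  show thesis
  proof (rule that)
    fix xs :: "nat list" assume "xs \<noteq> []"
    from main[OF this] obtain j where j: "j \<le> N * length xs" "N * length xs = Suc (length xs + j)"
      "length (F (xs @ replicate j 0)) \<le> length xs \<longrightarrow> computes_within (compile C 0) xs (F (xs @ replicate j 0))
       (K + N * length xs * 20 + T (xs @ replicate j 0) + length xs * 20)" by blast
    have "K + N * length xs * 20 + T (xs @ replicate j 0) + length xs * 20 \<le> (mu (xs @ replicate j 0) + 2) ^ k"
      using k[of "xs @ replicate j 0"] j(2) by simp
    with j show "\<exists>j \<le> N * length xs. length (F (xs @ replicate j 0)) \<le> length xs \<longrightarrow>
      computes_within (compile C 0) xs (F (xs @ replicate j 0)) ((mu (xs @ replicate j 0) + 2) ^ k)"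
      unfolding computes_within_def by (meson order_trans)
  qed
qed

text \<open>The parameter-dependent factor of the running time will have this form. Multiplication
  by \<open>2 ^ e\<close> is done by \<open>e\<close> doublings. Register 5 supplies the constant
  one because loops zero register 1, and register 0 keeps the input length one, which is also the
  output length.\<close>

lemma computable_power: "computable_fun (\<lambda>x. (2 ^ e) ^ x)"
proof -
  define body where "body = Block (replicate e (Add 4 4 4)) ;; Block [Sub 3 3 5]"
  have dbl: "fold act (replicate k (Add 4 4 4)) m = m(4 := 2 ^ k * m 4)" for k m
  proof (induction k arbitrary: m)
    case (Suc k)
    then show ?case by (simp add: fun_eq_iff algebra_simps)
  qed simp
  have loop: "\<exists>t m'. bs (While 3 body) m t m' \<and> m' 0 = m 0 \<and> m' 4 = (2 ^ e) ^ x * m 4"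
    if "m 3 = x" "m 5 = 1" for x m
    using that
  proof (induction x arbitrary: m)
    case 0
    then have "bs (While 3 body) m 1 m" by (intro bs.While0) auto
    then show ?case by (intro exI[of _ 1] exI[of _ m]) auto
  next
    case (Suc x)
    define m1 where "m1 = m(4 := 2 ^ e * m 4)"
    have 1: "bs (Block (replicate e (Add 4 4 4))) m e m1"
      by (rule bs_BlockI) (simp add: straight_replicate, simp only: dbl m1_def, simp)
    have 2: "bs (Block [Sub 3 3 5]) m1 1 (m1(3 := x))"
      using Suc.prems by (intro bs_BlockI) (auto simp: m1_def)
    define m2 where "m2 = (m1(3 := x))(1 := 0)"
    have m2: "m2 3 = x" "m2 5 = 1" "m2 0 = m 0" "m2 4 = 2 ^ e * m 4"
      using Suc.prems by (auto simp: m2_def m1_def)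
    with Suc.IH[of m2] obtain t m' where 3: "bs (While 3 body) m2 t m'" "m' 0 = m 0"
      "m' 4 = (2 ^ e) ^ x * (2 ^ e * m 4)" by auto
    have "bs (While 3 body) m ((e + 1) + t + 3) m'"
      using Suc.prems(1) bs.Seq[OF 1 2] 3(1) unfolding body_def m2_def by (intro bs.While1) auto
    with 3 show ?case by (intro exI[of _ "(e + 1) + t + 3"] exI[of _ m']) (simp add: algebra_simps)
  qed
  let ?C = "Block [Const 2 0, Add 3 1 2, Const 4 1, Const 5 1] ;; While 3 body ;; Block [Const 2 0, Add 1 4 2]"
  have "\<exists>t. computes_within (compile ?C 0) [x] [(2 ^ e) ^ x] t" for x
  proof -
    define m where "m = snd (init_config [x])"
    define m1 where "m1 = fold act [Const 2 0, Add 3 1 2, Const 4 1, Const 5 1] m"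
    have 1: "bs (Block [Const 2 0, Add 3 1 2, Const 4 1, Const 5 1]) m 4 m1"
      unfolding m1_def by (rule bs_BlockI) auto
    have "m1 3 = x" "m1 5 = 1" "m1 4 = 1" "m1 0 = 1" by (auto simp: m1_def m_def init_config_def)
    with loop[of m1 x] obtain t m2 where 2: "bs (While 3 body) m1 t m2" "m2 0 = 1" "m2 4 = (2 ^ e) ^ x"
      by auto
    define m3 where "m3 = fold act [Const 2 0, Add 1 4 2] m2"
    have 3: "bs (Block [Const 2 0, Add 1 4 2]) m2 2 m3" unfolding m3_def by (rule bs_BlockI) auto
    have "output_of (clen ?C, m3) = [(2 ^ e) ^ x]"
      using 2 by (simp add: output_of_def m3_def)
    with bs.Seq[OF 1 bs.Seq[OF 2(1) 3]] show ?thesis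
      unfolding m_def by (blast intro: bs_computes)
  qed
  then show ?thesis unfolding computable_fun_def by blast
qed

section \<open>Polynomial-time list functions\<close>

named_theorems pt_intro

lemma pt_id [pt_intro]: "pt (\<lambda>x. x)"
  by (rule PT_id) simp

lemma pt_comp: "pt f \<Longrightarrow> pt g \<Longrightarrow> pt (\<lambda>x. g (f x))"
  using PT_comp[of sz f sz g] PT_size by blast

lemma PT_pt_comp: "PT mu f \<Longrightarrow> pt g \<Longrightarrow> PT mu (\<lambda>x. g (f x))"
  using PT_comp[of mu f sz g] PT_size by blast

lemma pt_fst_of [pt_intro]: "pt f \<Longrightarrow> pt (\<lambda>x. fst (f x))"
  by (rule pt_comp[OF _ pt_fst])

lemma pt_snd_of [pt_intro]: "pt f \<Longrightarrow> pt (\<lambda>x. snd (f x))"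
  by (rule pt_comp[OF _ pt_snd])

lemmas [pt_intro] = PT_pair[of sz] PT_add[of sz] PT_sub[of sz] PT_nat[of sz]

lemma pt_comp2:
  assumes "pt (\<lambda>p. h (fst p) (snd p))" "pt f" "pt g" shows "pt (\<lambda>x. h (f x) (g x))"
  using pt_comp[OF PT_pair[OF assms(2,3)] assms(1)] by simp

lemma pt_comp3:
  assumes "pt (\<lambda>p. h (fst p) (fst (snd p)) (snd (snd p)))" "pt f" "pt g" "pt k"
  shows "pt (\<lambda>x. h (f x) (g x) (k x))"
  using pt_comp[OF PT_pair[OF assms(2) PT_pair[OF assms(3,4)]] assms(1)] by simp

lemma pt_comp4:
  assumes "pt (\<lambda>p. h (fst p) (fst (snd p)) (fst (snd (snd p))) (snd (snd (snd p))))" "pt f" "pt g" "pt k" "pt l"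
  shows "pt (\<lambda>x. h (f x) (g x) (k x) (l x))"
  using pt_comp[OF PT_pair[OF assms(2) PT_pair[OF assms(3) PT_pair[OF assms(4,5)]]] assms(1)] by simp

lemma pt_Cons [pt_intro]: "pt f \<Longrightarrow> pt g \<Longrightarrow> pt (\<lambda>x. f x # g x)"
  by (rule PT_cast[OF PT_pair[of sz f g]]) (simp_all add: repr_prod_def)

lemma pt_Nil [pt_intro]: "pt (\<lambda>_. [])"
  by (rule PT_cast[OF PT_nat[of sz 0]]) (simp_all add: repr_nat_def)

lemma pt_bool [pt_intro]: "pt (\<lambda>_. True)" "pt (\<lambda>_. False)"
  by (rule PT_cast[OF PT_nat[of sz 1]] PT_cast[OF PT_nat[of sz 0]], simp add: repr_nat_def repr_bool_def)+

lemma pt_if [pt_intro]: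
  assumes "pt b" "pt f" "pt g" shows "pt (\<lambda>x. if b x then f x else g x)"
proof -
  have "pt (\<lambda>x. if b x then 1 else 0 :: nat)"
    by (rule PT_cast[OF assms(1)]) (simp add: repr_nat_def repr_bool_def)
  from PT_if_zero[OF this assms(3,2)] show ?thesis
    by (rule PT_cast) simp
qed

lemma pt_cong: "pt f \<Longrightarrow> (\<And>x. f x = g x) \<Longrightarrow> pt g"
  by (metis ext)

lemma pt_conj [pt_intro]: "pt b \<Longrightarrow> pt c \<Longrightarrow> pt (\<lambda>x. b x \<and> c x)"
  by (rule pt_cong[OF pt_if[of b c "\<lambda>_. False"]]) (auto intro: pt_bool)

lemma pt_disj [pt_intro]: "pt b \<Longrightarrow> pt c \<Longrightarrow> pt (\<lambda>x. b x \<or> c x)"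
  by (rule pt_cong[OF pt_if[of b "\<lambda>_. True" c]]) (auto intro: pt_bool)

lemma pt_not [pt_intro]: "pt b \<Longrightarrow> pt (\<lambda>x. \<not> b x)"
  by (rule pt_cong[OF pt_if[of b "\<lambda>_. False" "\<lambda>_. True"]]) (auto intro: pt_bool)

lemma pt_is_zero: "pt f \<Longrightarrow> pt (\<lambda>x. f x = (0 :: nat))"
  by (rule pt_cong[OF PT_if_zero[of sz f "\<lambda>_. True" "\<lambda>_. False"]]) (auto intro: pt_bool)

lemma pt_le [pt_intro]: "pt f \<Longrightarrow> pt g \<Longrightarrow> pt (\<lambda>x. f x \<le> (g x :: nat))"
  using pt_is_zero[OF PT_sub[of sz f g]] by simp

lemma pt_less [pt_intro]: "pt f \<Longrightarrow> pt g \<Longrightarrow> pt (\<lambda>x. f x < (g x :: nat))"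
  using pt_not[OF pt_le[of g f]] by (simp add: not_le)

lemma pt_eq [pt_intro]: "pt f \<Longrightarrow> pt g \<Longrightarrow> pt (\<lambda>x. f x = (g x :: nat))"
  using pt_conj[OF pt_le[of f g] pt_le[of g f]] by (simp add: eq_iff)

lemma pt_case_list [pt_intro]:
  assumes "pt l" "pt f" "pt (\<lambda>p. g (fst p) (fst (snd p)) (snd (snd p)))"
  shows "pt (\<lambda>x. case l x of [] \<Rightarrow> f x | y # ys \<Rightarrow> g x y ys)"
  using PT_list_case[OF assms order_refl] by (simp only: fst_conv snd_conv)

section \<open>Folds with controlled growth and the list functions defined by them\<close>

lemma pb_elem:
  assumes f: "pt (\<lambda>p. f (fst p) (snd p))" and l: "pt l"
  obtains h where "pb sz h" "\<And>x y. y \<in> set (l x) \<Longrightarrow> sz (f x y) \<le> h x"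
proof -
  obtain k where k: "\<And>p. sz (f (fst p) (snd p)) \<le> (sz p + 2) ^ k"
    using PT_size[OF f] unfolding pb_def by blast
  have "pb (\<lambda>n. n) (\<lambda>n :: nat. (n + 2) ^ k)" unfolding pb_def by blast
  moreover have "pb sz (\<lambda>x. sz x + sz (l x) + 1)"
    by (intro pb_intros PT_size l)
  ultimately have "pb sz (\<lambda>x. (sz x + sz (l x) + 1 + 2) ^ k)"
    using pb_comp[of "\<lambda>n. n" "\<lambda>n. (n + 2) ^ k" sz "\<lambda>x. sz x + sz (l x) + 1"] by simp
  moreover have "sz (f x y) \<le> (sz x + sz (l x) + 1 + 2) ^ k" if "y \<in> set (l x)" for x y
  proof -
    have "sz y \<le> sz (l x)"
      using that sz_nth by (metis in_set_conv_nth)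
    then have "sz (x, y) \<le> sz x + sz (l x) + 1" by simp
    then have "(sz (x, y) + 2) ^ k \<le> (sz x + sz (l x) + 1 + 2) ^ k" by (intro power_mono) auto
    with k[of "(x, y)"] show ?thesis by simp
  qed
  ultimately show thesis using that by blast
qed

lemma foldl_growth:
  assumes "\<And>a y. y \<in> set l \<Longrightarrow> sz (s a y) \<le> sz a + h"
  shows "sz (foldl s a l) \<le> sz a + length l * h"
  using assms
proof (induction l arbitrary: a)
  case (Cons y l)
  have "sz (foldl s (s a y) l) \<le> sz (s a y) + length l * h"
    using Cons by simp
  with Cons.prems[of y a] show ?case by simp
qed simp

text \<open>If a step adds at most \<open>h x\<close> to the size, independently of the accumulator,
  then all intermediate sizes are at most the initial size plus the length of the list times
  \<open>h x\<close>.\<close>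

lemma pt_foldl:
  assumes i: "pt i" and l: "pt l" and s: "pt (\<lambda>p. s (fst p) (fst (snd p)) (snd (snd p)))"
    and h: "pb sz h" "\<And>x a y. y \<in> set (l x) \<Longrightarrow> sz (s x a y) \<le> sz a + h x"
  shows "pt (\<lambda>x. foldl (s x) (i x) (l x))"
proof (rule PT_foldl[OF i l s])
  show "pb sz (\<lambda>x. sz (i x) + sz (l x) * h x)"
    by (intro pb_add pb_mult PT_size i l h)
  fix x j
  have "sz (foldl (s x) (i x) (take j (l x))) \<le> sz (i x) + length (take j (l x)) * h x"
    by (rule foldl_growth) (meson h(2) in_set_takeD)
  also have "\<dots> \<le> sz (i x) + sz (l x) * h x"
    using length_le_sz[of "l x"] by (intro add_left_mono mult_le_mono1) simp
  finally show "sz (foldl (s x) (i x) (take j (l x))) \<le> sz (i x) + sz (l x) * h x" .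
qed simp

lemma pt_foldl_nat:
  assumes "pt i" "pt l" "pt (\<lambda>p. s (fst p) (fst (snd p)) (snd (snd p)))"
  shows "pt (\<lambda>x. foldl (s x) (i x :: nat) (l x))"
  by (rule pt_foldl[OF assms pb_const[of sz 0]]) simp

lemma foldl_Cons_rev: "foldl (\<lambda>a y. f y # a) b l = rev (map f l) @ b"
  by (induction l arbitrary: b) auto

lemma elem_sz: "y \<in> set l \<Longrightarrow> sz y \<le> sz l"
  using sz_nth by (metis in_set_conv_nth)

lemma pt_rev [pt_intro]:
  fixes l :: "'x :: repr \<Rightarrow> 'a :: repr list"
  assumes "pt l" shows "pt (\<lambda>x. rev (l x))"
proof -
  have "pt (\<lambda>l :: 'a list. foldl (\<lambda>a y. y # a) [] l)"
    by (rule pt_foldl[where h = "\<lambda>l. sz l + 1"]) ((intro pt_intro pb_intros)+, auto dest: elem_sz)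
  then show ?thesis using pt_comp[OF assms, of rev] by (simp add: foldl_Cons_rev[of "\<lambda>y. y"])
qed

lemma pt_map [pt_intro]:
  assumes f: "pt (\<lambda>p. f (fst p) (snd p))" and l: "pt l"
  shows "pt (\<lambda>x. map (f x) (l x))"
proof -
  obtain h where h: "pb sz h" "\<And>x y. y \<in> set (l x) \<Longrightarrow> sz (f x y) \<le> h x"
    using f l by (rule pb_elem) blast
  have "pt (\<lambda>p. f (fst p) (snd (snd p)))"
    by (rule pt_comp2[OF f]) (intro pt_intro)+
  then have "pt (\<lambda>x. foldl (\<lambda>a y. f x y # a) [] (l x))"
    by (intro pt_foldl[where h = "\<lambda>x. h x + 1"] l pt_intro pb_intros h) (auto dest: h(2))
  from pt_rev[OF this] show ?thesis by (simp add: foldl_Cons_rev)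
qed

lemma foldl_filter_rev: "foldl (\<lambda>a y. if b y then y # a else a) c l = rev (filter b l) @ c"
  by (induction l arbitrary: c) auto

lemma pt_filter [pt_intro]:
  assumes b: "pt (\<lambda>p. b (fst p) (snd p))" and l: "pt l"
  shows "pt (\<lambda>x. filter (b x) (l x))"
proof -
  have "pt (\<lambda>p. b (fst p) (snd (snd p)))"
    by (rule pt_comp2[OF b]) (intro pt_intro)+
  then have "pt (\<lambda>x. foldl (\<lambda>a y. if b x y then y # a else a) [] (l x))"
    by (intro pt_foldl[where h = "\<lambda>x. sz (l x) + 1"] l pt_intro pb_add pb_const PT_size) (auto dest: elem_sz)
  from pt_rev[OF this] show ?thesis by (simp add: foldl_filter_rev)
qed

lemma pt_bex [pt_intro]:
  assumes b: "pt (\<lambda>p. b (fst p) (snd p))" and l: "pt l"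
  shows "pt (\<lambda>x. \<exists>y\<in>set (l x). b x y)"
proof -
  have "pt (\<lambda>x. case filter (b x) (l x) of [] \<Rightarrow> False | y # ys \<Rightarrow> True)"
    by (intro pt_intro b l)
  moreover have "(case filter (b x) (l x) of [] \<Rightarrow> False | y # ys \<Rightarrow> True) \<longleftrightarrow> (\<exists>y\<in>set (l x). b x y)" for x
    by (auto split: list.split simp: filter_empty_conv) (metis list.set_intros(1) mem_Collect_eq set_filter)
  ultimately show ?thesis by simp
qed

lemma pt_ball [pt_intro]:
  assumes "pt (\<lambda>p. b (fst p) (snd p))" "pt l"
  shows "pt (\<lambda>x. \<forall>y\<in>set (l x). b x y)"
  using pt_not[OF pt_bex[OF pt_not[OF assms(1)] assms(2)]] by simp

lemma pt_member [pt_intro]: "pt f \<Longrightarrow> pt l \<Longrightarrow> pt (\<lambda>x. (f x :: nat) \<in> set (l x))"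
  by (rule pt_cong[OF pt_bex[of "\<lambda>x y. y = f x" l]])
    (auto intro: pt_eq pt_snd pt_comp[OF pt_fst])

lemma pt_append [pt_intro]:
  assumes "pt f" "pt g" shows "pt (\<lambda>x. f x @ g x)"
proof -
  have "pt (\<lambda>x. foldl (\<lambda>a y. y # a) (g x) (rev (f x)))"
    by (rule pt_foldl[where h = "\<lambda>x. sz (f x) + 1"]) ((intro pt_intro assms pb_intros PT_size)+, auto dest: elem_sz)
  then show ?thesis by (simp add: foldl_Cons_rev[of "\<lambda>y. y"])
qed

lemma sz_append: "sz (xs @ ys) + 1 = sz xs + sz ys"
  by (induction xs) auto

lemma foldl_append_concat: "foldl (@) a l = a @ concat l"
  by (induction l arbitrary: a) auto

lemma pt_concat [pt_intro]:
  assumes "pt l" shows "pt (\<lambda>x. concat (l x))"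
proof -
  have "pt (\<lambda>x. foldl (\<lambda>a y. a @ y) [] (l x))"
  proof (rule pt_foldl[where h = "\<lambda>x. sz (l x)"])
    fix x a y assume "y \<in> set (l x)"
    then show "sz (a @ y) \<le> sz a + sz (l x)"
      using elem_sz[of y "l x"] sz_append[of a y] by simp
  qed (intro pt_intro assms PT_size)+
  then show ?thesis by (simp add: foldl_append_concat)
qed

lemma pt_length [pt_intro]:
  assumes "pt l" shows "pt (\<lambda>x. length (l x))"
proof -
  have e: "foldl (\<lambda>a y. a + 1) n l = n + length l" for n and l :: "'z list"
    by (induction l arbitrary: n) auto
  have "pt (\<lambda>x. foldl (\<lambda>a y. a + 1) (0 :: nat) (l x))"
    by (rule pt_foldl_nat[where i = "\<lambda>_. 0" and l = l and s = "\<lambda>_ a _. a + 1"]) (intro pt_intro assms)+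
  then show ?thesis unfolding e by simp
qed

lemma pt_sum_list [pt_intro]:
  assumes "pt l" shows "pt (\<lambda>x. sum_list (l x) :: nat)"
proof -
  have e: "foldl (\<lambda>a y. a + y) n l = n + sum_list l" for n :: nat and l
    by (induction l arbitrary: n) auto
  have "pt (\<lambda>x. foldl (\<lambda>a y. a + y) (0 :: nat) (l x))"
    by (intro pt_foldl_nat pt_intro assms)
  then show ?thesis unfolding e by simp
qed

lemma pt_tl [pt_intro]:
  assumes "pt l" shows "pt (\<lambda>x. tl (l x))"
proof -
  have "pt (\<lambda>x. case l x of [] \<Rightarrow> [] | y # ys \<Rightarrow> ys)"
    by (intro pt_intro assms)
  moreover have "(case xs of [] \<Rightarrow> [] | y # ys \<Rightarrow> ys) = tl xs" for xs :: "'b list"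
    by (cases xs) auto
  ultimately show ?thesis by simp
qed

definition hd_or :: "'a \<Rightarrow> 'a list \<Rightarrow> 'a" where
  "hd_or d xs = (case xs of [] \<Rightarrow> d | y # ys \<Rightarrow> y)"

lemma hd_or_simps [simp]: "hd_or d [] = d" "hd_or d (y # ys) = y"
  by (simp_all add: hd_or_def)

lemma pt_hd_or [pt_intro]: "pt d \<Longrightarrow> pt l \<Longrightarrow> pt (\<lambda>x. hd_or (d x) (l x))"
  unfolding hd_or_def by (intro pt_intro)

lemma pt_enumerate [pt_intro]:
  assumes "pt l" shows "pt (\<lambda>x. List.enumerate 0 (l x))"
proof -
  have e: "foldl (\<lambda>a y. (length a, y) # a) b l = rev (List.enumerate (length b) l) @ b"
    for b and l :: "'z list"
    by (induction l arbitrary: b) auto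
  have "pt (\<lambda>x. foldl (\<lambda>a y. (length a, y) # a) [] (l x))"
    by (rule pt_foldl[where h = "\<lambda>x. sz (l x) + 3"]) ((intro pt_intro assms pb_intros PT_size)+, auto dest: elem_sz)
  from pt_rev[OF this] show ?thesis unfolding e by simp
qed

lemma pt_zip [pt_intro]:
  assumes "pt k" "pt l" shows "pt (\<lambda>x. zip (k x) (l x))"
proof -
  \<comment> \<open>The state pairs the reversed result with the unread rest of the second list;
    once that rest is empty the state no longer changes, as \<open>zip\<close> demands.\<close>
  define s where "s = (\<lambda>(p :: ('b \<times> 'c) list \<times> 'c list) (y :: 'b).
    case snd p of [] \<Rightarrow> p | z # zs \<Rightarrow> ((y, z) # fst p, zs))"
  have n: "foldl s (a, []) k = (a, [])" for a k
    by (induction k) (auto simp: s_def)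
  have e: "fst (foldl s (a, l) k) = rev (zip k l) @ a" for a k l
  proof (induction k arbitrary: a l)
    case (Cons y k)
    then show ?case
    proof (cases l)
      case Nil
      then show ?thesis by (simp only: n) simp
    qed (auto simp: s_def)
  qed simp
  have "pt (\<lambda>x. foldl s ([], l x) (k x))"
  proof (rule pt_foldl[where h = "\<lambda>x. sz (k x) + 1"])
    show "pt (\<lambda>p :: 'a \<times> (('b \<times> 'c) list \<times> 'c list) \<times> 'b. s (fst (snd p)) (snd (snd p)))"
      unfolding s_def by (intro pt_intro)
    show "sz (s a y) \<le> sz a + (sz (k x) + 1)" if "y \<in> set (k x)" for x a y
      using elem_sz[OF that] by (cases a) (auto simp: s_def split: list.split)
  qed (intro pt_intro assms pb_intros PT_size)+
  from pt_rev[OF pt_fst_of[OF this]] show ?thesis unfolding e by simp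
qed

lemma list_update_enumerate:
  "xs[i := v] = map (\<lambda>p. if fst p = i then v else snd p) (List.enumerate 0 xs)"
  by (rule nth_equalityI) (auto simp: nth_enumerate_eq nth_list_update)

lemma pt_list_update [pt_intro]:
  assumes "pt l" "pt i" "pt v" shows "pt (\<lambda>x. (l x)[i x := v x])"
  unfolding list_update_enumerate
  by (intro pt_intro assms pt_comp[OF pt_fst assms(2)] pt_comp[OF pt_fst assms(3)])

section \<open>One column: cardinality matching by augmentation\<close>

type_synonym item = "nat \<times> nat \<times> nat"

definition cnt :: "nat list \<Rightarrow> nat \<Rightarrow> nat" where
  "cnt x v = length (filter (\<lambda>y. y = v) x)"

text \<open>The third component \<open>h\<close> of an item is 0 if there is no upper bound and the
  successor of the bound otherwise.\<close>

definition viol :: "nat \<Rightarrow> item \<Rightarrow> nat" where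
  "viol c it = (fst (snd it) - c) + (if snd (snd it) = 0 then 0 else c + 1 - snd (snd it))"

definition pen :: "item list \<Rightarrow> nat list \<Rightarrow> nat" where
  "pen g x = sum_list (map (\<lambda>it. viol (cnt x (fst it)) it) g)"

definition fits :: "nat list list \<Rightarrow> nat list \<Rightarrow> bool" where
  "fits L x \<longleftrightarrow> length x = length L \<and> (\<forall>i<length L. x ! i \<in> set (L ! i))"

text \<open>An edge \<open>(i, a, w)\<close> allows row \<open>i\<close> to change from its current
  value \<open>a\<close> to \<open>w\<close>. A table entry \<open>(z, y)\<close> records the
  assignment \<open>y\<close> obtained by changing rows along a path from the start value to
  \<open>z\<close>, which moves one occurrence from the start value to \<open>z\<close>.\<close>

type_synonym edge = "nat \<times> nat \<times> nat"
type_synonym table = "(nat \<times> nat list) list"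

definition edges :: "nat list list \<Rightarrow> nat list \<Rightarrow> edge list" where
  "edges L x = concat (map (\<lambda>p. map (\<lambda>w. (fst p, fst (snd p), w)) (snd (snd p))) (List.enumerate 0 (zip x L)))"

definition ext :: "table \<Rightarrow> edge \<Rightarrow> table" where
  "ext T e = (if \<exists>p\<in>set T. fst p = snd (snd e) then T
     else case filter (\<lambda>p. fst p = fst (snd e)) T of [] \<Rightarrow> T
       | p # ps \<Rightarrow> (snd (snd e), (snd p)[fst e := snd (snd e)]) # T)"

definition reach :: "edge list \<Rightarrow> nat list \<Rightarrow> nat \<Rightarrow> table" where
  "reach E x u = foldl (\<lambda>T _. foldl ext T E) [(u, x)] ((0, 0, 0) # E)"

definition neigh :: "nat list list \<Rightarrow> nat list \<Rightarrow> nat list list" where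
  "neigh L x = concat (map (\<lambda>u. map snd (reach (edges L x) x u)) x)"

definition improve :: "nat list list \<Rightarrow> item list \<Rightarrow> nat list \<Rightarrow> nat list" where
  "improve L g x = hd_or x (filter (\<lambda>y. pen g y < pen g x) (neigh L x))"

text \<open>The concatenated list is only a clock. Its length, twice the number of rows for every
  item, is the largest penalty that the starting assignment can have in a solvable column.\<close>

definition match :: "nat list list \<Rightarrow> item list \<Rightarrow> nat list" where
  "match L g = foldl (\<lambda>x _. improve L g x) (map (hd_or 0) L) (concat (map (\<lambda>_. L @ L) g))"

text \<open>Nonempty domains are checked separately, because otherwise the starting assignment
  contains the default 0, which may lie outside its domain.\<close>

definition colok :: "nat list list \<Rightarrow> item list \<Rightarrow> bool" where
  "colok L g \<longleftrightarrow> (\<forall>l\<in>set L. 0 < length l) \<and> pen g (match L g) = 0"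

section \<open>Search for augmenting paths\<close>

lemma set_edges: "set (edges L x) = {(i, x ! i, w) |i w. i < length x \<and> i < length L \<and> w \<in> set (L ! i)}"
proof -
  have "set (List.enumerate 0 (zip x L)) = (\<lambda>i. (i, x ! i, L ! i)) ` {..<min (length x) (length L)}"
    by (auto simp: in_set_enumerate_eq image_iff)
  then show ?thesis by (auto simp: edges_def)
qed

lemma cnt_Cons: "cnt (a # x) v = cnt x v + (if v = a then 1 else 0)"
  by (simp add: cnt_def)

lemma cnt_update:
  "i < length y \<Longrightarrow> cnt (y[i := w]) v + (if v = y ! i then 1 else 0) = cnt y v + (if v = w then 1 else 0)"
proof (induction y arbitrary: i)
  case (Cons a y)
  then show ?case
  proof (cases i)
    case (Suc k)
    with Cons.IH[of k] Cons.prems show ?thesis by (simp add: cnt_Cons)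
  qed (simp add: cnt_Cons)
qed simp

lemma fits_update: "fits L y \<Longrightarrow> i < length L \<Longrightarrow> w \<in> set (L ! i) \<Longrightarrow> fits L (y[i := w])"
  by (auto simp: fits_def nth_list_update)

lemma cnt_pos: "0 < cnt x u \<longleftrightarrow> u \<in> set x"
  by (auto simp: cnt_def filter_empty_conv)

definition step_rel :: "nat list list \<Rightarrow> nat list \<Rightarrow> (nat \<times> nat) set" where
  "step_rel L x = {(x ! i, w) |i w. i < length L \<and> w \<in> set (L ! i)}"

text \<open>Rows whose value in \<open>x\<close> is the key of a table entry are still unchanged in that
  entry, so an edge of \<open>x\<close> leaving the key can be applied to it.\<close>

definition table_inv :: "nat list list \<Rightarrow> nat list \<Rightarrow> nat \<Rightarrow> table \<Rightarrow> bool" where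
  "table_inv L x u T \<longleftrightarrow> distinct (map fst T) \<and> u \<in> fst ` set T \<and>
     (\<forall>z y. (z, y) \<in> set T \<longrightarrow> (u, z) \<in> (step_rel L x)\<^sup>* \<and> fits L y \<and>
       (\<forall>v. cnt y v + (if v = u then 1 else 0) = cnt x v + (if v = z then 1 else 0)) \<and>
       (\<forall>i<length L. x ! i = z \<longrightarrow> y ! i = z) \<and>
       (\<forall>i<length L. y ! i \<noteq> x ! i \<longrightarrow> x ! i \<in> fst ` set T))"

lemma table_invD:
  assumes "table_inv L x u T" "(z, y) \<in> set T"
  shows "(u, z) \<in> (step_rel L x)\<^sup>*" "fits L y"
    "cnt y v + (if v = u then 1 else 0) = cnt x v + (if v = z then 1 else 0)"
    "i < length L \<Longrightarrow> x ! i = z \<Longrightarrow> y ! i = z"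
    "i < length L \<Longrightarrow> y ! i \<noteq> x ! i \<Longrightarrow> x ! i \<in> fst ` set T"
  using assms unfolding table_inv_def by simp_all

text \<open>The row of the new edge has the key \<open>z\<close> as its value in \<open>x\<close>,
  so by the invariant it is unchanged in the entry of \<open>z\<close> and can still be moved. Thus
  an extended path never changes a row twice.\<close>

lemma ext_inv:
  assumes T: "table_inv L x u T" and x: "fits L x" and e: "e \<in> set (edges L x)"
  shows "table_inv L x u (ext T e)"
proof -
  obtain i w where e': "e = (i, x ! i, w)" "i < length L" "w \<in> set (L ! i)"
    using e by (auto simp: set_edges)
  show ?thesis
  proof (cases "(\<exists>p\<in>set T. fst p = w) \<or> filter (\<lambda>p. fst p = x ! i) T = []")
    case True
    then have "ext T e = T" by (auto simp: ext_def e')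
    with T show ?thesis by simp
  next
    case False
    then obtain p ps where p: "filter (\<lambda>p. fst p = x ! i) T = p # ps"
      by (cases "filter (\<lambda>p. fst p = x ! i) T") auto
    then have "p \<in> set (filter (\<lambda>p. fst p = x ! i) T)" by simp
    then have pT: "p \<in> set T" "fst p = x ! i" by auto
    define z y where "z = x ! i" and "y = snd p"
    have "p = (z, y)" by (simp add: z_def y_def pT(2)[symmetric])
    with pT(1) have zy: "(z, y) \<in> set T" by simp
    have new: "ext T e = (w, y[i := w]) # T"
      using False p by (auto simp: ext_def e' y_def)
    note I = table_invD(1,2,3)[OF T zy] table_invD(4)[OF T zy e'(2) z_def[symmetric]] table_invD(5)[OF T zy]
    have len: "length y = length L" using I(2) by (simp add: fits_def)
    have w: "w \<notin> fst ` set T" using False by auto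
    have "(z, w) \<in> step_rel L x" using e' by (auto simp: step_rel_def z_def)
    then have 1: "(u, w) \<in> (step_rel L x)\<^sup>*" using I(1) by simp
    have 2: "fits L (y[i := w])" using fits_update[OF I(2) e'(2,3)] .
    have 3: "cnt (y[i := w]) v + (if v = u then 1 else 0) = cnt x v + (if v = w then 1 else 0)" for v
    proof -
      have "cnt (y[i := w]) v + (if v = z then 1 else 0) = cnt y v + (if v = w then 1 else 0)"
        using cnt_update[of i y w v] e'(2) len unfolding I(4) by simp
      with I(3)[of v] show ?thesis by linarith
    qed
    \<comment> \<open>Every changed row has a key as its original value, and \<open>w\<close> is not
      yet a key; hence the rows with original value \<open>w\<close> are unchanged.\<close>
    have 4: "y[i := w] ! k = w" if "k < length L" "x ! k = w" for k
      using I(5)[of k] that w len by (cases "k = i") (auto simp: nth_list_update)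
    have 5: "x ! k \<in> fst ` set ((w, y[i := w]) # T)" if "k < length L" "y[i := w] ! k \<noteq> x ! k" for k
    proof (cases "k = i")
      case True
      then show ?thesis using zy z_def by force
    next
      case False
      then show ?thesis using I(5)[of k] that by auto
    qed
    show ?thesis
      unfolding new table_inv_def
    proof (intro conjI allI impI)
      show "distinct (map fst ((w, y[i := w]) # T))" "u \<in> fst ` set ((w, y[i := w]) # T)"
        using T w by (auto simp: table_inv_def)
      fix z' y' assume "(z', y') \<in> set ((w, y[i := w]) # T)"
      then consider (new) "z' = w" "y' = y[i := w]" | (old) "(z', y') \<in> set T" by auto
      note c = this
      show "(u, z') \<in> (step_rel L x)\<^sup>*" by (cases rule: c) (use 1 table_invD(1)[OF T] in auto)
      show "fits L y'" by (cases rule: c) (use 2 table_invD(2)[OF T] in auto)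
      show "cnt y' v + (if v = u then 1 else 0) = cnt x v + (if v = z' then 1 else 0)" for v
        by (cases rule: c) (use 3 table_invD(3)[OF T] in auto)
      show "y' ! k = z'" if "k < length L" "x ! k = z'" for k
        by (cases rule: c) (use that 4 table_invD(4)[OF T] in auto)
      show "x ! k \<in> fst ` set ((w, y[i := w]) # T)" if k: "k < length L" "y' ! k \<noteq> x ! k" for k
      proof (cases rule: c)
        case new
        then show ?thesis using 5[of k] k by blast
      next
        case old
        then show ?thesis using table_invD(5)[OF T old k] by simp
      qed
    qed
  qed
qed

lemma foldl_ext_inv:
  "table_inv L x u T \<Longrightarrow> fits L x \<Longrightarrow> set E \<subseteq> set (edges L x) \<Longrightarrow> table_inv L x u (foldl ext T E)"
  by (induction E arbitrary: T) (auto intro: ext_inv)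

lemma foldl_const: "foldl (\<lambda>a _. f a) a l = (f ^^ length l) a"
  by (induction l arbitrary: a) (auto simp: funpow_swap1)

lemma ext_cases: "ext T e = T \<or> length (ext T e) = Suc (length T)"
  by (auto simp: ext_def split: list.split)

lemma length_ext: "length T \<le> length (ext T e)" "length (ext T e) \<le> Suc (length T)"
  using ext_cases[of T e] by auto

lemma length_foldl_ext: "length T \<le> length (foldl ext T E)" "length (foldl ext T E) \<le> length T + length E"
proof (induction E arbitrary: T)
  case (Cons e E)
  { case 1 show ?case using Cons(1)[of "ext T e"] length_ext(1)[of T e] by simp }
  { case 2 show ?case using Cons(2)[of "ext T e"] length_ext(2)[of T e] by simp }
qed simp_all

text \<open>Tables never shrink, so a pass without net growth cannot have grown at any single
  edge.\<close>

lemma foldl_ext_fix: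
  "length (foldl ext T E) \<le> length T \<Longrightarrow> e \<in> set E \<Longrightarrow> ext T e = T"
proof (induction E)
  case (Cons a E)
  have "length (ext T a) \<le> length (foldl ext (ext T a) E)" by (rule length_foldl_ext)
  then have "ext T a = T" using Cons.prems(1) ext_cases[of T a] by auto
  then show ?case using Cons by auto
qed simp

lemma reach_inv:
  assumes x: "fits L x" shows "table_inv L x u (reach (edges L x) x u)"
proof -
  have "table_inv L x u (((\<lambda>T. foldl ext T (edges L x)) ^^ n) [(u, x)])" for n
  proof (induction n)
    case 0
    then show ?case using x by (auto simp: table_inv_def)
  next
    case (Suc n)
    then show ?case using foldl_ext_inv[OF _ x order_refl] by simp
  qed
  then show ?thesis unfolding reach_def foldl_const by blast
qed

lemma table_length:
  assumes "table_inv L x u T" "fits L x" shows "length T \<le> Suc (length (edges L x))"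
proof -
  have "fst ` set T \<subseteq> insert u ((\<lambda>e. snd (snd e)) ` set (edges L x))"
  proof
    fix z assume "z \<in> fst ` set T"
    then have "(u, z) \<in> (step_rel L x)\<^sup>*" using assms by (auto simp: table_inv_def)
    then show "z \<in> insert u ((\<lambda>e. snd (snd e)) ` set (edges L x))"
      using assms(2) by (cases rule: rtranclE) (force simp: step_rel_def set_edges fits_def)+
  qed
  then have "card (fst ` set T) \<le> card (insert u ((\<lambda>e. snd (snd e)) ` set (edges L x)))"
    by (intro card_mono) auto
  also have "\<dots> \<le> Suc (card ((\<lambda>e. snd (snd e)) ` set (edges L x)))" by (rule card_insert_le_m1) auto
  also have "\<dots> \<le> Suc (length (edges L x))"
    by (simp add: card_image_le order_trans[OF card_image_le card_length])
  finally show ?thesis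
    using assms(1) distinct_card[of "map fst T"] by (simp add: table_inv_def)
qed

text \<open>Until the table is stable every pass adds an entry, and the keys other than
  \<open>u\<close> are targets of edges, so one pass more than there are edges leads to stability.
  In a stable table no edge leaves the set of keys.\<close>

lemma reach_keys:
  assumes x: "fits L x" shows "fst ` set (reach (edges L x) x u) = {w. (u, w) \<in> (step_rel L x)\<^sup>*}"
proof
  let ?E = "edges L x"
  define f where "f = (\<lambda>T. foldl ext T ?E)"
  define N where "N = Suc (length ?E)"
  have T: "reach ?E x u = (f ^^ N) [(u, x)]"
    unfolding reach_def foldl_const by (simp only: f_def N_def list.size(4)) simp
  note I = reach_inv[OF x, of u]
  show "fst ` set (reach ?E x u) \<subseteq> {w. (u, w) \<in> (step_rel L x)\<^sup>*}"
    using I by (auto simp: table_inv_def)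
  have grow: "Suc n \<le> length ((f ^^ n) [(u, x)]) \<or> f ((f ^^ n) [(u, x)]) = (f ^^ n) [(u, x)]" for n
  proof (induction n)
    case (Suc n)
    show ?case
    proof (cases "f ((f ^^ n) [(u, x)]) = (f ^^ n) [(u, x)]")
      case False
      let ?T = "(f ^^ n) [(u, x)]"
      have "length ?T < length (f ?T)"
      proof (rule ccontr)
        assume "\<not> length ?T < length (f ?T)"
        then have "ext ?T e = ?T" if "e \<in> set ?E" for e
          using foldl_ext_fix[of ?T ?E e] that by (simp add: f_def)
        then have "foldl ext ?T E = ?T" if "set E \<subseteq> set ?E" for E
          using that by (induction E) auto
        then show False using False by (simp add: f_def)
      qed
      then show ?thesis using Suc False by simp
    qed simp
  qed simp
  have "table_inv L x u (f (reach ?E x u))"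
    using foldl_ext_inv[OF I x order_refl] by (simp add: f_def)
  from table_length[OF this x] table_length[OF I x]
  have "f (reach ?E x u) = reach ?E x u \<or> Suc N \<le> N"
    using grow[of N] unfolding T N_def[symmetric] by auto
  then have "length (foldl ext (reach ?E x u) ?E) \<le> length (reach ?E x u)"
    by (simp add: f_def)
  then have fx: "ext (reach ?E x u) e = reach ?E x u" if "e \<in> set ?E" for e
    using foldl_ext_fix that by blast
  have closed: "w \<in> fst ` set (reach ?E x u)" if zw: "(z, w) \<in> step_rel L x" "z \<in> fst ` set (reach ?E x u)" for z w
  proof (rule ccontr)
    assume w: "w \<notin> fst ` set (reach ?E x u)"
    obtain i where i: "i < length L" "z = x ! i" "w \<in> set (L ! i)"
      using zw(1) by (auto simp: step_rel_def)
    then have e: "(i, z, w) \<in> set ?E" using x by (auto simp: set_edges fits_def)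
    have "filter (\<lambda>p. fst p = z) (reach ?E x u) \<noteq> []"
      using zw(2) by (auto simp: filter_empty_conv)
    then have "length (ext (reach ?E x u) (i, z, w)) = Suc (length (reach ?E x u))"
      using w by (auto simp: ext_def split: list.split)
    with fx[OF e] show False by simp
  qed
  show "{w. (u, w) \<in> (step_rel L x)\<^sup>*} \<subseteq> fst ` set (reach ?E x u)"
  proof
    fix w assume "w \<in> {w. (u, w) \<in> (step_rel L x)\<^sup>*}"
    then have "(u, w) \<in> (step_rel L x)\<^sup>*" by simp
    then show "w \<in> fst ` set (reach ?E x u)"
    proof induction
      case base
      then show ?case using I by (simp add: table_inv_def)
    qed (use closed in blast)
  qed
qed

section \<open>Existence of an improving path\<close>

lemma length_filter_cnt:
  "set x \<subseteq> F \<Longrightarrow> finite F \<Longrightarrow> length (filter (\<lambda>a. a \<in> K) x) = (\<Sum>v\<in>K \<inter> F. cnt x v)"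
proof (induction x)
  case Nil
  then show ?case by (simp add: cnt_def)
next
  case (Cons a x)
  have "(\<Sum>v\<in>K \<inter> F. cnt (a # x) v) = (\<Sum>v\<in>K \<inter> F. cnt x v + (if v = a then 1 else 0))"
    by (intro sum.cong) (auto simp: cnt_def)
  also have "\<dots> = (\<Sum>v\<in>K \<inter> F. cnt x v) + (if a \<in> K then 1 else 0)"
    using Cons.prems by (simp add: sum.distrib)
  finally show ?case using Cons by simp
qed

text \<open>The hypothesis says that no row leaves \<open>K\<close> on passing from \<open>x\<close>
  to \<open>y\<close>, so \<open>y\<close> has at least as many entries in \<open>K\<close>. If one
  value of \<open>K\<close> loses occurrences, another one has to gain some.\<close>

lemma cut_argument:
  assumes "length x = length y" "\<And>i. i < length x \<Longrightarrow> x ! i \<in> K \<Longrightarrow> y ! i \<in> K"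
    and "u \<in> K" "cnt y u < cnt x u"
  shows "\<exists>w\<in>K. cnt x w < cnt y w"
proof (rule ccontr)
  assume "\<not> (\<exists>w\<in>K. cnt x w < cnt y w)"
  then have le: "cnt y w \<le> cnt x w" if "w \<in> K" for w using that by force
  define F where "F = set x \<union> set y"
  have "u \<in> set x" using assms(4) cnt_pos[of x u] by simp
  then have "(\<Sum>v\<in>K \<inter> F. cnt y v) < (\<Sum>v\<in>K \<inter> F. cnt x v)"
    using assms(3,4) le by (intro sum_strict_mono_ex1) (auto simp: F_def)
  then have "length (filter (\<lambda>a. a \<in> K) y) < length (filter (\<lambda>a. a \<in> K) x)"
    using length_filter_cnt[of x F K] length_filter_cnt[of y F K] by (simp add: F_def)
  moreover have "length (filter (\<lambda>a. a \<in> K) x) \<le> length (filter (\<lambda>a. a \<in> K) y)"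
    unfolding length_filter_conv_card using assms(1,2) by (intro card_mono) auto
  ultimately show False by simp
qed

text \<open>As a function of the count the violation is convex and integer valued, and it vanishes
  at the feasible count \<open>c'\<close>. A unit step towards \<open>c'\<close> therefore never
  increases it and decreases it where it is positive.\<close>

lemma viol_decrease:
  "viol c' it = 0 \<Longrightarrow> c' < c \<Longrightarrow> d + 1 = c \<Longrightarrow> viol d it \<le> viol c it"
  "viol c' it = 0 \<Longrightarrow> c' < c \<Longrightarrow> d + 1 = c \<Longrightarrow> 0 < viol c it \<Longrightarrow> viol d it < viol c it"
  "viol c' it = 0 \<Longrightarrow> c < c' \<Longrightarrow> d = c + 1 \<Longrightarrow> viol d it \<le> viol c it"
  "viol c' it = 0 \<Longrightarrow> c < c' \<Longrightarrow> d = c + 1 \<Longrightarrow> 0 < viol c it \<Longrightarrow> viol d it < viol c it"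
  by (auto simp: viol_def split: if_splits)

lemma sum_list_strict:
  fixes f :: "'a \<Rightarrow> nat"
  shows "(\<And>a. a \<in> set l \<Longrightarrow> f a \<le> h a) \<Longrightarrow> b \<in> set l \<Longrightarrow> f b < h b \<Longrightarrow> sum_list (map f l) < sum_list (map h l)"
proof (induction l)
  case (Cons a l)
  have le: "sum_list (map f l) \<le> sum_list (map h l)"
    using Cons.prems(1) by (intro sum_list_mono) auto
  show ?case
  proof (cases "b \<in> set l")
    case True
    then have "sum_list (map f l) < sum_list (map h l)" using Cons.prems by (intro Cons.IH) auto
    with Cons.prems(1)[of a] show ?thesis by simp
  next
    case False
    then have "f a < h a" using Cons.prems(2,3) by auto
    with le show ?thesis by simp
  qed
qed simp

text \<open>The path joins a value that occurs more often in \<open>x\<close> than in the feasible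
  \<open>y\<close> to one that occurs less often, and one of its ends is the value of a violated
  item. Both counts that change move by one towards those of \<open>y\<close>.\<close>

lemma improving_neighbour:
  assumes x: "fits L x" and y: "fits L y" "pen g y = 0" and pos: "0 < pen g x"
  shows "\<exists>z\<in>set (neigh L x). pen g z < pen g x"
proof -
  have len: "length x = length L" "length y = length L" using x y by (simp_all add: fits_def)
  obtain it where it: "it \<in> set g" "0 < viol (cnt x (fst it)) it"
    using pos unfolding pen_def neq0_conv[symmetric] sum_list_eq_0_iff by auto
  have y0: "viol (cnt y (fst it)) it = 0" if "it \<in> set g" for it
    using y(2) that by (auto simp: pen_def sum_list_eq_0_iff)
  let ?R = "(step_rel L x)\<^sup>*"
  have edge: "(x ! i, y ! i) \<in> step_rel L x" if "i < length L" for i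
    using that y(1) by (auto simp: step_rel_def fits_def)
  \<comment> \<open>Changing row \<open>i\<close> from \<open>x ! i\<close> to \<open>y ! i\<close>
    is an edge. Hence the values reachable from a surplus value are closed on passing from
    \<open>x\<close> to \<open>y\<close>, and the values from which a deficient one is reachable are
    closed on passing from \<open>y\<close> to \<open>x\<close>; \<open>cut_argument\<close>
    provides the other end of the path.\<close>
  obtain u w where uw: "(u, w) \<in> ?R" "cnt y u < cnt x u" "cnt x w < cnt y w" "fst it \<in> {u, w}"
  proof (cases "cnt y (fst it) < cnt x (fst it)")
    case True
    let ?K = "{w. (fst it, w) \<in> ?R}"
    have "\<exists>w\<in>?K. cnt x w < cnt y w"
    proof (rule cut_argument[OF _ _ _ True])
      show "y ! i \<in> ?K" if "i < length x" "x ! i \<in> ?K" for i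
        using that(2) edge[of i] that(1) len by (auto intro: rtrancl_into_rtrancl)
    qed (use len in auto)
    then show thesis using that[of "fst it"] True by auto
  next
    case False
    have "cnt x (fst it) \<noteq> cnt y (fst it)" using y0[OF it(1)] it(2) by force
    with False have lt: "cnt x (fst it) < cnt y (fst it)" by simp
    let ?K = "{u. (u, fst it) \<in> ?R}"
    have "\<exists>w\<in>?K. cnt y w < cnt x w"
    proof (rule cut_argument[OF _ _ _ lt])
      show "x ! i \<in> ?K" if "i < length y" "y ! i \<in> ?K" for i
        using that(2) edge[of i] that(1) len by (auto intro: converse_rtrancl_into_rtrancl)
    qed (use len in auto)
    then show thesis using that[of _ "fst it"] lt by auto
  qed
  then have "u \<in> set x" using cnt_pos[of x u] by simp
  moreover have "w \<in> fst ` set (reach (edges L x) x u)"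
    using uw(1) reach_keys[OF x] by simp
  then obtain z where z: "(w, z) \<in> set (reach (edges L x) x u)" by force
  ultimately have "z \<in> set (neigh L x)" unfolding neigh_def by force
  moreover have zc: "cnt z v + (if v = u then 1 else 0) = cnt x v + (if v = w then 1 else 0)" for v
    by (rule table_invD(3)[OF reach_inv[OF x] z])
  have ne: "u \<noteq> w" using uw by auto
  have zu: "cnt z u + 1 = cnt x u" and zw: "cnt z w = cnt x w + 1"
    and zo: "v \<noteq> u \<Longrightarrow> v \<noteq> w \<Longrightarrow> cnt z v = cnt x v" for v
    using zc[of u] zc[of w] zc[of v] ne by auto
  have le: "viol (cnt z (fst a)) a \<le> viol (cnt x (fst a)) a" if "a \<in> set g" for a
  proof -
    consider "fst a = u" | "fst a = w" | "fst a \<noteq> u" "fst a \<noteq> w" by blast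
    then show ?thesis
    proof cases
      case 1
      then show ?thesis using viol_decrease(1)[OF y0[OF that], of "cnt x u" "cnt z u"] zu uw(2) by simp
    next
      case 2
      then show ?thesis using viol_decrease(3)[OF y0[OF that], of "cnt x w" "cnt z w"] zw uw(3) by simp
    next
      case 3
      then show ?thesis using zo[of "fst a"] by simp
    qed
  qed
  have "viol (cnt z (fst it)) it < viol (cnt x (fst it)) it"
    using uw(4) viol_decrease(2)[OF y0[OF it(1)], of "cnt x u" "cnt z u"]
      viol_decrease(4)[OF y0[OF it(1)], of "cnt x w" "cnt z w"] zu zw uw(2,3) it(2) by auto
  then have "pen g z < pen g x"
    unfolding pen_def by (intro sum_list_strict[OF _ it(1)]) (use le in auto)
  ultimately show ?thesis by blast
qed

lemma neigh_fits: "fits L x \<Longrightarrow> z \<in> set (neigh L x) \<Longrightarrow> fits L z"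
  by (auto simp: neigh_def dest: table_invD(2)[OF reach_inv])

lemma hd_or_filter:
  fixes P :: "'a \<Rightarrow> bool"
  shows "hd_or d (filter P l) = d \<and> (\<forall>y\<in>set l. \<not> P y) \<or> P (hd_or d (filter P l)) \<and> hd_or d (filter P l) \<in> set l"
proof (cases "filter P l")
  case (Cons a as)
  then have "a \<in> set (filter P l)" by simp
  then have "P a" "a \<in> set l" by auto
  with Cons show ?thesis by simp
qed (auto simp: filter_empty_conv)

lemma improve_fits: "fits L x \<Longrightarrow> fits L (improve L g x)"
  using hd_or_filter[of x "\<lambda>y. pen g y < pen g x" "neigh L x"] neigh_fits[of L x]
  unfolding improve_def by metis

lemma improve_pen:
  assumes "fits L x" "fits L y" "pen g y = 0" shows "pen g (improve L g x) \<le> pen g x - 1"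
proof (cases "pen g x = 0")
  case True
  then show ?thesis by (simp add: improve_def)
next
  case False
  then have "\<exists>z\<in>set (neigh L x). pen g z < pen g x"
    using improving_neighbour[OF assms] by simp
  then show ?thesis
    using hd_or_filter[of x "\<lambda>y. pen g y < pen g x" "neigh L x"] unfolding improve_def by force
qed

lemma cnt_le: "cnt x v \<le> length x"
  by (simp add: cnt_def)

lemma viol_le: "fst (snd it) \<le> k \<Longrightarrow> c \<le> k \<Longrightarrow> viol c it \<le> 2 * k"
  unfolding viol_def by (cases "snd (snd it) = 0") auto

lemma colok_iff: "colok L g \<longleftrightarrow> (\<exists>x. fits L x \<and> pen g x = 0)"
proof -
  let ?x = "\<lambda>n. (improve L g ^^ n) (map (hd_or 0) L)"
  define n where "n = length g * (2 * length L)"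
  have m: "match L g = ?x n"
  proof -
    have "length (concat (map (\<lambda>_. L @ L) l)) = length l * (2 * length L)" for l :: "item list"
      by (induction l) auto
    then have "length (concat (map (\<lambda>_. L @ L) g)) = n" by (simp add: n_def)
    then show ?thesis by (simp add: match_def foldl_const)
  qed
  have fit: "fits L (?x k)" if "\<forall>l\<in>set L. 0 < length l" for k
  proof (induction k)
    case 0
    have "hd_or 0 l \<in> set l" if "0 < length l" for l :: "nat list" using that by (cases l) auto
    then show ?case using that by (auto simp: fits_def)
  qed (simp add: improve_fits)
  show ?thesis
  proof
    assume "colok L g"
    then show "\<exists>x. fits L x \<and> pen g x = 0" using fit m by (auto simp: colok_def)
  next
    assume "\<exists>x. fits L x \<and> pen g x = 0"
    then obtain y where y: "fits L y" "pen g y = 0" by blast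
    have ne: "\<forall>l\<in>set L. 0 < length l"
      using y(1) by (force simp: fits_def in_set_conv_nth)
    have dec: "pen g (?x k) \<le> pen g (?x 0) - k" for k
    proof (induction k)
      case (Suc k)
      have "pen g (?x (Suc k)) \<le> pen g (?x k) - 1"
        using improve_pen[OF fit[OF ne] y] by simp
      with Suc show ?case by linarith
    qed simp
    \<comment> \<open>A feasible \<open>y\<close> meets all lower quotas, so these are at most the
      number of rows. An upper quota is exceeded by at most the number of rows in any case.\<close>
    have "pen g (?x 0) \<le> n"
    proof -
      have "viol (cnt (?x 0) (fst it)) it \<le> 2 * length L" if "it \<in> set g" for it
      proof -
        have "viol (cnt y (fst it)) it = 0"
          using y(2) that by (auto simp: pen_def sum_list_eq_0_iff)
        then have "fst (snd it) \<le> length L" using cnt_le[of y "fst it"] y(1) by (simp add: viol_def fits_def)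
        moreover have "cnt (?x 0) (fst it) \<le> length L" using cnt_le[of "?x 0" "fst it"] by simp
        ultimately show ?thesis by (rule viol_le)
      qed
      then have "pen g (?x 0) \<le> sum_list (map (\<lambda>_. 2 * length L) g)"
        unfolding pen_def by (rule sum_list_mono)
      then show ?thesis by (simp add: n_def sum_list_triv)
    qed
    with dec[of n] have "pen g (match L g) = 0" unfolding m by simp
    with ne show "colok L g" by (simp add: colok_def)
  qed
qed

section \<open>Propagation over the columns\<close>

type_synonym aut = "nat \<times> nat \<times> nat list \<times> edge list"

definition dedup :: "nat list \<Rightarrow> nat list" where
  "dedup l = foldl (\<lambda>a y. if y \<in> set a then a else y # a) [] l"

text \<open>A run visits only the start state and targets of transitions. Removing duplicates makes
  the length a count of states, so that \<open>nst\<close> bounds it.\<close>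

definition states :: "aut \<Rightarrow> nat list" where
  "states A = dedup (fst (snd A) # map (\<lambda>t. snd (snd t)) (snd (snd (snd A))))"

definition vectors :: "aut list \<Rightarrow> nat list list" where
  "vectors As = foldl (\<lambda>V A. concat (map (\<lambda>q. map (\<lambda>s. s @ [q]) V) (states A))) [[]] As"

definition allowed :: "aut list \<Rightarrow> nat list list \<Rightarrow> nat list \<Rightarrow> nat list \<Rightarrow> nat list list" where
  "allowed As ds s s' = map (\<lambda>p. filter (\<lambda>v. \<exists>t\<in>set (snd (snd (snd (fst (snd (snd p)))))).
      fst t = fst p \<and> fst (snd t) = v \<and> snd (snd t) = fst (snd p)) (snd (snd (snd p))))
    (zip s (zip s' (zip As ds)))"

definition advance ::
  "nat list list \<Rightarrow> aut list \<Rightarrow> item list \<Rightarrow> nat list list \<Rightarrow> nat list list \<Rightarrow> nat list list" where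
  "advance V As g ds S = filter (\<lambda>s'. \<exists>s\<in>set S. colok (allowed As ds s s') g) V"

text \<open>Next to the current set of vectors the fold carries the domain matrix without the
  columns already treated, so the next column consists of the heads of its rows.\<close>

definition sweep :: "nat list list \<Rightarrow> aut list \<Rightarrow> item list list \<Rightarrow> nat list list list
    \<Rightarrow> nat list list \<times> nat list list list" where
  "sweep V As G D = foldl (\<lambda>p g. (advance V As g (map (hd_or []) (snd p)) (fst p), map tl (snd p)))
     ([map (\<lambda>A. fst (snd A)) As], D) G"

definition solvable :: "nat list list \<Rightarrow> aut list \<Rightarrow> item list list \<Rightarrow> nat list list list \<Rightarrow> bool" where
  "solvable V As G D \<longleftrightarrow> (\<exists>s\<in>set (fst (sweep V As G D)).
     \<forall>p\<in>set (zip s As). fst p \<in> set (fst (snd (snd (snd p)))))"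

definition prune ::
  "nat list list \<Rightarrow> aut list \<Rightarrow> item list list \<Rightarrow> nat list list list \<Rightarrow> nat list list list" where
  "prune V As G D = map (\<lambda>p. map (\<lambda>q. filter (\<lambda>v. solvable V As G (D[fst p := (snd p)[fst q := [v]]])) (snd q))
     (List.enumerate 0 (snd p))) (List.enumerate 0 D)"

text \<open>The tuple lists the fields in the order of the input encoding, so it is what the parser
  returns.\<close>

definition aut_of :: "dfa \<Rightarrow> aut" where
  "aut_of A = (nst A, start A, fins A, trans A)"

definition item_of :: "gcc_item \<Rightarrow> item" where
  "item_of c = (fst c, fst (snd c), case snd (snd c) of None \<Rightarrow> 0 | Some h \<Rightarrow> Suc h)"

section \<open>Correctness of the sweep and of pruning\<close>

lemma dedup: "set (dedup l) = set l" "distinct (dedup l)"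
proof -
  have "set (foldl (\<lambda>a y. if y \<in> set a then a else y # a) b l) = set b \<union> set l \<and>
    (distinct b \<longrightarrow> distinct (foldl (\<lambda>a y. if y \<in> set a then a else y # a) b l))" for b :: "nat list"
    by (induction l arbitrary: b) auto
  from this[of "[]"] show "set (dedup l) = set l" "distinct (dedup l)" by (auto simp: dedup_def)
qed

lemma vectors_snoc:
  "vectors (As @ [A]) = concat (map (\<lambda>q. map (\<lambda>s. s @ [q]) (vectors As)) (states A))"
  by (simp add: vectors_def)

lemma set_vectors:
  "set (vectors As) = {s. length s = length As \<and> (\<forall>i<length As. s ! i \<in> set (states (As ! i)))}"
proof (induction As rule: rev_induct)
  case Nil
  then show ?case by (auto simp: vectors_def)
next
  case (snoc A As)
  have "s \<in> set (vectors (As @ [A])) \<longleftrightarrow>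
    (\<exists>s' q. s = s' @ [q] \<and> s' \<in> set (vectors As) \<and> q \<in> set (states A))" for s
    by (auto simp: vectors_snoc)
  also have "\<dots> s \<longleftrightarrow> length s = length (As @ [A]) \<and> (\<forall>i<length (As @ [A]). s ! i \<in> set (states ((As @ [A]) ! i)))" for s
  proof (cases s rule: rev_cases)
    case (snoc s' q)
    then show ?thesis by (auto simp: snoc.IH less_Suc_eq nth_append)
  qed auto
  finally show ?case by blast
qed

lemma length_vectors: "length (vectors As) = prod_list (map (\<lambda>A. length (states A)) As)"
proof (induction As rule: rev_induct)
  case (snoc A As)
  have "length (concat (map (\<lambda>q. map (\<lambda>s. s @ [q]) V) l)) = length V * length l" for V :: "nat list list" and l
    by (induction l) auto
  with snoc show ?case by (simp add: vectors_snoc)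
qed (simp add: vectors_def)

lemma run_None [simp]: "run A None w = None"
  by (cases w) auto

lemma run_snoc: "run A q (w @ [a]) = (case run A q w of None \<Rightarrow> None | Some q' \<Rightarrow> delta A q' a)"
proof (induction w arbitrary: q)
  case Nil
  then show ?case by (cases q; cases "delta A (the q) a") auto
next
  case (Cons b w)
  then show ?case by (cases q) auto
qed

text \<open>By well-formedness the pairs of state and symbol are distinct, so \<open>find\<close>
  returns the only matching triple.\<close>

lemma delta_iff:
  assumes "dfa_wf A" shows "delta A q a = Some q' \<longleftrightarrow> (q, a, q') \<in> set (trans A)"
proof -
  have "map_option (\<lambda>(_,_,q'). q') (find (\<lambda>(p,b,_). p = q \<and> b = a) l) = Some q' \<longleftrightarrow> (q, a, q') \<in> set l"
    if "distinct (map (\<lambda>(q,a,q'). (q,a)) l)" for l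
    using that
  proof (induction l)
    case (Cons t l)
    obtain p b r where "t = (p, b, r)" by (cases t) auto
    with Cons show ?case by force
  qed simp
  then show ?thesis using assms by (simp add: delta_def dfa_wf_def)
qed

definition col_ok :: "rgcc \<Rightarrow> (nat \<Rightarrow> nat \<Rightarrow> nat) \<Rightarrow> nat \<Rightarrow> bool" where
  "col_ok I X j \<longleftrightarrow> (\<forall>i<nrows I. X i j \<in> set (doms I ! i ! j)) \<and>
     (\<forall>(v, lo, hi) \<in> set (gccs I ! j).
        let c = card {i. i < nrows I \<and> X i j = v} in
        lo \<le> c \<and> (case hi of None \<Rightarrow> True | Some h \<Rightarrow> c \<le> h))"

lemma is_solution_cols:
  "is_solution I X \<longleftrightarrow> (\<forall>j<ncols I. col_ok I X j) \<and>
     (\<forall>i<nrows I. accepts (auts I ! i) (map (X i) [0..<ncols I]))"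
  unfolding is_solution_def col_ok_def by blast

lemma pen_iff:
  "pen (map item_of g) (map f [0..<r]) = 0 \<longleftrightarrow> (\<forall>(v, lo, hi) \<in> set g.
        let c = card {i. i < r \<and> f i = v} in
        lo \<le> c \<and> (case hi of None \<Rightarrow> True | Some h \<Rightarrow> c \<le> h))"
proof -
  have c: "cnt (map f [0..<r]) v = card {i. i < r \<and> f i = v}" for v
    unfolding cnt_def length_filter_conv_card by (rule arg_cong[of _ _ card]) auto
  show ?thesis
    unfolding pen_def c sum_list_eq_0_iff
    by (auto simp: item_of_def viol_def Let_def split: option.splits)
qed

lemma colok_allowed:
  assumes wf: "inst_wf I" and j: "j < ncols I" and s: "length s = nrows I" "length s' = nrows I"
  shows "colok (allowed (map aut_of (auts I)) (map (\<lambda>row. row ! j) (doms I)) s s') (map item_of (gccs I ! j)) \<longleftrightarrow>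
    (\<exists>X. col_ok I X j \<and> (\<forall>i<nrows I. delta (auts I ! i) (s ! i) (X i j) = Some (s' ! i)))"
proof -
  let ?L = "allowed (map aut_of (auts I)) (map (\<lambda>row. row ! j) (doms I)) s s'"
  have len: "length (auts I) = nrows I" "length (doms I) = nrows I"
    using wf by (auto simp: inst_wf_def nrows_def)
  have L: "length ?L = nrows I" using len s by (simp add: allowed_def)
  have Li: "v \<in> set (?L ! i) \<longleftrightarrow> v \<in> set (doms I ! i ! j) \<and> delta (auts I ! i) (s ! i) v = Some (s' ! i)"
    if "i < nrows I" for i v
  proof -
    have "dfa_wf (auts I ! i)" using wf that len by (auto simp: inst_wf_def)
    then show ?thesis
      using that len s by (auto simp: allowed_def aut_of_def delta_iff) force
  qed
  have "(\<exists>x. fits ?L x \<and> pen (map item_of (gccs I ! j)) x = 0) \<longleftrightarrow>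
    (\<exists>f. (\<forall>i<nrows I. f i \<in> set (?L ! i)) \<and> pen (map item_of (gccs I ! j)) (map f [0..<nrows I]) = 0)" (is "?l \<longleftrightarrow> ?r")
  proof
    assume ?l
    then obtain x where x: "fits ?L x" "pen (map item_of (gccs I ! j)) x = 0" by blast
    then have "map (\<lambda>i. x ! i) [0..<nrows I] = x"
      using L by (metis fits_def map_nth)
    with x L show ?r by (intro exI[of _ "\<lambda>i. x ! i"]) (auto simp: fits_def)
  next
    assume ?r
    then obtain f where "\<forall>i<nrows I. f i \<in> set (?L ! i)" "pen (map item_of (gccs I ! j)) (map f [0..<nrows I]) = 0"
      by blast
    with L show ?l by (intro exI[of _ "map f [0..<nrows I]"]) (auto simp: fits_def)
  qed
  also have "\<dots> \<longleftrightarrow> (\<exists>f. col_ok I (\<lambda>i _. f i) j \<and> (\<forall>i<nrows I. delta (auts I ! i) (s ! i) (f i) = Some (s' ! i)))"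
  proof -
    have "(\<forall>i<nrows I. f i \<in> set (?L ! i)) \<and> pen (map item_of (gccs I ! j)) (map f [0..<nrows I]) = 0 \<longleftrightarrow>
      col_ok I (\<lambda>i _. f i) j \<and> (\<forall>i<nrows I. delta (auts I ! i) (s ! i) (f i) = Some (s' ! i))" for f
    proof -
      have "(\<forall>i<nrows I. f i \<in> set (?L ! i)) \<longleftrightarrow> (\<forall>i<nrows I. f i \<in> set (doms I ! i ! j)) \<and>
        (\<forall>i<nrows I. delta (auts I ! i) (s ! i) (f i) = Some (s' ! i))"
        using Li by blast
      then show ?thesis unfolding pen_iff col_ok_def by blast
    qed
    then show ?thesis by blast
  qed
  also have "\<dots> \<longleftrightarrow> (\<exists>X. col_ok I X j \<and> (\<forall>i<nrows I. delta (auts I ! i) (s ! i) (X i j) = Some (s' ! i)))"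
  proof
    assume "\<exists>X. col_ok I X j \<and> (\<forall>i<nrows I. delta (auts I ! i) (s ! i) (X i j) = Some (s' ! i))"
    then obtain X where "col_ok I X j" "\<forall>i<nrows I. delta (auts I ! i) (s ! i) (X i j) = Some (s' ! i)" by blast
    moreover from this have "col_ok I (\<lambda>i _. X i j) j" by (simp add: col_ok_def)
    ultimately show "\<exists>f. col_ok I (\<lambda>i _. f i) j \<and> (\<forall>i<nrows I. delta (auts I ! i) (s ! i) (f i) = Some (s' ! i))" by auto
  qed blast
  finally show ?thesis by (simp add: colok_iff)
qed

text \<open>These are the reachable states of the product automaton that reads whole columns, where
  a column is a letter if it respects its domains and its cardinality constraint.\<close>

definition reached :: "rgcc \<Rightarrow> nat \<Rightarrow> nat list set" where
  "reached I j = {s. length s = nrows I \<and> (\<exists>X. (\<forall>j'<j. col_ok I X j') \<and>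
     (\<forall>i<nrows I. run (auts I ! i) (Some (start (auts I ! i))) (map (X i) [0..<j]) = Some (s ! i)))}"

lemma reached_Suc:
  "reached I (Suc j) = {s'. length s' = nrows I \<and> (\<exists>s\<in>reached I j. \<exists>X. col_ok I X j \<and>
     (\<forall>i<nrows I. delta (auts I ! i) (s ! i) (X i j) = Some (s' ! i)))}" (is "_ = ?R")
proof (intro equalityI subsetI)
  fix s' assume "s' \<in> reached I (Suc j)"
  then obtain X where X: "length s' = nrows I" "\<And>j'. j' < Suc j \<Longrightarrow> col_ok I X j'"
    "\<And>i. i < nrows I \<Longrightarrow> run (auts I ! i) (Some (start (auts I ! i))) (map (X i) [0..<Suc j]) = Some (s' ! i)"
    by (auto simp: reached_def simp del: upt_Suc)
  let ?q = "\<lambda>i. run (auts I ! i) (Some (start (auts I ! i))) (map (X i) [0..<j])"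
  have q: "?q i = Some (the (?q i)) \<and> delta (auts I ! i) (the (?q i)) (X i j) = Some (s' ! i)" if "i < nrows I" for i
    using X(3)[OF that] by (auto simp: run_snoc split: option.splits)
  define s where "s = map (\<lambda>i. the (?q i)) [0..<nrows I]"
  have s: "?q i = Some (s ! i)" if "i < nrows I" for i
    using q[OF that] that by (simp only: s_def nth_map length_upt minus_nat.diff_0 nth_upt add_0)
  have "s \<in> reached I j"
    unfolding reached_def using s X(2) by (intro CollectI conjI exI[of _ X]) (auto simp: s_def)
  moreover have "\<forall>i<nrows I. delta (auts I ! i) (s ! i) (X i j) = Some (s' ! i)"
    using q by (simp add: s_def)
  ultimately show "s' \<in> ?R" using X by auto
next
  fix s' assume "s' \<in> ?R"
  then obtain s X Y where s: "length s' = nrows I" "length s = nrows I" "\<And>j'. j' < j \<Longrightarrow> col_ok I Y j'"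
    "\<And>i. i < nrows I \<Longrightarrow> run (auts I ! i) (Some (start (auts I ! i))) (map (Y i) [0..<j]) = Some (s ! i)"
    "col_ok I X j" "\<And>i. i < nrows I \<Longrightarrow> delta (auts I ! i) (s ! i) (X i j) = Some (s' ! i)"
    by (auto simp: reached_def)
  \<comment> \<open>Since \<open>col_ok I X j\<close> reads only column \<open>j\<close> of the
    assignment, the earlier columns of \<open>Y\<close> and column \<open>j\<close> of
    \<open>X\<close> can be glued together.\<close>
  define Z where "Z i j' = (if j' = j then X i j' else Y i j')" for i j'
  have "col_ok I Z j'" if "j' < Suc j" for j'
    using s(3)[of j'] s(5) that by (cases "j' = j") (auto simp: col_ok_def Z_def)
  moreover have "run (auts I ! i) (Some (start (auts I ! i))) (map (Z i) [0..<Suc j]) = Some (s' ! i)"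
    if "i < nrows I" for i
  proof -
    have "map (Z i) [0..<Suc j] = map (Y i) [0..<j] @ [X i j]" by (simp add: Z_def)
    then show ?thesis using s(4,6)[OF that] by (simp only: run_snoc option.case)
  qed
  ultimately show "s' \<in> reached I (Suc j)"
    unfolding reached_def using s(1) by blast
qed

lemma target_state: "(q, a, q') \<in> set (trans A) \<Longrightarrow> q' \<in> set (states (aut_of A))"
  by (force simp: states_def dedup aut_of_def)

lemma sweep_correct:
  assumes wf: "inst_wf I" and k: "k \<le> ncols I"
  shows "set (fst (sweep (vectors (map aut_of (auts I))) (map aut_of (auts I)) (map (map item_of) (take k (gccs I))) (doms I)))
       = reached I k \<and>
    snd (sweep (vectors (map aut_of (auts I))) (map aut_of (auts I)) (map (map item_of) (take k (gccs I))) (doms I))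
       = map (drop k) (doms I)"
  using k
proof (induction k)
  case 0
  have "s \<in> reached I 0 \<longleftrightarrow> s = map start (auts I)" for s
    by (auto simp: reached_def nrows_def intro: nth_equalityI)
  then show ?case by (auto simp: sweep_def aut_of_def o_def)
next
  case (Suc k)
  let ?As = "map aut_of (auts I)"
  let ?p = "sweep (vectors ?As) ?As (map (map item_of) (take k (gccs I))) (doms I)"
  have k: "k < ncols I" using Suc.prems by simp
  then have t: "take (Suc k) (gccs I) = take k (gccs I) @ [gccs I ! k]"
    by (simp add: ncols_def take_Suc_conv_app_nth)
  have rows: "length row = ncols I" if "row \<in> set (doms I)" for row
    using wf that by (auto simp: inst_wf_def in_set_conv_nth)
  have IH: "set (fst ?p) = reached I k" "snd ?p = map (drop k) (doms I)" using Suc by auto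
  have hd: "map (hd_or []) (snd ?p) = map (\<lambda>row. row ! k) (doms I)"
  proof -
    have "hd_or [] (drop k row) = row ! k" if "row \<in> set (doms I)" for row
      using rows[OF that] k by (simp add: Cons_nth_drop_Suc[symmetric])
    then show ?thesis by (simp add: IH)
  qed
  have e: "sweep (vectors ?As) ?As (map (map item_of) (take (Suc k) (gccs I))) (doms I) =
    (advance (vectors ?As) ?As (map item_of (gccs I ! k)) (map (\<lambda>row. row ! k) (doms I)) (fst ?p), map tl (snd ?p))"
    unfolding t hd[symmetric] by (simp add: sweep_def)
  have "s' \<in> set (vectors ?As) \<and> (\<exists>s\<in>reached I k. colok (allowed ?As (map (\<lambda>row. row ! k) (doms I)) s s') (map item_of (gccs I ! k)))
     \<longleftrightarrow> s' \<in> reached I (Suc k)" for s'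
  proof -
    have len: "length s = nrows I" if "s \<in> reached I k" for s using that by (simp add: reached_def)
    \<comment> \<open>After at least one column every component is the target of a transition, so
      restricting the candidates to \<open>vectors\<close> loses nothing.\<close>
    have V: "s' \<in> set (vectors ?As)" if r: "s' \<in> reached I (Suc k)"
    proof -
      obtain s X where s: "length s' = nrows I"
        "\<And>i. i < nrows I \<Longrightarrow> delta (auts I ! i) (s ! i) (X i k) = Some (s' ! i)"
        using r unfolding reached_Suc by blast
      have "s' ! i \<in> set (states (aut_of (auts I ! i)))" if "i < nrows I" for i
        using s(2)[OF that] wf that by (auto simp: inst_wf_def nrows_def delta_iff intro: target_state)
      then show ?thesis using s(1) by (auto simp: set_vectors nrows_def)
    qed
    show ?thesis
    proof (cases "length s' = nrows I")
      case True
      have "(\<exists>s\<in>reached I k. colok (allowed ?As (map (\<lambda>row. row ! k) (doms I)) s s') (map item_of (gccs I ! k)))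
         \<longleftrightarrow> s' \<in> reached I (Suc k)"
        unfolding reached_Suc using colok_allowed[OF wf k len True] True by auto
      then show ?thesis using V by blast
    next
      case False
      then show ?thesis by (auto simp: set_vectors reached_def nrows_def)
    qed
  qed
  then show ?case
    unfolding e by (auto simp: advance_def IH drop_Suc drop_tl[symmetric] tl_drop)
qed

lemma solvable_correct:
  assumes wf: "inst_wf I"
  shows "solvable (vectors (map aut_of (auts I))) (map aut_of (auts I)) (map (map item_of) (gccs I)) (doms I)
    \<longleftrightarrow> (\<exists>X. is_solution I X)"
proof -
  let ?As = "map aut_of (auts I)"
  have r: "set (fst (sweep (vectors ?As) ?As (map (map item_of) (gccs I)) (doms I))) = reached I (ncols I)"
    using sweep_correct[OF wf order_refl] by (simp add: ncols_def)
  have "(\<forall>p\<in>set (zip s ?As). fst p \<in> set (fst (snd (snd (snd p))))) \<longleftrightarrow> (\<forall>i<nrows I. s ! i \<in> set (fins (auts I ! i)))"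
    if "s \<in> reached I (ncols I)" for s
    using that by (simp add: all_set_conv_all_nth reached_def aut_of_def nrows_def)
  then have "solvable (vectors ?As) ?As (map (map item_of) (gccs I)) (doms I) \<longleftrightarrow>
    (\<exists>s\<in>reached I (ncols I). \<forall>i<nrows I. s ! i \<in> set (fins (auts I ! i)))"
    unfolding solvable_def r by blast
  also have "\<dots> \<longleftrightarrow> (\<exists>X. is_solution I X)"
  proof
    assume "\<exists>s\<in>reached I (ncols I). \<forall>i<nrows I. s ! i \<in> set (fins (auts I ! i))"
    then obtain s X where "\<forall>i<nrows I. s ! i \<in> set (fins (auts I ! i))" "\<forall>j<ncols I. col_ok I X j"
      "\<forall>i<nrows I. run (auts I ! i) (Some (start (auts I ! i))) (map (X i) [0..<ncols I]) = Some (s ! i)"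
      unfolding reached_def by blast
    then have "is_solution I X" by (simp add: is_solution_cols accepts_def)
    then show "\<exists>X. is_solution I X" by blast
  next
    assume "\<exists>X. is_solution I X"
    then obtain X where X: "\<And>j. j < ncols I \<Longrightarrow> col_ok I X j"
      "\<And>i. i < nrows I \<Longrightarrow> accepts (auts I ! i) (map (X i) [0..<ncols I])"
      by (auto simp: is_solution_cols)
    let ?q = "\<lambda>i. run (auts I ! i) (Some (start (auts I ! i))) (map (X i) [0..<ncols I])"
    have q: "?q i = Some (the (?q i)) \<and> the (?q i) \<in> set (fins (auts I ! i))" if "i < nrows I" for i
      using X(2)[OF that] by (auto simp: accepts_def split: option.splits)
    define s where "s = map (\<lambda>i. the (?q i)) [0..<nrows I]"
    have r: "?q i = Some (s ! i)" if "i < nrows I" for i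
      using q[OF that] that by (simp only: s_def nth_map length_upt minus_nat.diff_0 nth_upt add_0)
    have "s \<in> reached I (ncols I)"
      unfolding reached_def using r X(1) by (intro CollectI conjI exI[of _ X]) (auto simp: s_def)
    moreover have "\<forall>i<nrows I. s ! i \<in> set (fins (auts I ! i))" using q by (simp add: s_def)
    ultimately show "\<exists>s\<in>reached I (ncols I). \<forall>i<nrows I. s ! i \<in> set (fins (auts I ! i))" by blast
  qed
  finally show ?thesis .
qed

lemma prune_correct:
  assumes wf: "inst_wf I"
  shows "prune (vectors (map aut_of (auts I))) (map aut_of (auts I)) (map (map item_of) (gccs I)) (doms I) = dc_domains I"
proof -
  let ?S = "solvable (vectors (map aut_of (auts I))) (map aut_of (auts I)) (map (map item_of) (gccs I))"
  have len: "length (doms I) = nrows I" "\<And>i. i < nrows I \<Longrightarrow> length (doms I ! i) = ncols I"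
    using wf by (auto simp: inst_wf_def)
  have forced: "?S ((doms I)[i := (doms I ! i)[j := [v]]]) \<longleftrightarrow> (\<exists>X. is_solution I X \<and> X i j = v)"
    if ij: "i < nrows I" "j < ncols I" and v: "v \<in> set (doms I ! i ! j)" for i j v
  proof -
    define J where "J = I\<lparr>doms := (doms I)[i := (doms I ! i)[j := [v]]]\<rparr>"
    have J: "nrows J = nrows I" "ncols J = ncols I" "auts J = auts I" "gccs J = gccs I"
      by (simp_all add: J_def nrows_def ncols_def)
    have d: "doms J ! i' ! j' = (if i' = i \<and> j' = j then [v] else doms I ! i' ! j')"
      if "i' < nrows I" "j' < ncols I" for i' j'
      using that len ij by (auto simp: J_def nth_list_update)
    have "inst_wf J" using wf len ij by (auto simp: J_def inst_wf_def nrows_def ncols_def nth_list_update)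
    from solvable_correct[OF this] have "?S (doms J) \<longleftrightarrow> (\<exists>X. is_solution J X)"
      by (simp add: J)
    also have "\<dots> \<longleftrightarrow> (\<exists>X. is_solution I X \<and> X i j = v)"
    proof -
      \<comment> \<open>The value \<open>v\<close> comes from the original domain, so shrinking that
        domain to \<open>v\<close> is the same as demanding \<open>X i j = v\<close>.\<close>
      have "(\<forall>i'<nrows I. \<forall>j'<ncols I. X i' j' \<in> set (doms J ! i' ! j')) \<longleftrightarrow>
        (\<forall>i'<nrows I. \<forall>j'<ncols I. X i' j' \<in> set (doms I ! i' ! j')) \<and> X i j = v" (is "?l \<longleftrightarrow> ?r") for X
      proof
        assume l: ?l
        have "X i j = v" using l[rule_format, OF ij] d[OF ij] by simp
        moreover have "X i' j' \<in> set (doms I ! i' ! j')" if "i' < nrows I" "j' < ncols I" for i' j'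
          using l[rule_format, OF that] d[OF that] v by (auto split: if_splits)
        ultimately show ?r by blast
      next
        assume ?r
        then show ?l using d by auto
      qed
      then show ?thesis unfolding is_solution_def J by blast
    qed
    finally show ?thesis by (simp add: J_def)
  qed
  show ?thesis
    unfolding prune_def dc_domains_def
  proof (rule nth_equalityI)
    fix i assume "i < length (map (\<lambda>p. map (\<lambda>q. filter (\<lambda>v. ?S ((doms I)[fst p := (snd p)[fst q := [v]]])) (snd q))
     (List.enumerate 0 (snd p))) (List.enumerate 0 (doms I)))"
    then have i: "i < nrows I" by (simp add: len)
    have "map (\<lambda>q. filter (\<lambda>v. ?S ((doms I)[i := (doms I ! i)[fst q := [v]]])) (snd q)) (List.enumerate 0 (doms I ! i))
      = map (\<lambda>j. filter (\<lambda>v. \<exists>X. is_solution I X \<and> X i j = v) (doms I ! i ! j)) [0..<ncols I]"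
      by (rule nth_equalityI) (auto simp: len i nth_enumerate_eq forced intro!: filter_cong)
    then show "map (\<lambda>p. map (\<lambda>q. filter (\<lambda>v. ?S ((doms I)[fst p := (snd p)[fst q := [v]]])) (snd q))
     (List.enumerate 0 (snd p))) (List.enumerate 0 (doms I)) ! i = map (\<lambda>i. map (\<lambda>j.
       filter (\<lambda>v. \<exists>X. is_solution I X \<and> X i j = v) (doms I ! i ! j)) [0..<ncols I]) [0..<nrows I] ! i"
      using i len(1) by (simp add: nth_enumerate_eq)
  qed (simp add: len)
qed

section \<open>The algorithm runs in polynomial time\<close>

lemma foldl_invariant:
  "I a \<Longrightarrow> (\<And>a y. I a \<Longrightarrow> y \<in> set l \<Longrightarrow> I (f a y)) \<Longrightarrow> I (foldl f a l)"
  by (induction l arbitrary: a) auto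

text \<open>For folds whose accumulator is confined by an invariant rather than by its growth per
  step.\<close>

lemma pt_foldl_invariant:
  assumes i: "pt i" and l: "pt l" and s: "pt (\<lambda>p. s (fst p) (fst (snd p)) (snd (snd p)))"
    and b: "pb sz b"
    and I: "\<And>x. I x (i x)" "\<And>x a y. I x a \<Longrightarrow> y \<in> set (l x) \<Longrightarrow> I x (s x a y)"
      "\<And>x a. I x a \<Longrightarrow> sz a \<le> b x"
  shows "pt (\<lambda>x. foldl (s x) (i x) (l x))"
proof (rule PT_foldl[OF i l s order_refl b])
  show "sz (foldl (s x) (i x) (take j (l x))) \<le> b x" for x j
    by (intro I(3) foldl_invariant[of "I x"] I(1,2)) (auto dest: in_set_takeD)
qed

lemma sz_nat_list [simp]: "sz (l :: nat list) = 2 * length l + 1"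
  by (induction l) auto

section \<open>Polynomial time of the column test\<close>

lemma pt_cnt [pt_intro]: "pt f \<Longrightarrow> pt g \<Longrightarrow> pt (\<lambda>x. cnt (f x) (g x))"
  by (rule pt_comp2[where h = cnt], unfold cnt_def) (intro pt_intro | assumption)+

lemma pt_viol [pt_intro]: "pt f \<Longrightarrow> pt g \<Longrightarrow> pt (\<lambda>x. viol (f x) (g x))"
  by (rule pt_comp2[where h = viol], unfold viol_def) (intro pt_intro | assumption)+

lemma pt_pen [pt_intro]: "pt f \<Longrightarrow> pt g \<Longrightarrow> pt (\<lambda>x. pen (f x) (g x))"
  by (rule pt_comp2[where h = pen], unfold pen_def) (intro pt_intro | assumption)+

lemma pt_edges [pt_intro]: "pt f \<Longrightarrow> pt g \<Longrightarrow> pt (\<lambda>x. edges (f x) (g x))"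
  by (rule pt_comp2[where h = edges], unfold edges_def) (intro pt_intro | assumption)+

lemma pt_ext [pt_intro]: "pt f \<Longrightarrow> pt g \<Longrightarrow> pt (\<lambda>x. ext (f x) (g x))"
  by (rule pt_comp2[where h = ext], unfold ext_def) (intro pt_intro | assumption)+

lemma ext_lengths:
  "\<forall>p\<in>set T. length (snd p) = n \<Longrightarrow> \<forall>p\<in>set (ext T e). length (snd p) = n"
proof -
  assume T: "\<forall>p\<in>set T. length (snd p) = n"
  show ?thesis
  proof (cases "filter (\<lambda>p. fst p = fst (snd e)) T")
    case (Cons p ps)
    then have "p \<in> set (filter (\<lambda>p. fst p = fst (snd e)) T)" by simp
    then have "length (snd p) = n" using T by auto
    then show ?thesis using T Cons by (auto simp: ext_def)
  qed (use T in \<open>auto simp: ext_def\<close>)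
qed

lemma foldl_ext_lengths:
  assumes "\<forall>p\<in>set T. length (snd p) = n"
  shows "\<forall>p\<in>set (foldl ext T E). length (snd p) = n"
  by (rule foldl_invariant[of "\<lambda>T. \<forall>p\<in>set T. length (snd p) = n", OF assms]) (rule ext_lengths)

lemma sz_bounded: "(\<And>y. y \<in> set l \<Longrightarrow> sz y \<le> M) \<Longrightarrow> sz l \<le> length l * (M + 1) + 1"
proof (induction l)
  case (Cons a l)
  then have "sz l \<le> length l * (M + 1) + 1" "sz a \<le> M" by auto
  then show ?case by simp
qed simp

lemma foldl_foldl: "foldl (\<lambda>a y. foldl f a (g y)) a l = foldl f a (concat (map g l))"
  by (induction l arbitrary: a) auto

text \<open>With the passes flattened into one fold, each processed edge adds at most one entry.
  This bounds the table at every moment of the nested iteration.\<close>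

lemma reach_foldl: "reach E x u = foldl ext [(u, x)] (concat (map (\<lambda>_. E) ((0, 0, 0) # E)))"
  unfolding reach_def by (rule foldl_foldl)

lemma pt_reach [pt_intro]: "pt f \<Longrightarrow> pt g \<Longrightarrow> pt h \<Longrightarrow> pt (\<lambda>z. reach (f z) (g z) (h z))"
proof (rule pt_comp3[where h = reach])
  let ?i = "\<lambda>z :: edge list \<times> nat list \<times> nat. [(snd (snd z), fst (snd z))]"
  let ?l = "\<lambda>z :: edge list \<times> nat list \<times> nat. concat (map (\<lambda>_. fst z) ((0, 0, 0) # fst z))"
  have l: "pt ?l" by (intro pt_intro)
  have "pt (\<lambda>z. foldl ext (?i z) (?l z))"
  proof (rule PT_foldl)
    show "pt ?i" by (intro pt_intro)
    show "pt ?l" by (rule l)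
    show "pt (\<lambda>p :: (edge list \<times> nat list \<times> nat) \<times> table \<times> edge. ext (fst (snd p)) (snd (snd p)))"
      by (intro pt_intro)
    show "pb sz (\<lambda>z. (1 + sz (?l z)) * ((sz (fst (snd z)) + 2) + 1) + 1)"
      by (intro pb_add pb_mult pb_const PT_size[OF l] PT_size pt_intro)
    fix z :: "edge list \<times> nat list \<times> nat" and j
    define T where "T = foldl ext (?i z) (take j (?l z))"
    have "\<forall>p\<in>set T. length (snd p) = length (fst (snd z))"
      unfolding T_def by (rule foldl_ext_lengths) simp
    then have "sz p \<le> sz (fst (snd z)) + 2" if "p \<in> set T" for p
      using that by (cases p) auto
    then have "sz T \<le> length T * ((sz (fst (snd z)) + 2) + 1) + 1" by (rule sz_bounded)
    also have "length T \<le> 1 + sz (?l z)"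
      using length_foldl_ext(2)[of "?i z" "take j (?l z)"] length_le_sz[of "?l z"]
      unfolding T_def by simp
    then have "length T * ((sz (fst (snd z)) + 2) + 1) + 1 \<le> (1 + sz (?l z)) * ((sz (fst (snd z)) + 2) + 1) + 1"
      by (intro add_right_mono mult_le_mono1)
    finally show "sz (foldl ext (?i z) (take j (?l z))) \<le> (1 + sz (?l z)) * ((sz (fst (snd z)) + 2) + 1) + 1"
      unfolding T_def .
  qed simp
  then show "pt (\<lambda>z. reach (fst z) (fst (snd z)) (snd (snd z)))"
    by (simp add: reach_foldl)
qed

lemma pt_neigh [pt_intro]: "pt f \<Longrightarrow> pt g \<Longrightarrow> pt (\<lambda>x. neigh (f x) (g x))"
  by (rule pt_comp2[where h = neigh], unfold neigh_def, intro pt_intro, assumption+)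

lemma pt_improve [pt_intro]: "pt f \<Longrightarrow> pt g \<Longrightarrow> pt h \<Longrightarrow> pt (\<lambda>x. improve (f x) (g x) (h x))"
  by (rule pt_comp3[where h = improve], unfold improve_def) (intro pt_intro | assumption)+

lemma length_improve: "length (improve L g x) = length x"
proof -
  have "\<forall>p\<in>set (reach E x u). length (snd p) = length x" for E u
    unfolding reach_foldl by (rule foldl_ext_lengths) simp
  then have "length y = length x" if "y \<in> set (neigh L x)" for y
    using that by (auto simp: neigh_def)
  then show ?thesis
    using hd_or_filter[of x "\<lambda>y. pen g y < pen g x" "neigh L x"] unfolding improve_def by auto
qed

lemma pt_match [pt_intro]: "pt f \<Longrightarrow> pt g \<Longrightarrow> pt (\<lambda>x. match (f x) (g x))"
proof (rule pt_comp2[where h = match], unfold match_def)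
  show "pt (\<lambda>p. foldl (\<lambda>x _. improve (fst p) (snd p) x) (map (hd_or 0) (fst p))
      (concat (map (\<lambda>_. fst p @ fst p) (snd p))))"
  proof (rule pt_foldl_invariant[where I = "\<lambda>p x. length x = length (fst p)" and b = "\<lambda>p. 2 * sz (fst p) + 1"])
    show "sz x \<le> 2 * sz (fst p) + 1" if "length x = length (fst p)" for x :: "nat list" and p :: "nat list list \<times> item list"
      using that length_le_sz[of "fst p"] by simp
  qed ((intro pt_intro pb_intros PT_size)+, simp_all add: length_improve)
qed

lemma pt_colok [pt_intro]: "pt f \<Longrightarrow> pt g \<Longrightarrow> pt (\<lambda>x. colok (f x) (g x))"
  by (rule pt_comp2[where h = colok], unfold colok_def) (intro pt_intro | assumption)+

lemma pt_dedup [pt_intro]: "pt f \<Longrightarrow> pt (\<lambda>x. dedup (f x))"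
proof (rule pt_comp[where g = dedup])
  have "pt (\<lambda>l :: nat list. foldl (\<lambda>a y. if y \<in> set a then a else y # a) [] l)"
  proof (rule pt_foldl[where h = "\<lambda>_. 2"])
    show "pt (\<lambda>p :: nat list \<times> nat list \<times> nat. if snd (snd p) \<in> set (fst (snd p)) then fst (snd p) else snd (snd p) # fst (snd p))"
      by (intro pt_intro)
  qed ((intro pt_intro pb_const)+, simp)
  then show "pt dedup" by (simp add: dedup_def[abs_def])
qed

lemma pt_states [pt_intro]: "pt f \<Longrightarrow> pt (\<lambda>x. states (f x))"
  by (rule pt_comp[where g = states], assumption, unfold states_def) (intro pt_intro)

lemma pt_allowed [pt_intro]:
  "pt f \<Longrightarrow> pt g \<Longrightarrow> pt h \<Longrightarrow> pt k \<Longrightarrow> pt (\<lambda>x. allowed (f x) (g x) (h x) (k x))"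
  by (rule pt_comp4[where h = allowed], unfold allowed_def) (intro pt_intro | assumption)+

lemma sz_filter: "sz (filter b l) \<le> sz l"
  by (induction l) auto

lemma sz_map_tl: "sz (map tl l) \<le> sz l"
proof (induction l)
  case (Cons a l)
  then show ?case by (cases a) auto
qed simp

lemma pt_sweep [pt_intro]:
  "pt f \<Longrightarrow> pt g \<Longrightarrow> pt h \<Longrightarrow> pt k \<Longrightarrow> pt (\<lambda>x. sweep (f x) (g x) (h x) (k x))"
proof (rule pt_comp4[where h = sweep], unfold sweep_def advance_def)
  let ?i = "\<lambda>z :: nat list list \<times> aut list \<times> item list list \<times> nat list list list.
    [map (\<lambda>A. fst (snd A)) (fst (snd z))]"
  have i: "pt ?i" by (intro pt_intro)
  show "pt (\<lambda>z. foldl (\<lambda>p g. (filter (\<lambda>s'. \<exists>s\<in>set (fst p). colok (allowed (fst (snd z)) (map (hd_or []) (snd p)) s s') g) (fst z),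
      map tl (snd p))) (?i z, snd (snd (snd z))) (fst (snd (snd z))))"
  \<comment> \<open>The current set is the initial singleton or a sublist of the vectors
    \<open>fst z\<close>, and the remaining columns only shrink, so no step depends on the size
    reached before.\<close>
  proof (rule pt_foldl_invariant[where b = "\<lambda>z. sz (?i z) + sz (fst z) + sz (snd (snd (snd z))) + 1"
        and I = "\<lambda>z p. sz (fst p) \<le> sz (?i z) + sz (fst z) \<and> sz (snd p) \<le> sz (snd (snd (snd z)))"])
    show "pb sz (\<lambda>z. sz (?i z) + sz (fst z) + sz (snd (snd (snd z))) + 1)"
      by (intro pb_add pb_const PT_size i) (intro pt_intro)+
    show "pt (\<lambda>z. (?i z, snd (snd (snd z))))" by (intro pt_intro i)
    fix z :: "nat list list \<times> aut list \<times> item list list \<times> nat list list list"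
      and p :: "nat list list \<times> nat list list list" and g
    assume I: "sz (fst p) \<le> sz (?i z) + sz (fst z) \<and> sz (snd p) \<le> sz (snd (snd (snd z)))"
    show "sz p \<le> sz (?i z) + sz (fst z) + sz (snd (snd (snd z))) + 1"
      using I by (cases p) simp
    show "sz (fst (filter (\<lambda>s'. \<exists>s\<in>set (fst p). colok (allowed (fst (snd z)) (map (hd_or []) (snd p)) s s') g) (fst z),
        map tl (snd p))) \<le> sz (?i z) + sz (fst z) \<and>
      sz (snd (filter (\<lambda>s'. \<exists>s\<in>set (fst p). colok (allowed (fst (snd z)) (map (hd_or []) (snd p)) s s') g) (fst z),
        map tl (snd p))) \<le> sz (snd (snd (snd z)))"
      unfolding fst_conv snd_conv
      using order_trans[OF sz_map_tl[of "snd p"] I[THEN conjunct2]] sz_filter[of _ "fst z"]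
      by (blast intro: trans_le_add2)
  qed ((intro pt_intro)+, simp)
qed

lemma pt_solvable [pt_intro]:
  "pt f \<Longrightarrow> pt g \<Longrightarrow> pt h \<Longrightarrow> pt k \<Longrightarrow> pt (\<lambda>x. solvable (f x) (g x) (h x) (k x))"
  by (rule pt_comp4[where h = solvable], unfold solvable_def) (intro pt_intro | assumption)+

lemma pt_prune [pt_intro]:
  "pt f \<Longrightarrow> pt g \<Longrightarrow> pt h \<Longrightarrow> pt k \<Longrightarrow> pt (\<lambda>x. prune (f x) (g x) (h x) (k x))"
  by (rule pt_comp4[where h = prune], unfold prune_def) (intro pt_intro | assumption)+

text \<open>Every automaton contributes at least its start state, so every factor of the product is
  at least one. The lemma bounds the intermediate results of the fold in \<open>vectors\<close>,
  which are the vectors of prefixes.\<close>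

lemma vectors_take: "length (vectors (take j As)) \<le> length (vectors As)"
proof -
  have pos: "0 < length (states A)" for A
    using dedup(1)[of "fst (snd A) # map (\<lambda>t. snd (snd t)) (snd (snd (snd A)))"]
    by (auto simp: states_def simp flip: length_greater_0_conv)
  have "1 \<le> prod_list (map (\<lambda>A. length (states A)) As)" for As
    using pos by (induction As) (auto simp: Suc_le_eq)
  then have "prod_list (map (\<lambda>A. length (states A)) (take j As)) * 1 \<le>
    prod_list (map (\<lambda>A. length (states A)) (take j As)) * prod_list (map (\<lambda>A. length (states A)) (drop j As))"
    by (rule mult_le_mono2)
  also have "\<dots> = prod_list (map (\<lambda>A. length (states A)) (take j As @ drop j As))"
    by (simp only: map_append prod_list.append)
  finally show ?thesis unfolding length_vectors by simp
qed

text \<open>This is the one exponential ingredient; it becomes polynomial because the measure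
  \<open>mu\<close> includes the number of vectors produced.\<close>

lemma PT_vectors:
  assumes "PT mu l" "\<And>x. sz x \<le> mu x" "\<And>x. length (vectors (l x)) \<le> mu x"
  shows "PT mu (\<lambda>x. vectors (l x))"
  unfolding vectors_def
proof (rule PT_foldl)
  show "PT mu (\<lambda>_. [[]] :: nat list list)"
    by (rule PT_weaken[of sz]) (intro pt_intro assms)+
  show "pt (\<lambda>p :: 'a \<times> nat list list \<times> aut.
      concat (map (\<lambda>q. map (\<lambda>s. s @ [q]) (fst (snd p))) (states (snd (snd p)))))"
    by (intro pt_intro)
  show "pb mu (\<lambda>x. mu x * ((2 * sz (l x) + 1) + 1) + 1)"
    by (intro pb_intros PT_size assms)
  fix x j
  let ?V = "vectors (take j (l x))"
  have "sz s \<le> 2 * sz (l x) + 1" if "s \<in> set ?V" for s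
    using that length_le_sz[of "l x"] by (auto simp: set_vectors)
  then have "sz ?V \<le> length ?V * ((2 * sz (l x) + 1) + 1) + 1" by (rule sz_bounded)
  also have "\<dots> \<le> mu x * ((2 * sz (l x) + 1) + 1) + 1"
    by (intro add_right_mono mult_le_mono1 order_trans[OF vectors_take assms(3)])
  finally show "sz (foldl (\<lambda>V A. concat (map (\<lambda>q. map (\<lambda>s. s @ [q]) V) (states A))) [[]] (take j (l x)))
      \<le> mu x * ((2 * sz (l x) + 1) + 1) + 1"
    by (simp add: vectors_def)
qed (use assms in auto)

section \<open>Parsing\<close>

type_synonym 'a parser = "nat list \<Rightarrow> 'a \<times> nat list"

definition p_nat :: "nat parser" where
  "p_nat xs = (hd_or 0 xs, tl xs)"

definition p_pair :: "'a parser \<Rightarrow> 'b parser \<Rightarrow> ('a \<times> 'b) parser" where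
  "p_pair p q xs = ((fst (p xs), fst (q (snd (p xs)))), snd (q (snd (p xs))))"

text \<open>On malformed input the announced length may exceed what is left, so exhaustion of the
  input ends the loop as well. Items are collected in reverse order.\<close>

definition p_step :: "'a parser \<Rightarrow> nat \<times> 'a list \<times> nat list \<Rightarrow> nat \<times> 'a list \<times> nat list" where
  "p_step p s = (if fst s = 0 \<or> length (snd (snd s)) = 0 then s
     else (fst s - 1, fst (p (snd (snd s))) # fst (snd s), snd (p (snd (snd s)))))"

text \<open>The remaining input itself serves as the clock of the loop.\<close>

definition p_items :: "'a parser \<Rightarrow> nat list \<Rightarrow> nat \<times> 'a list \<times> nat list" where
  "p_items p xs = foldl (\<lambda>s _. p_step p s) (hd_or 0 xs, [], tl xs) (tl xs)"

definition p_list :: "'a parser \<Rightarrow> 'a list parser" where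
  "p_list p xs = (rev (fst (snd (p_items p xs))), snd (snd (p_items p xs)))"

text \<open>Bounding the size of a result by the number of consumed numbers keeps repeated
  parsing polynomial even on malformed input.\<close>

definition frugal :: "('a :: repr) parser \<Rightarrow> bool" where
  "frugal p \<longleftrightarrow> pt p \<and> snd (p []) = [] \<and> (\<exists>K. \<forall>xs. xs \<noteq> [] \<longrightarrow> length (snd (p xs)) < length xs \<and>
     sz (fst (p xs)) \<le> K * (length xs - length (snd (p xs))))"

lemma frugal_nat: "frugal p_nat"
  unfolding frugal_def
proof (intro conjI exI[of _ 1])
  show "pt p_nat" unfolding p_nat_def[abs_def] by (intro pt_intro)
qed (auto simp: p_nat_def neq_Nil_conv)

lemma frugal_pair:
  assumes p: "frugal p" and q: "frugal q" shows "frugal (p_pair p q)"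
proof -
  have ptp: "pt p" and ptq: "pt q" using p q by (auto simp: frugal_def)
  obtain Kp where Kp: "\<And>xs. xs \<noteq> [] \<Longrightarrow> length (snd (p xs)) < length xs"
    "\<And>xs. xs \<noteq> [] \<Longrightarrow> sz (fst (p xs)) \<le> Kp * (length xs - length (snd (p xs)))"
    using p unfolding frugal_def by blast
  obtain Kq where Kq: "\<And>xs. xs \<noteq> [] \<Longrightarrow> length (snd (q xs)) < length xs"
    "\<And>xs. xs \<noteq> [] \<Longrightarrow> sz (fst (q xs)) \<le> Kq * (length xs - length (snd (q xs)))"
    using q unfolding frugal_def by blast
  have nil: "snd (p []) = []" "snd (q []) = []" using p q by (auto simp: frugal_def)
  \<comment> \<open>The second parser may start on the empty list, where it consumes nothing but
    still returns a value. The first parser consumes at least one number, which pays for this value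
    and for the pair cell.\<close>
  define c where "c = sz (fst (q []))"
  have "pt (p_pair p q)"
    unfolding p_pair_def[abs_def] by (intro pt_intro pt_comp[OF _ ptp] pt_comp[OF _ ptq])
  moreover have "length (snd (p_pair p q xs)) < length xs \<and>
     sz (fst (p_pair p q xs)) \<le> (Kp + Kq + c + 1) * (length xs - length (snd (p_pair p q xs)))"
    if xs: "xs \<noteq> []" for xs
  proof -
    define ys where "ys = snd (p xs)"
    define zs where "zs = snd (q ys)"
    have 1: "length ys < length xs" "sz (fst (p xs)) \<le> Kp * (length xs - length ys)"
      using Kp xs by (auto simp: ys_def)
    have 2: "length zs \<le> length ys" "sz (fst (q ys)) \<le> Kq * (length ys - length zs) + c"
    proof -
      show "length zs \<le> length ys" using Kq(1)[of ys] nil by (cases "ys = []") (auto simp: zs_def)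
      show "sz (fst (q ys)) \<le> Kq * (length ys - length zs) + c"
        using Kq(2)[of ys] by (cases "ys = []") (auto simp: zs_def c_def)
    qed
    define d where "d = length xs - length zs"
    have "0 < d" using 1(1) 2(1) by (simp add: d_def)
    then have "c + 1 \<le> (c + 1) * d" by (cases d) auto
    moreover have "Kp * (length xs - length ys) \<le> Kp * d" "Kq * (length ys - length zs) \<le> Kq * d"
      using 1(1) 2(1) unfolding d_def by (intro mult_le_mono2; linarith)+
    moreover have "(Kp + Kq + c + 1) * d = Kp * d + Kq * d + (c + 1) * d"
      by (simp add: add_mult_distrib)
    ultimately have "sz (fst (p xs)) + sz (fst (q ys)) + 1 \<le> (Kp + Kq + c + 1) * d"
      using 1(2) 2(2) by linarith
    then show ?thesis using 1(1) 2(1) by (simp add: p_pair_def ys_def zs_def d_def)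
  qed
  moreover have "snd (p_pair p q []) = []" using nil by (simp add: p_pair_def)
  ultimately show ?thesis unfolding frugal_def by blast
qed

lemma sz_rev: "sz (rev l) = sz l"
proof (induction l)
  case (Cons a l)
  then show ?case using sz_append[of "rev l" "[a]"] by simp
qed simp

lemma frugal_list:
  assumes p: "frugal p" shows "frugal (p_list p)"
proof -
  have ptp: "pt p" using p by (simp add: frugal_def)
  obtain K where K: "\<And>xs. xs \<noteq> [] \<Longrightarrow> length (snd (p xs)) < length xs"
    "\<And>xs. xs \<noteq> [] \<Longrightarrow> sz (fst (p xs)) \<le> K * (length xs - length (snd (p xs)))"
    using p unfolding frugal_def by blast
  \<comment> \<open>The coefficient \<open>K + 1\<close> pays for the cons cell of each item, since
    an item consumes at least one number. The final \<open>+ 1\<close> is the empty list, paid for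
    by the length field.\<close>
  define I where "I ys s \<longleftrightarrow> length (snd (snd s)) \<le> length ys \<and>
    sz (fst (snd s)) \<le> (K + 1) * (length ys - length (snd (snd s))) + 1"
    for ys :: "nat list" and s :: "nat \<times> 'a list \<times> nat list"
  have step: "I ys (p_step p s)" if "I ys s" for ys s
  proof (cases "fst s = 0 \<or> length (snd (snd s)) = 0")
    case True
    with that show ?thesis by (simp add: p_step_def)
  next
    case False
    define u v where "u = snd (snd s)" and "v = snd (p u)"
    have u: "length v < length u" "sz (fst (p u)) \<le> K * (length u - length v)"
      using K[of u] False by (auto simp: u_def v_def)
    have s: "length u \<le> length ys" "sz (fst (snd s)) \<le> (K + 1) * (length ys - length u) + 1"
      using that by (auto simp: I_def u_def)
    have "K * (length u - length v) + 1 \<le> (K + 1) * (length u - length v)" using u(1) by simp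
    then have "sz (fst (p u)) + sz (fst (snd s)) + 1 \<le>
      (K + 1) * (length u - length v) + (K + 1) * (length ys - length u) + 1"
      using u(2) s(2) by linarith
    also have "\<dots> = (K + 1) * (length ys - length v) + 1"
    proof -
      have "length u - length v + (length ys - length u) = length ys - length v"
        using u(1) s(1) by simp
      then show ?thesis by (metis add_mult_distrib2)
    qed
    finally show ?thesis
      using u(1) s(1) False by (simp add: I_def p_step_def u_def v_def)
  qed
  have I: "I (tl xs) (p_items p xs)" for xs
    unfolding p_items_def by (rule foldl_invariant[of "I (tl xs)"]) (simp_all add: I_def[of _ "(_, _)"] step)
  have "pt (\<lambda>xs. foldl (\<lambda>s _. p_step p s) (hd_or 0 xs, [], tl xs) (tl xs))"
  proof (rule pt_foldl_invariant[where I = "\<lambda>xs. I (tl xs)" and b = "\<lambda>xs. (K + 1) * sz xs + 2 * sz xs + 6"])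
    show "pt (\<lambda>z :: nat list \<times> (nat \<times> 'a list \<times> nat list) \<times> nat. p_step p (fst (snd z)))"
      unfolding p_step_def by (intro pt_intro pt_comp[OF _ ptp])
    show "sz s \<le> (K + 1) * sz xs + 2 * sz xs + 6" if "I (tl xs) s" for xs and s :: "nat \<times> 'a list \<times> nat list"
    proof -
      have "length (tl xs) \<le> sz xs" by simp
      then have "(K + 1) * (length (tl xs) - length (snd (snd s))) \<le> (K + 1) * sz xs"
        by (intro mult_le_mono2) linarith
      moreover have "length (snd (snd s)) \<le> sz xs" using that \<open>length (tl xs) \<le> sz xs\<close> by (simp add: I_def)
      ultimately show ?thesis using that by (cases s) (simp add: I_def del: sz_nat_list, simp)
    qed
    show "pb sz (\<lambda>xs :: nat list. (K + 1) * sz xs + 2 * sz xs + 6)" by (intro pb_intros)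
  qed ((intro pt_intro)+, simp add: I_def, rule step)
  then have "pt (p_items p)" by (simp add: p_items_def[abs_def])
  then have "pt (p_list p)"
    unfolding p_list_def[abs_def] by (intro pt_intro)
  moreover have "length (snd (p_list p xs)) < length xs \<and>
     sz (fst (p_list p xs)) \<le> (K + 1) * (length xs - length (snd (p_list p xs)))" if "xs \<noteq> []" for xs
  proof -
    define d e where "d = length (tl xs)" and "e = length (snd (p_list p xs))"
    have "length xs = Suc d" using that by (cases xs) (auto simp: d_def)
    moreover have "e \<le> d" "sz (fst (p_list p xs)) \<le> (K + 1) * (d - e) + 1"
      using I[of xs] by (auto simp: I_def p_list_def sz_rev d_def e_def)
    ultimately show ?thesis unfolding e_def[symmetric] by (simp add: Suc_diff_le)
  qed
  moreover have "snd (p_list p []) = []" by (simp add: p_list_def p_items_def)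
  ultimately show ?thesis unfolding frugal_def by blast
qed

text \<open>Nonempty codes ensure that the remaining input is at least as long as the list still to
  be read, so the clock of \<open>p_items\<close> does not run out. The arbitrary rest
  \<open>r\<close> admits the zeros that follow the input in memory.\<close>

definition parses :: "'b parser \<Rightarrow> ('a \<Rightarrow> nat list) \<Rightarrow> ('a \<Rightarrow> 'b) \<Rightarrow> bool" where
  "parses p e f \<longleftrightarrow> (\<forall>a r. p (e a @ r) = (f a, r) \<and> e a \<noteq> [])"

lemma parses_cong:
  "parses p e f \<Longrightarrow> (\<And>x. e x = e' x) \<Longrightarrow> (\<And>x. f x = f' x) \<Longrightarrow> parses p e' f'"
  by (simp add: parses_def)

lemma parses_nat: "parses p_nat (\<lambda>x. [x]) (\<lambda>x. x)"
  by (simp add: parses_def p_nat_def)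

lemma parses_pair:
  "parses p e f \<Longrightarrow> parses q e' f' \<Longrightarrow> parses (p_pair p q) (\<lambda>z. e (g z) @ e' (h z)) (\<lambda>z. (f (g z), f' (h z)))"
  by (simp add: parses_def p_pair_def)

lemma parses_list:
  assumes "parses p e f" shows "parses (p_list p) (enc_list e) (map f)"
proof -
  have stop: "foldl (\<lambda>s _. p_step p s) (0, b, r) k = (0, b, r)" for b r and k :: "nat list"
    by (induction k) (auto simp: p_step_def)
  have "foldl (\<lambda>s _. p_step p s) (length l, b, concat (map e l) @ r) k = (0, rev (map f l) @ b, r)"
    if "length l \<le> length k" for l b r and k :: "nat list"
    using that
  proof (induction l arbitrary: b k)
    case Nil
    then show ?case by (simp add: stop)
  next
    case (Cons a l)
    obtain y k' where k: "k = y # k'" "length l \<le> length k'" using Cons.prems by (cases k) auto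
    have "p (e a @ concat (map e l) @ r) = (f a, concat (map e l) @ r)" "e a \<noteq> []"
      using assms by (auto simp: parses_def)
    then have "p_step p (length (a # l), b, concat (map e (a # l)) @ r) = (length l, f a # b, concat (map e l) @ r)"
      by (simp add: p_step_def)
    then show ?case using Cons.IH[OF k(2), of "f a # b"] k(1) by simp
  qed
  moreover have "length l \<le> length (concat (map e l) @ r)" for l r
  proof (induction l)
    case (Cons a l)
    have "e a \<noteq> []" using assms by (simp add: parses_def)
    with Cons show ?case by (cases "e a") auto
  qed simp
  ultimately have "p_items p (enc_list e l @ r) = (0, rev (map f l), r)" for l r
    by (simp add: p_items_def enc_list_def del: foldl_append)
  then show ?thesis by (simp add: parses_def p_list_def enc_list_def)
qed

definition p_triple :: "edge parser" where
  "p_triple = p_pair p_nat (p_pair p_nat p_nat)"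

definition p_aut :: "aut parser" where
  "p_aut = p_pair p_nat (p_pair p_nat (p_pair (p_list p_nat) (p_list p_triple)))"

definition p_inst :: "(nat list list list \<times> aut list \<times> item list list) parser" where
  "p_inst = p_pair (p_list (p_list (p_list p_nat))) (p_pair (p_list p_aut) (p_list (p_list p_triple)))"

lemma pt_inst: "pt p_inst"
proof -
  have "frugal p_inst"
    unfolding p_inst_def p_aut_def p_triple_def
    by (intro frugal_pair frugal_list frugal_nat)
  then show ?thesis by (simp add: frugal_def)
qed

lemma enc_nats_list: "enc_nats l = enc_list (\<lambda>x. [x]) l"
  by (simp add: enc_nats_def enc_list_def)

lemma parses_triple: "parses p_triple (\<lambda>(a, b, c). [a, b, c]) (\<lambda>t. t)"
  unfolding p_triple_def
  by (rule parses_cong[OF parses_pair[OF parses_nat parses_pair[OF parses_nat parses_nat,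
        of "\<lambda>t. fst (snd t)" "\<lambda>t. snd (snd t)"], of fst "\<lambda>t. t"]]) auto

lemma parses_item: "parses p_triple enc_item item_of"
proof -
  have "parses p_triple (\<lambda>c. (\<lambda>(a, b, c). [a, b, c]) (item_of c)) (\<lambda>c. item_of c)"
    using parses_triple unfolding parses_def by blast
  then show ?thesis
    by (rule parses_cong) (simp_all add: enc_item_def item_of_def split: prod.split)
qed

lemma parses_aut: "parses p_aut enc_dfa aut_of"
  unfolding p_aut_def
  by (rule parses_cong[OF parses_pair[OF parses_nat parses_pair[OF parses_nat parses_pair[OF
        parses_list[OF parses_nat] parses_list[OF parses_triple], of fins trans], of start "\<lambda>A. A"], of nst "\<lambda>A. A"]])
    (auto simp: enc_dfa_def aut_of_def enc_nats_list)

lemma parses_inst: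
  "parses p_inst enc_inst (\<lambda>I. (doms I, map aut_of (auts I), map (map item_of) (gccs I)))"
  unfolding p_inst_def
  by (rule parses_cong[OF parses_pair[OF parses_list[OF parses_list[OF parses_list[OF parses_nat]]]
        parses_pair[OF parses_list[OF parses_aut] parses_list[OF parses_list[OF parses_item]], of auts gccs],
        of doms "\<lambda>I. I"]])
    (auto simp: enc_inst_def enc_doms_def enc_nats_list[abs_def])

section \<open>The parameter bound\<close>

lemma states_bound: "dfa_wf A \<Longrightarrow> length (states (aut_of A)) \<le> nst A"
proof -
  assume "dfa_wf A"
  then have "set (states (aut_of A)) \<subseteq> {..<nst A}"
    by (force simp: states_def dedup aut_of_def dfa_wf_def)
  then have "card (set (states (aut_of A))) \<le> nst A"
    using card_mono[of "{..<nst A}"] by simp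
  moreover have "distinct (states (aut_of A))" by (simp only: states_def dedup)
  ultimately show ?thesis by (simp add: distinct_card)
qed

lemma vectors_bound:
  assumes "inst_wf I" shows "length (vectors (map aut_of (auts I))) \<le> 2 ^ param I"
proof -
  let ?Q = "maxQ I"
  have Q1: "1 \<le> ?Q" by (simp add: maxQ_def)
  have "length (states (aut_of A)) \<le> ?Q" if "A \<in> set (auts I)" for A
  proof -
    have "nst A \<le> ?Q" unfolding maxQ_def using that by (intro Max_ge) auto
    then show ?thesis using states_bound[of A] assms that by (auto simp: inst_wf_def)
  qed
  then have "prod_list (map (\<lambda>A. length (states A)) (map aut_of As)) \<le> ?Q ^ length As" if "set As \<subseteq> set (auts I)" for As
    using that by (induction As) (auto intro: mult_le_mono)
  from this[of "auts I"] have "length (vectors (map aut_of (auts I))) \<le> ?Q ^ nrows I"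
    by (simp add: length_vectors nrows_def)
  also have "?Q ^ nrows I \<le> 2 ^ param I"
  proof -
    have "real (?Q ^ nrows I) = 2 powr (real (nrows I) * log 2 (real ?Q))"
    proof -
      have "2 powr (real (nrows I) * log 2 (real ?Q)) = (2 powr log 2 (real ?Q)) powr real (nrows I)"
        by (simp add: powr_powr mult.commute)
      also have "\<dots> = real ?Q ^ nrows I" using Q1 by (simp add: powr_realpow)
      finally show ?thesis by simp
    qed
    also have "\<dots> \<le> 2 powr real (param I)"
      unfolding param_def by (intro powr_mono) linarith+
    also have "\<dots> = real (2 ^ param I)" by (simp add: powr_realpow)
    finally show ?thesis using of_nat_le_iff by blast
  qed
  finally show ?thesis .
qed

lemma length_le_enc_size: "length xs \<le> enc_size xs"
proof (induction xs)
  case (Cons x xs)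
  have "1 \<le> bitlen x" by (subst bitlen.simps) simp
  with Cons show ?case by (simp add: enc_size_def)
qed simp

lemma enc_doms_unfold:
  "enc_doms D = length D # concat (map (\<lambda>row. length row # concat (map (\<lambda>l. length l # l) row)) D)"
  by (simp add: enc_doms_def enc_list_def[abs_def] enc_nats_def[abs_def])

text \<open>Filtering shortens domains and keeps the shape of the matrix. This discharges the
  requirement of \<open>PT_program\<close> that the output be no longer than the input.\<close>

lemma length_prune: "length (enc_doms (prune V As G D)) \<le> length (enc_doms D)"
proof -
  have row: "length (concat (map (\<lambda>l. length l # l) r')) \<le> length (concat (map (\<lambda>l. length l # l) r))"
    if "list_all2 (\<lambda>a b. length a \<le> length b) r' r" for r' r :: "nat list list"
    using that by (induction rule: list_all2_induct) auto
  have "length (enc_doms D') \<le> length (enc_doms D)"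
    if "list_all2 (list_all2 (\<lambda>a b. length a \<le> length b)) D' D" for D' D
    unfolding enc_doms_unfold using that
  proof (induction rule: list_all2_induct)
    case (Cons r' R' r R)
    then show ?case using row[OF Cons(1)] list_all2_lengthD[OF Cons(1)] by simp
  qed simp
  moreover have "list_all2 (list_all2 (\<lambda>a b. length a \<le> length b)) (prune V As G D) D"
    by (simp add: list_all2_conv_all_nth prune_def nth_enumerate_eq)
  ultimately show ?thesis .
qed

section \<open>The complete algorithm and its running time\<close>

definition solve :: "nat list \<Rightarrow> nat list" where
  "solve xs = enc_doms (prune (vectors (fst (snd (fst (p_inst xs))))) (fst (snd (fst (p_inst xs))))
     (snd (snd (fst (p_inst xs)))) (fst (fst (p_inst xs))))"

definition work :: "nat list \<Rightarrow> nat" where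
  "work xs = sz xs + length (vectors (fst (snd (fst (p_inst xs)))))"

text \<open>Once the vectors are an argument, everything else is polynomial in the ordinary size
  \<open>sz\<close>; the measure \<open>work\<close> enters only through
  \<open>PT_vectors\<close>.\<close>

lemma PT_solve: "PT work solve"
proof -
  have le: "sz xs \<le> work xs" "length (vectors (fst (snd (fst (p_inst xs))))) \<le> work xs" for xs
    by (simp_all add: work_def)
  have "PT work (\<lambda>xs. fst (snd (fst (p_inst xs))))"
    by (rule PT_weaken[OF _ le(1)]) (intro pt_intro pt_inst)
  then have "PT work (\<lambda>xs. vectors (fst (snd (fst (p_inst xs)))))"
    by (rule PT_vectors) (rule le)+
  moreover have "PT work (\<lambda>xs. fst (p_inst xs))"
    by (rule PT_weaken[OF _ le(1)]) (intro pt_intro pt_inst)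
  ultimately have "PT work (\<lambda>xs. (vectors (fst (snd (fst (p_inst xs)))), fst (p_inst xs)))"
    by (rule PT_pair)
  moreover have "pt (\<lambda>z :: nat list list \<times> nat list list list \<times> aut list \<times> item list list.
      enc_doms (prune (fst z) (fst (snd (snd z))) (snd (snd (snd z))) (fst (snd z))))"
    unfolding enc_doms_unfold by (intro pt_intro)
  ultimately have "PT work (\<lambda>xs. (\<lambda>z. enc_doms (prune (fst z) (fst (snd (snd z))) (snd (snd (snd z))) (fst (snd z))))
      (vectors (fst (snd (fst (p_inst xs)))), fst (p_inst xs)))"
    by (rule PT_pt_comp)
  then show ?thesis by (simp add: solve_def[abs_def])
qed

lemma solve_correct:
  assumes "inst_wf I"
  shows "solve (enc_inst I @ zs) = enc_doms (dc_domains I)"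
    "length (solve (enc_inst I @ zs)) \<le> length (enc_inst I)"
    "work (enc_inst I @ zs) = sz (enc_inst I @ zs) + length (vectors (map aut_of (auts I)))"
proof -
  have p: "p_inst (enc_inst I @ zs) = ((doms I, map aut_of (auts I), map (map item_of) (gccs I)), zs)"
    using parses_inst by (simp add: parses_def)
  show 1: "solve (enc_inst I @ zs) = enc_doms (dc_domains I)"
    by (simp add: solve_def p prune_correct[OF assms])
  have "length (enc_doms (dc_domains I)) \<le> length (enc_doms (doms I))"
    unfolding prune_correct[OF assms, symmetric] by (rule length_prune)
  with 1 show "length (solve (enc_inst I @ zs)) \<le> length (enc_inst I)"
    by (simp add: enc_inst_def)
  show "work (enc_inst I @ zs) = sz (enc_inst I @ zs) + length (vectors (map aut_of (auts I)))"
    by (simp add: work_def p)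
qed

theorem theorem6:
  shows "\<exists>(P :: prog) (f :: nat \<Rightarrow> nat) (c :: nat) (d :: nat).
           computable_fun f \<and>
           (\<forall>I. inst_wf I \<longrightarrow>
              computes_within P (enc_inst I) (enc_doms (dc_domains I))
                (f (param I) * c * (inst_size I + 1) ^ d))"
proof -
  obtain Q M k where Q: "\<And>xs. xs \<noteq> [] \<Longrightarrow> \<exists>j \<le> M * length xs.
    length (solve (xs @ replicate j 0)) \<le> length xs \<longrightarrow>
    computes_within Q xs (solve (xs @ replicate j 0)) ((work (xs @ replicate j 0) + 2) ^ k)"
    by (rule PT_program[OF PT_solve]) (simp add: work_def, blast)
  \<comment> \<open>A list of numbers has size twice its length plus one and the padding is at most
    \<open>M\<close> times the input length. So \<open>work + 2\<close> is at most
    \<open>2 ^ param I\<close> times \<open>2 * M + 6\<close> times \<open>inst_size I + 1\<close>,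
    and the \<open>k\<close>-th power separates into the three factors.\<close>
  have "computes_within Q (enc_inst I) (enc_doms (dc_domains I))
      ((2 ^ k) ^ param I * (2 * M + 6) ^ k * (inst_size I + 1) ^ k)" if I: "inst_wf I" for I
  proof -
    let ?n = "length (enc_inst I)"
    have "enc_inst I \<noteq> []" using parses_inst by (simp add: parses_def)
    from Q[OF this] obtain j where j: "j \<le> M * ?n"
      "computes_within Q (enc_inst I) (enc_doms (dc_domains I)) ((work (enc_inst I @ replicate j 0) + 2) ^ k)"
      using solve_correct[OF I] by auto
    have n: "?n \<le> inst_size I" unfolding inst_size_def by (rule length_le_enc_size)
    have "work (enc_inst I @ replicate j 0) + 2 \<le> 2 * (?n + j) + 3 + 2 ^ param I"
      using solve_correct(3)[OF I] vectors_bound[OF I] by simp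
    also have "\<dots> \<le> (2 * M + 5) * (inst_size I + 1) + 2 ^ param I"
    proof -
      have "j \<le> M * inst_size I" using j(1) n by (meson mult_le_mono2 order_trans)
      then show ?thesis using n by (simp add: algebra_simps del: sz_nat_list)
    qed
    also have "\<dots> \<le> (2 * M + 5) * (inst_size I + 1) * 2 ^ param I + (inst_size I + 1) * 2 ^ param I"
      by (intro add_mono) simp_all
    also have "\<dots> = 2 ^ param I * (2 * M + 6) * (inst_size I + 1)"
      by (simp add: algebra_simps)
    finally have "(work (enc_inst I @ replicate j 0) + 2) ^ k \<le> (2 ^ param I * (2 * M + 6) * (inst_size I + 1)) ^ k"
      by (rule power_mono) simp
    also have "\<dots> = (2 ^ k) ^ param I * (2 * M + 6) ^ k * (inst_size I + 1) ^ k"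
      by (simp only: power_mult_distrib power_mult[symmetric] mult.commute[of "param I" k])
    finally show ?thesis
      using j(2) unfolding computes_within_def by (meson order_trans)
  qed
  then show ?thesis using computable_power[of k] by (intro exI conjI allI impI) assumption+
qed

end
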